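(* Let $d\in\mathbb N$, let $(A_n)_{n\ge1}$, $(Y_n)_{n\ge0}$ and the autoregressive process $X$ and max-autoregressive process $M$ be as in the context. Assume: (BD1) there exists $\gamma_1\in\mathbb N$ such that a.s. $\|A_1\|\le\gamma_1$; (PR) there exist $\kappa>0$ and $K\in\mathbb N$ such that a.s. $A_1\cdots A_K\in[\kappa,\infty)^{d\times d}$; $\lambda>0$, where $\lambda:=\lim_{n\to\infty}\frac1n\left(-\ln\|A_1\cdots A_n\|\right)$ (a.s. limit); (REG) there exists $\beta\in(2/3,1)$ such that $\lim_{x\to\infty}x^\beta P[\|Y_1\|>e^x]=0$ or $\liminf_{x\to\infty}xP[\|Y_1\|>e^x]>\lambda$. Let $y\in(0,\infty)$ be such that $P[\|Y_1\|\le y]>0$. Then the following three statements are equivalent: (XR) the autoregressive process $X$ is recurrent; (MR) the max-autoregressive process $M$ is recurrent; (RR) $\displaystyle\sum_{n\ge0}\prod_{m=0}^nP\left[\|Y_1\|\le ye^{m\lambda}\right]=\infty$. Suppose in addition that the matrices $A_n$ are the conditional mean offspring matrices of a branching process with immigration in random environment $Z$ as in the context, and that (BD2) there exists $\gamma_2\in\mathbb N$ such that a.s. $\|\mathcal V^1\|,\dots,\|\mathcal V^d\|\le\gamma_2$, where $\mathcal V^j$ is the conditional covariance matrix of the vector $(\xi_{0,1,1}^{i,j})_{i=1,\dots,d}$ given $\Psi$. Then (XR), (MR) and (RR) are equivalent to (ZR) the branching process with immigration $Z$ is recurrent.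
   Context: Notation: $\mathbb N=\{1,2,\dots\}$, $\mathbb N_0=\mathbb N\cup\{0\}$. $\|\cdot\|$ is the $\ell_\infty$-norm on $\mathbb R^d$ and the associated matrix norm (maximum absolute row sum); $[x]_i$ is the $i$-th coordinate of a vector $x$. Maxima of vectors are taken coordinatewise. Standing setting: $Y=(Y_n)_{n\ge0}$ is a sequence of $[0,\infty)^d$-valued random vectors and $(A_n)_{n\ge1}$ a sequence of $[0,\infty)^{d\times d}$-valued random matrices such that $(A_n,Y_n)_{n\ge1}$ is i.i.d. and independent of $Y_0$; the support of the law of $Y_1$ is unbounded. The a.s. limit defining $\lambda$ exists and is deterministic whenever $E[\ln_+\|A_1\|]<\infty$. Autoregressive process: $X_0:=Y_0$, $X_n:=A_nX_{n-1}+Y_n$ for $n\ge1$. Max-autoregressive process: $M_0:=Y_0$, $M_n:=\max\{A_nM_{n-1},Y_n\}$ for $n\ge1$. Branching process with immigration in random environment: let $\Phi$ be the set of measurable functions $[0,1]\to\mathbb N_0^d$. Let $\Psi=(\Psi_n)_{n\ge1}=((\Psi_n^j)_{j=1,\dots,d})_{n\ge1}$ be an i.i.d. sequence of $\Phi^d$-valued random variables (the random environment) such that $(\Psi_n,Y_n)_{n\ge1}$ is i.i.d. and independent of $Y_0$. Let $(U_{m,n,k}^j)_{0\le m<n;\,k\ge1;\,1\le j\le d}$ be i.i.d. uniform on $[0,1]$, independent of $(\Psi,Y)$, and set $\xi_{m,n,k}^{i,j}:=[\Psi_n^j(U_{m,n,k}^j)]_i$. Let $\lfloor Y_m\rfloor$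 be the vector of integer parts of the components of $Y_m$. For $m\ge0$ set $B_{m,m}:=\lfloor Y_m\rfloor$ and $$B_{m,n}:=\Big(\sum_{j=1}^d\sum_{k=1}^{[B_{m,n-1}]_j}\xi_{m,n,k}^{i,j}\Big)_{i=1,\dots,d},\qquad n\ge m+1.$$ Then $Z_n:=\sum_{m=0}^nB_{m,n}$, $n\ge0$. The associated conditional mean offspring matrices are $A_n:=(E[\xi_{0,n,1}^{i,j}\mid\Psi])_{i,j=1,\dots,d}$, assumed to be $[0,\infty)^{d\times d}$-valued. Recurrence: each of $V\in\{X,M,Z\}$ is a Markov chain on $[0,\infty)^d$; it is called recurrent if there exists $b\in(0,\infty)$ such that $\sum_{n\ge0}P[\|V_n\|\le b]=\infty$ for the chain started at $0$ (i.e. with $Y_0$ replaced by $0$). (This property does not depend on the initial state.) *)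

theory Defs
  imports "HOL-Probability.Probability"
begin

text \<open>
  Vectors in $R^d$ are \<open>real ^ 'd\<close> for a finite index type \<open>'d\<close>, matrices are \<open>real ^ 'd ^ 'd\<close> with
  \<open>A $ i $ j\<close> the entry in row \<open>i\<close> and column \<open>j\<close>. The vector norm is \<open>infnorm\<close>; \<open>norm\<close> is Euclidean
  on these types and is not used.
\<close>

definition matnorm :: "real ^ 'd ^ 'd \<Rightarrow> real" where
  "matnorm A = Max (range (\<lambda>i. \<Sum>j\<in>UNIV. \<bar>A $ i $ j\<bar>))"

primrec mat_prod :: "(nat \<Rightarrow> real ^ 'd ^ 'd) \<Rightarrow> nat \<Rightarrow> real ^ 'd ^ 'd" where
  "mat_prod A 0 = mat 1"
| "mat_prod A (Suc n) = mat_prod A n ** A (Suc n)"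

definition law_support :: "'a::topological_space measure \<Rightarrow> 'a set" where
  "law_support N = {x. \<forall>W. open W \<longrightarrow> x \<in> W \<longrightarrow> 0 < emeasure N W}"

text \<open>
  Independence of two random variables with possibly different value types; the library's
  \<open>indep_var\<close> needs a common one.
\<close>

definition indep_rvs ::
  "'w measure \<Rightarrow> 'a measure \<Rightarrow> ('w \<Rightarrow> 'a) \<Rightarrow> 'b measure \<Rightarrow> ('w \<Rightarrow> 'b) \<Rightarrow> bool" where
  "indep_rvs M S X T Y \<longleftrightarrow>
     X \<in> M \<rightarrow>\<^sub>M S \<and> Y \<in> M \<rightarrow>\<^sub>M T \<and>
     prob_space.indep_set M (sets (vimage_algebra (space M) X S)) (sets (vimage_algebra (space M) Y T))"

definition iid_indep_of_initial ::
  "'w measure \<Rightarrow> 'a measure \<Rightarrow> (nat \<Rightarrow> 'w \<Rightarrow> 'a) \<Rightarrow> ('w \<Rightarrow> real ^ 'd) \<Rightarrow> bool" where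
  "iid_indep_of_initial M S V V0 \<longleftrightarrow>
     prob_space.indep_vars M (\<lambda>_. S) V {1..} \<and>
     (\<forall>n\<ge>1. distr M S (V n) = distr M S (V 1)) \<and>
     indep_rvs M (\<Pi>\<^sub>M n\<in>{1..}. S) (\<lambda>\<omega>. \<lambda>n\<in>{1..}. V n \<omega>) borel V0"

text \<open>The matrix \<open>A 0\<close> is never used.\<close>

definition random_affine_setting ::
  "'w measure \<Rightarrow> (nat \<Rightarrow> 'w \<Rightarrow> real ^ 'd ^ 'd) \<Rightarrow> (nat \<Rightarrow> 'w \<Rightarrow> real ^ 'd) \<Rightarrow> bool" where
  "random_affine_setting M A Y \<longleftrightarrow>
     prob_space M \<and>
     (\<forall>n. \<forall>\<omega>\<in>space M. \<forall>i. 0 \<le> Y n \<omega> $ i) \<and>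
     (\<forall>n\<ge>1. \<forall>\<omega>\<in>space M. \<forall>i j. 0 \<le> A n \<omega> $ i $ j) \<and>
     iid_indep_of_initial M (borel \<Otimes>\<^sub>M borel) (\<lambda>n \<omega>. (A n \<omega>, Y n \<omega>)) (Y 0) \<and>
     \<not> bounded (law_support (distr M borel (Y 1)))"

definition has_decay_rate :: "'w measure \<Rightarrow> (nat \<Rightarrow> 'w \<Rightarrow> real ^ 'd ^ 'd) \<Rightarrow> real \<Rightarrow> bool" where
  "has_decay_rate M A l \<longleftrightarrow>
     (AE \<omega> in M. (\<lambda>n. (- ln (matnorm (mat_prod (\<lambda>k. A k \<omega>) n))) / real n) \<longlonglongrightarrow> l)"

primrec ar_process ::
  "(nat \<Rightarrow> 'w \<Rightarrow> real ^ 'd ^ 'd) \<Rightarrow> (nat \<Rightarrow> 'w \<Rightarrow> real ^ 'd) \<Rightarrow> nat \<Rightarrow> 'w \<Rightarrow> real ^ 'd" where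
  "ar_process A Y 0 = Y 0"
| "ar_process A Y (Suc n) = (\<lambda>\<omega>. A (Suc n) \<omega> *v ar_process A Y n \<omega> + Y (Suc n) \<omega>)"

primrec max_ar_process ::
  "(nat \<Rightarrow> 'w \<Rightarrow> real ^ 'd ^ 'd) \<Rightarrow> (nat \<Rightarrow> 'w \<Rightarrow> real ^ 'd) \<Rightarrow> nat \<Rightarrow> 'w \<Rightarrow> real ^ 'd" where
  "max_ar_process A Y 0 = Y 0"
| "max_ar_process A Y (Suc n) =
     (\<lambda>\<omega>. \<chi> i. max ((A (Suc n) \<omega> *v max_ar_process A Y n \<omega>) $ i) (Y (Suc n) \<omega> $ i))"

text \<open>
  Recurrence is a statement about the chain started at 0, so the processes below are fed with
  \<open>start_at_zero Y\<close>.
\<close>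

definition start_at_zero :: "(nat \<Rightarrow> 'w \<Rightarrow> real ^ 'd) \<Rightarrow> nat \<Rightarrow> 'w \<Rightarrow> real ^ 'd" where
  "start_at_zero Y = Y(0 := \<lambda>\<omega>. 0)"

definition infinite_expected_visits :: "'w measure \<Rightarrow> (nat \<Rightarrow> 'w \<Rightarrow> real ^ 'd) \<Rightarrow> bool" where
  "infinite_expected_visits M V \<longleftrightarrow>
     (\<exists>b>0. (\<Sum>n. ennreal (\<P>(\<omega> in M. infnorm (V n \<omega>) \<le> b))) = \<infinity>)"

definition ar_recurrent ::
  "'w measure \<Rightarrow> (nat \<Rightarrow> 'w \<Rightarrow> real ^ 'd ^ 'd) \<Rightarrow> (nat \<Rightarrow> 'w \<Rightarrow> real ^ 'd) \<Rightarrow> bool" where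
  "ar_recurrent M A Y \<longleftrightarrow> infinite_expected_visits M (ar_process A (start_at_zero Y))"

definition max_ar_recurrent ::
  "'w measure \<Rightarrow> (nat \<Rightarrow> 'w \<Rightarrow> real ^ 'd ^ 'd) \<Rightarrow> (nat \<Rightarrow> 'w \<Rightarrow> real ^ 'd) \<Rightarrow> bool" where
  "max_ar_recurrent M A Y \<longleftrightarrow> infinite_expected_visits M (max_ar_process A (start_at_zero Y))"


text \<open>
  Branching processes with immigration in random environment. The uniform distribution on $[0,1]$ is
  Lebesgue measure restricted to $[0,1]$; it also serves as the measurable space $[0,1]$.
\<close>

definition unif01 :: "real measure" where
  "unif01 = restrict_space lborel {0..1}"

definition offspring_functions :: "(real \<Rightarrow> nat ^ 'd) set" where
  "offspring_functions = extensional {0..1} \<inter> (unif01 \<rightarrow>\<^sub>M count_space UNIV)"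

type_synonym 'd env = "'d \<Rightarrow> real \<Rightarrow> nat ^ 'd"

text \<open>
  A measurable space of environments: a set of \<open>'d\<close>-tuples of offspring functions with a sigma-algebra
  that makes evaluation jointly measurable, so that \<open>\<Psi>\<^sup>j(U)\<close> is a random variable. The space
  must not be required to contain all tuples: by a theorem of Aumann no sigma-algebra on the set of all
  Borel functions makes evaluation jointly measurable.
\<close>

definition env_space :: "('d::finite) env measure \<Rightarrow> bool" where
  "env_space E \<longleftrightarrow>
     space E \<subseteq> {\<psi>. \<forall>j. \<psi> j \<in> offspring_functions} \<and>
     (\<forall>j. (\<lambda>(\<psi>, u). \<psi> j u) \<in> E \<Otimes>\<^sub>M unif01 \<rightarrow>\<^sub>M count_space UNIV)"

definition U_index :: "(nat \<times> nat \<times> nat \<times> 'd) set" where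
  "U_index = {(m, n, k, j). m < n \<and> 1 \<le> k}"

definition branching_setting ::
  "'w measure \<Rightarrow> ('d::finite) env measure \<Rightarrow> (nat \<Rightarrow> 'w \<Rightarrow> 'd env) \<Rightarrow>
   (nat \<Rightarrow> nat \<Rightarrow> nat \<Rightarrow> 'd \<Rightarrow> 'w \<Rightarrow> real) \<Rightarrow> (nat \<Rightarrow> 'w \<Rightarrow> real ^ 'd) \<Rightarrow> bool" where
  "branching_setting M E \<Psi> U Y \<longleftrightarrow>
     env_space E \<and>
     iid_indep_of_initial M (E \<Otimes>\<^sub>M borel) (\<lambda>n \<omega>. (\<Psi> n \<omega>, Y n \<omega>)) (Y 0) \<and>
     prob_space.indep_vars M (\<lambda>_. unif01) (\<lambda>(m, n, k, j). U m n k j) U_index \<and>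
     (\<forall>(m, n, k, j)\<in>U_index. distr M unif01 (U m n k j) = unif01) \<and>
     indep_rvs M
       (\<Pi>\<^sub>M p\<in>U_index. unif01) (\<lambda>\<omega>. \<lambda>(m, n, k, j)\<in>U_index. U m n k j \<omega>)
       ((\<Pi>\<^sub>M n\<in>{1..}. E) \<Otimes>\<^sub>M (\<Pi>\<^sub>M n\<in>UNIV. borel))
       (\<lambda>\<omega>. (\<lambda>n\<in>{1..}. \<Psi> n \<omega>, \<lambda>n. Y n \<omega>))"

definition offspring ::
  "(nat \<Rightarrow> 'w \<Rightarrow> ('d::finite) env) \<Rightarrow> (nat \<Rightarrow> nat \<Rightarrow> nat \<Rightarrow> 'd \<Rightarrow> 'w \<Rightarrow> real) \<Rightarrow>
   nat \<Rightarrow> nat \<Rightarrow> nat \<Rightarrow> 'd \<Rightarrow> 'd \<Rightarrow> 'w \<Rightarrow> nat" where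
  "offspring \<Psi> U m n k i j \<omega> = \<Psi> n \<omega> j (U m n k j \<omega>) $ i"

text \<open>
  The generation at time \<open>m + l\<close> of the family immigrated at time \<open>m\<close>.
\<close>

primrec family_after ::
  "(nat \<Rightarrow> 'w \<Rightarrow> ('d::finite) env) \<Rightarrow> (nat \<Rightarrow> nat \<Rightarrow> nat \<Rightarrow> 'd \<Rightarrow> 'w \<Rightarrow> real) \<Rightarrow>
   (nat \<Rightarrow> 'w \<Rightarrow> real ^ 'd) \<Rightarrow> nat \<Rightarrow> nat \<Rightarrow> 'w \<Rightarrow> nat ^ 'd" where
  "family_after \<Psi> U Y m 0 = (\<lambda>\<omega>. \<chi> i. nat \<lfloor>Y m \<omega> $ i\<rfloor>)"
| "family_after \<Psi> U Y m (Suc l) =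
     (\<lambda>\<omega>. \<chi> i. \<Sum>j\<in>UNIV. \<Sum>k = 1..family_after \<Psi> U Y m l \<omega> $ j.
        offspring \<Psi> U m (m + Suc l) k i j \<omega>)"

definition branching_process ::
  "(nat \<Rightarrow> 'w \<Rightarrow> ('d::finite) env) \<Rightarrow> (nat \<Rightarrow> nat \<Rightarrow> nat \<Rightarrow> 'd \<Rightarrow> 'w \<Rightarrow> real) \<Rightarrow>
   (nat \<Rightarrow> 'w \<Rightarrow> real ^ 'd) \<Rightarrow> nat \<Rightarrow> 'w \<Rightarrow> nat ^ 'd" where
  "branching_process \<Psi> U Y n \<omega> = (\<Sum>m=0..n. family_after \<Psi> U Y m (n - m) \<omega>)"

definition branching_recurrent ::
  "'w measure \<Rightarrow> (nat \<Rightarrow> 'w \<Rightarrow> ('d::finite) env) \<Rightarrow> (nat \<Rightarrow> nat \<Rightarrow> nat \<Rightarrow> 'd \<Rightarrow> 'w \<Rightarrow> real) \<Rightarrow>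
   (nat \<Rightarrow> 'w \<Rightarrow> real ^ 'd) \<Rightarrow> bool" where
  "branching_recurrent M \<Psi> U Y \<longleftrightarrow>
     infinite_expected_visits M (\<lambda>n \<omega>. \<chi> i. real (branching_process \<Psi> U (start_at_zero Y) n \<omega> $ i))"

definition env_algebra ::
  "'w measure \<Rightarrow> ('d::finite) env measure \<Rightarrow> (nat \<Rightarrow> 'w \<Rightarrow> 'd env) \<Rightarrow> 'w measure" where
  "env_algebra M E \<Psi> =
     vimage_algebra (space M) (\<lambda>\<omega>. \<lambda>n\<in>{1..}. \<Psi> n \<omega>) (\<Pi>\<^sub>M n\<in>{1..}. E)"

text \<open>
  Stated with \<open>nn_cond_exp\<close> because \<open>real_cond_exp\<close> is 0 where the conditional mean is infinite; here
  the conditional means are forced to be finite.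
\<close>

definition conditional_mean_offspring ::
  "'w measure \<Rightarrow> ('d::finite) env measure \<Rightarrow> (nat \<Rightarrow> 'w \<Rightarrow> 'd env) \<Rightarrow>
   (nat \<Rightarrow> nat \<Rightarrow> nat \<Rightarrow> 'd \<Rightarrow> 'w \<Rightarrow> real) \<Rightarrow> (nat \<Rightarrow> 'w \<Rightarrow> real ^ 'd ^ 'd) \<Rightarrow> bool" where
  "conditional_mean_offspring M E \<Psi> U A \<longleftrightarrow>
     (\<forall>n\<ge>1. \<forall>i j. AE \<omega> in M.
        nn_cond_exp M (env_algebra M E \<Psi>) (\<lambda>\<omega>. of_nat (offspring \<Psi> U 0 n 1 i j \<omega>)) \<omega> =
        ennreal (A n \<omega> $ i $ j))"

definition cond_cov_matrix ::
  "'w measure \<Rightarrow> 'w measure \<Rightarrow> ('d \<Rightarrow> 'w \<Rightarrow> real) \<Rightarrow> 'w \<Rightarrow> real ^ 'd ^ 'd" where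
  "cond_cov_matrix M F \<xi> \<omega> =
     (\<chi> i k. real_cond_exp M F
        (\<lambda>\<omega>. (\<xi> i \<omega> - real_cond_exp M F (\<xi> i) \<omega>) * (\<xi> k \<omega> - real_cond_exp M F (\<xi> k) \<omega>)) \<omega>)"

text \<open>
  The first conjunct, finiteness of the conditional second moments, says that the conditional
  covariances exist; otherwise the value of \<open>real_cond_exp\<close> would be meaningless.
\<close>

definition bounded_offspring_covariance ::
  "'w measure \<Rightarrow> ('d::finite) env measure \<Rightarrow> (nat \<Rightarrow> 'w \<Rightarrow> 'd env) \<Rightarrow>
   (nat \<Rightarrow> nat \<Rightarrow> nat \<Rightarrow> 'd \<Rightarrow> 'w \<Rightarrow> real) \<Rightarrow> bool" where
  "bounded_offspring_covariance M E \<Psi> U \<longleftrightarrow>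
     (\<forall>i j. AE \<omega> in M.
        nn_cond_exp M (env_algebra M E \<Psi>) (\<lambda>\<omega>. (of_nat (offspring \<Psi> U 0 1 1 i j \<omega>))\<^sup>2) \<omega> < \<infinity>) \<and>
     (\<exists>\<gamma>\<^sub>2::nat. 1 \<le> \<gamma>\<^sub>2 \<and>
        (AE \<omega> in M. \<forall>j.
           matnorm (cond_cov_matrix M (env_algebra M E \<Psi>)
             (\<lambda>i \<omega>. real (offspring \<Psi> U 0 1 1 i j \<omega>)) \<omega>) \<le> real \<gamma>\<^sub>2))"

end

theory Submission
  imports Defs "HOL-Real_Asymp.Real_Asymp"
begin

text \<open>
  Read backwards from time \<open>n\<close>, the contribution of the immigrants at age \<open>m\<close> is \<open>P\<^sub>m Y\<^sub>m\<close> with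
  \<open>P\<^sub>m = A\<^sub>0 \<cdots> A\<^sub>m\<^sub>-\<^sub>1\<close>. By (PR) the logarithm of \<open>P\<^sub>m\<close> is additive up to a bounded error, so Hoeffding's lemma
  gives \<open>ln \<parallel>P\<^sub>m\<parallel> = - \<lambda> m + O(m\<^sup>\<alpha>)\<close> outside a bad event of probability \<open>exp (- c m\<^sup>2\<^sup>\<alpha>\<^sup>-\<^sup>1)\<close>, for any
  \<open>\<alpha> > 1/2\<close>. The process is small at time \<open>n\<close> essentially when all \<open>\<parallel>Y\<^sub>m\<parallel>\<close> lie below
  \<open>exp (\<lambda> m \<plusminus> O(m\<^sup>\<alpha>))\<close>. Decomposing at the last bad time \<open>r\<close> costs a factor
  \<open>exp (- c r\<^sup>2\<^sup>\<alpha>\<^sup>-\<^sup>1 + C r\<^sup>1\<^sup>-\<^sup>\<beta>)\<close>, and replacing the thresholds by \<open>y exp (\<lambda> m)\<close> costs a bounded factor if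
  \<open>\<alpha> < \<beta>\<close>, since then \<open>E (ln\<^sub>+ \<parallel>Y\<parallel>)\<^sup>\<alpha>\<close> is finite. Both are affordable when
  \<open>1 - \<beta> < 2 \<alpha> - 1\<close> and \<open>\<alpha> < \<beta>\<close>, which is possible because \<open>\<beta> > 2/3\<close>; in the second alternative of (REG)
  everything is transient. For the branching process, given the environment, the mean is at most the
  autoregressive process (Markov), and a family with large mean survives by Chebyshev's inequality.
\<close>

section \<open>Nonnegative matrices\<close>

text \<open>The obstacle is dependence. The product at age \<open>m\<close> contains the matrices of
  all smaller ages, and each matrix may depend on the immigration of its own time, so smallness of
  the contributions is not an intersection of independent events. Badness at time \<open>r\<close>
  is therefore defined through coordinates below \<open>r\<close> only. After the last bad time the
  size of the products is known up to a small exponent, what remains is a condition on each single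
  immigrant vector, and every term of the decomposition factorises.

  Two facts then serve all three processes. If the series in (RR) diverges, a bound on the sum of
  all contributions makes the autoregressive process recurrent; domination and Markov's inequality
  pass this on to the other two. If it converges, one functional, \<open>survival_bound\<close>,
  dominates the return probabilities of both the max-autoregressive and the branching process.
  Recurrence involves only the law at each fixed time, which is what permits a separate time
  reversal for every \<open>n\<close>.\<close>

definition esum :: "real ^ 'd ^ 'd \<Rightarrow> real" where
  "esum A = (\<Sum>i\<in>UNIV. \<Sum>j\<in>UNIV. A $ i $ j)"

definition vsum :: "real ^ 'd \<Rightarrow> real" where
  "vsum v = (\<Sum>i\<in>UNIV. v $ i)"

definition nonneg_mat :: "real ^ 'd ^ 'd \<Rightarrow> bool" where
  "nonneg_mat A \<longleftrightarrow> (\<forall>i j. 0 \<le> A $ i $ j)"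

definition nonneg_vec :: "real ^ 'd \<Rightarrow> bool" where
  "nonneg_vec v \<longleftrightarrow> (\<forall>i. 0 \<le> v $ i)"

text \<open>Indices start at 0 because they will mostly be ages, counted backwards from the
  present.\<close>

primrec lprod :: "(nat \<Rightarrow> real ^ 'd ^ 'd) \<Rightarrow> nat \<Rightarrow> real ^ 'd ^ 'd" where
  "lprod a 0 = mat 1"
| "lprod a (Suc n) = lprod a n ** a n"

lemma lprod_add: "lprod a (m + l) = lprod a m ** lprod (\<lambda>i. a (m + i)) l"
  by (induction l) (simp_all add: matrix_mul_assoc)

lemma lprod_cong: "(\<And>i. i < n \<Longrightarrow> a i = b i) \<Longrightarrow> lprod a n = lprod b n"
  by (induction n) simp_all

lemma lprod_Suc_shift: "lprod a (Suc n) = a 0 ** lprod (\<lambda>i. a (Suc i)) n"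
  using lprod_add[of a 1 n] by simp

lemma mat_prod_eq_lprod: "mat_prod a n = lprod (\<lambda>i. a (Suc i)) n"
  by (induction n) simp_all

lemma nonneg_mat_mult: "nonneg_mat A \<Longrightarrow> nonneg_mat B \<Longrightarrow> nonneg_mat (A ** B)"
  by (auto simp: nonneg_mat_def matrix_matrix_mult_def intro!: sum_nonneg)

lemma nonneg_mat_one: "nonneg_mat (mat 1)"
  by (auto simp: nonneg_mat_def mat_def)

lemma nonneg_mat_lprod: "(\<And>i. i < n \<Longrightarrow> nonneg_mat (a i)) \<Longrightarrow> nonneg_mat (lprod a n)"
  by (induction n) (auto intro: nonneg_mat_mult nonneg_mat_one)

lemma nonneg_vec_mult: "nonneg_mat A \<Longrightarrow> nonneg_vec v \<Longrightarrow> nonneg_vec (A *v v)"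
  by (auto simp: nonneg_mat_def nonneg_vec_def matrix_vector_mult_def intro!: sum_nonneg)

lemma nonneg_vec_one: "nonneg_vec 1"
  by (auto simp: nonneg_vec_def)

text \<open>The reason for measuring by entry sums instead of \<open>matnorm\<close>: on nonnegative
  matrices both agree up to the dimension, but entry sums are linear, and facts about matrices
  become facts about vectors applied to the vector 1.\<close>

lemma esum_eq_vsum: "esum A = vsum (A *v 1)"
  by (simp add: esum_def vsum_def matrix_vector_mult_def)

lemma vsum_nonneg: "nonneg_vec v \<Longrightarrow> 0 \<le> vsum v"
  by (auto simp: vsum_def nonneg_vec_def intro!: sum_nonneg)

lemma esum_nonneg: "nonneg_mat A \<Longrightarrow> 0 \<le> esum A"
  by (auto simp: esum_def nonneg_mat_def intro!: sum_nonneg)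

lemma vec_le_vsum: "nonneg_vec v \<Longrightarrow> v $ i \<le> vsum v"
  unfolding vsum_def by (rule member_le_sum) (auto simp: nonneg_vec_def)

lemma vsum_mult: "vsum (A *v v) = (\<Sum>j\<in>UNIV. (\<Sum>i\<in>UNIV. A $ i $ j) * v $ j)"
  unfolding vsum_def matrix_vector_mult_def
  by (simp add: sum_distrib_right) (rule sum.swap)

lemma vsum_mult_le:
  assumes "nonneg_mat A" "nonneg_vec v"
  shows "vsum (A *v v) \<le> esum A * vsum v"
proof -
  have "esum A = (\<Sum>j\<in>UNIV. \<Sum>i\<in>UNIV. A $ i $ j)"
    unfolding esum_def by (rule sum.swap)
  then have "esum A * vsum v = (\<Sum>j\<in>UNIV. (\<Sum>i\<in>UNIV. A $ i $ j) * vsum v)"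
    by (simp add: sum_distrib_right)
  also have "\<dots> \<ge> (\<Sum>j\<in>UNIV. (\<Sum>i\<in>UNIV. A $ i $ j) * v $ j)"
    using assms by (intro sum_mono mult_left_mono vec_le_vsum sum_nonneg) (auto simp: nonneg_mat_def)
  finally show ?thesis by (simp add: vsum_mult)
qed

lemma esum_mult_le:
  assumes "nonneg_mat A" "nonneg_mat B"
  shows "esum (A ** B) \<le> esum A * esum B"
  using vsum_mult_le[OF assms(1) nonneg_vec_mult[OF assms(2) nonneg_vec_one]]
  by (simp add: esum_eq_vsum matrix_vector_mul_assoc)

text \<open>An entrywise positive factor makes \<open>v\<close> forget its direction: every
  coordinate of \<open>B *v v\<close> is at least \<open>k * vsum v\<close>, so every column of
  \<open>A\<close> is reached. Each use of (PR) goes through this converse of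
  \<open>vsum_mult_le\<close>.\<close>

lemma vsum_mult_ge:
  assumes "nonneg_mat A" "nonneg_vec v" "\<And>i j. k \<le> B $ i $ j"
  shows "k * esum A * vsum v \<le> vsum (A *v (B *v v))"
proof -
  have 1: "k * vsum v \<le> (B *v v) $ i" for i
    unfolding matrix_vector_mult_def vsum_def using assms
    by (auto simp: sum_distrib_left nonneg_vec_def intro!: sum_mono mult_right_mono)
  have "k * esum A * vsum v = (\<Sum>j\<in>UNIV. (\<Sum>i\<in>UNIV. A $ i $ j) * (k * vsum v))"
    unfolding esum_def by (subst sum.swap) (simp add: sum_distrib_right sum_distrib_left mult_ac)
  also have "\<dots> \<le> (\<Sum>j\<in>UNIV. (\<Sum>i\<in>UNIV. A $ i $ j) * (B *v v) $ j)"
    using assms by (intro sum_mono mult_left_mono 1 sum_nonneg) (auto simp: nonneg_mat_def)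
  finally show ?thesis by (simp add: vsum_mult)
qed

lemma vsum_one: "vsum (1 :: real ^ 'd) \<ge> 1"
proof -
  have "card (UNIV :: 'd set) > 0" by (simp add: card_gt_0_iff)
  then show ?thesis by (simp add: vsum_def)
qed

lemma esum_one: "esum (mat 1 :: real ^ 'd ^ 'd) = vsum (1 :: real ^ 'd)"
  by (simp add: esum_eq_vsum)

lemma matnorm_bounds:
  fixes A :: "real ^ 'd ^ 'd"
  assumes "nonneg_mat A"
  shows "matnorm A \<le> esum A" "esum A \<le> vsum (1 :: real ^ 'd) * matnorm A"
proof -
  have f: "matnorm A = Max (range (\<lambda>i. \<Sum>j\<in>UNIV. A $ i $ j))"
    using assms by (simp add: matnorm_def nonneg_mat_def)
  have "(\<Sum>j\<in>UNIV. A $ i $ j) \<le> esum A" for i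
    unfolding esum_def using assms
    by (intro member_le_sum) (auto simp: nonneg_mat_def intro!: sum_nonneg)
  then show "matnorm A \<le> esum A" unfolding f by (subst Max_le_iff) auto
  have "(\<Sum>j\<in>UNIV. A $ i $ j) \<le> matnorm A" for i
    unfolding f by (intro Max_ge) auto
  then have "esum A \<le> (\<Sum>i\<in>(UNIV::'d set). matnorm A)"
    unfolding esum_def by (intro sum_mono)
  then show "esum A \<le> vsum (1 :: real ^ 'd) * matnorm A"
    by (simp add: vsum_def)
qed

lemma infnorm_bounds:
  fixes v :: "real ^ 'd"
  assumes "nonneg_vec v"
  shows "infnorm v \<le> vsum v" "vsum v \<le> vsum (1 :: real ^ 'd) * infnorm v"
proof -
  have "\<bar>v $ i\<bar> \<le> vsum v" for i
    using vec_le_vsum[OF assms, of i] assms by (auto simp: nonneg_vec_def)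
  then show "infnorm v \<le> vsum v"
    unfolding infnorm_cart by (intro cSup_least) auto
  have "v $ i \<le> infnorm v" for i
    using component_le_infnorm_cart[of v i] by simp
  then have "vsum v \<le> (\<Sum>i\<in>(UNIV::'d set). infnorm v)"
    unfolding vsum_def by (intro sum_mono)
  then show "vsum v \<le> vsum (1 :: real ^ 'd) * infnorm v"
    by (simp add: vsum_def)
qed

text \<open>(BD1) and (PR) as a deterministic property of a whole sequence. Positivity of blocks is
  asked at every starting point, so that the property passes to tails and the inequalities below
  hold path by path.\<close>

definition admissible :: "real \<Rightarrow> real \<Rightarrow> nat \<Rightarrow> (nat \<Rightarrow> real ^ 'd ^ 'd) \<Rightarrow> bool" where
  "admissible G \<kappa> K a \<longleftrightarrow>
     (\<forall>i. nonneg_mat (a i)) \<and> (\<forall>i. esum (a i) \<le> G) \<and>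
     (\<forall>i p q. \<kappa> \<le> lprod (\<lambda>j. a (i + j)) K $ p $ q)"

lemma admissible_shift: "admissible G \<kappa> K a \<Longrightarrow> admissible G \<kappa> K (\<lambda>i. a (m + i))"
  unfolding admissible_def by (auto simp: add.assoc[symmetric])

section \<open>Products along an admissible sequence\<close>

context
  fixes G \<kappa> :: real and K :: nat and a :: "nat \<Rightarrow> real ^ 'd ^ 'd"
  assumes G: "1 \<le> G" and \<kappa>: "0 < \<kappa>" "\<kappa> \<le> 1" and K: "1 \<le> K" and adm: "admissible G \<kappa> K a"
begin

lemma adm_nonneg: "nonneg_mat (lprod (\<lambda>j. a (i + j)) n)"
  using adm by (intro nonneg_mat_lprod) (auto simp: admissible_def)

lemma adm_nonneg0: "nonneg_mat (lprod a n)"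
  using adm_nonneg[of 0 n] by simp

lemma adm_esum_le: "esum (A ** lprod (\<lambda>j. a (i + j)) n) \<le> G ^ n * esum A" if "nonneg_mat A"
proof (induction n)
  case (Suc n)
  have "esum (A ** lprod (\<lambda>j. a (i + j)) (Suc n)) = esum ((A ** lprod (\<lambda>j. a (i + j)) n) ** a (i + n))"
    by (simp add: matrix_mul_assoc)
  also have "\<dots> \<le> esum (A ** lprod (\<lambda>j. a (i + j)) n) * esum (a (i + n))"
    using adm that by (intro esum_mult_le nonneg_mat_mult adm_nonneg) (auto simp: admissible_def)
  also have "\<dots> \<le> (G ^ n * esum A) * G"
    using adm G that Suc by (intro mult_mono esum_nonneg mult_nonneg_nonneg) (auto simp: admissible_def)
  finally show ?case by (simp add: mult_ac)
qed simp

lemma adm_vsum_le: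
  assumes v: "nonneg_vec v"
  shows "vsum (lprod (\<lambda>j. a (i + j)) n *v v) \<le> G ^ n * vsum v"
  using v
proof (induction n arbitrary: v)
  case (Suc n)
  have 1: "nonneg_vec (a (i + n) *v v)"
    using Suc adm by (auto intro!: nonneg_vec_mult simp: admissible_def)
  have "vsum (lprod (\<lambda>j. a (i + j)) (Suc n) *v v) = vsum (lprod (\<lambda>j. a (i + j)) n *v (a (i + n) *v v))"
    by (simp add: matrix_vector_mul_assoc)
  also have "\<dots> \<le> G ^ n * vsum (a (i + n) *v v)" using Suc.IH[OF 1] .
  also have "vsum (a (i + n) *v v) \<le> esum (a (i + n)) * vsum v"
    using Suc adm by (intro vsum_mult_le) (auto simp: admissible_def)
  also have "\<dots> \<le> G * vsum v"
    using adm Suc.prems by (intro mult_right_mono vsum_nonneg) (auto simp: admissible_def)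
  finally show ?case using G by (simp add: mult_ac)
qed simp

lemma adm_block_vsum:
  assumes "nonneg_mat A" "nonneg_vec v"
  shows "\<kappa> * esum A * vsum v \<le> vsum (A *v (lprod (\<lambda>j. a (i + j)) K *v v))"
  using adm by (intro vsum_mult_ge assms) (auto simp: admissible_def)

lemma adm_block_esum: "nonneg_mat A \<Longrightarrow> \<kappa> * esum A \<le> esum (A ** lprod (\<lambda>j. a (i + j)) K)"
proof -
  assume A: "nonneg_mat A"
  have "\<kappa> * esum A * 1 \<le> \<kappa> * esum A * vsum (1 :: real ^ 'd)"
    using \<kappa> esum_nonneg[OF A] by (intro mult_left_mono vsum_one) auto
  also have "\<dots> \<le> vsum (A *v (lprod (\<lambda>j. a (i + j)) K *v 1))"
    by (intro adm_block_vsum A nonneg_vec_one)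
  finally show ?thesis by (simp add: esum_eq_vsum matrix_vector_mul_assoc)
qed

text \<open>Mixing happens in the first \<open>K\<close> letters behind \<open>A\<close>. The upper
  bound \<open>G ^ K\<close> for the same block then turns \<open>vsum (R *v v)\<close> back into
  the full product applied to \<open>v\<close>.\<close>

lemma adm_vec_long:
  assumes A: "nonneg_mat A" and v: "nonneg_vec v" and l: "K \<le> l"
  shows "\<kappa> / G ^ K * esum A * vsum (lprod (\<lambda>j. a (i + j)) l *v v)
    \<le> vsum (A *v (lprod (\<lambda>j. a (i + j)) l *v v))"
proof -
  define R where "R = lprod (\<lambda>j. a (i + K + j)) (l - K)"
  have R: "lprod (\<lambda>j. a (i + j)) l = lprod (\<lambda>j. a (i + j)) K ** R"
    using lprod_add[of "\<lambda>j. a (i + j)" K "l - K"] l by (simp add: R_def add.assoc)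
  have nR: "nonneg_vec (R *v v)"
    unfolding R_def using v by (intro nonneg_vec_mult adm_nonneg)
  have "vsum (lprod (\<lambda>j. a (i + j)) l *v v) = vsum (lprod (\<lambda>j. a (i + j)) K *v (R *v v))"
    by (simp add: R matrix_vector_mul_assoc)
  also have "\<dots> \<le> G ^ K * vsum (R *v v)"
    by (intro adm_vsum_le nR)
  finally have "\<kappa> / G ^ K * esum A * vsum (lprod (\<lambda>j. a (i + j)) l *v v)
      \<le> \<kappa> / G ^ K * esum A * (G ^ K * vsum (R *v v))"
    using \<kappa> G esum_nonneg[OF A] by (intro mult_left_mono) auto
  also have "\<dots> = \<kappa> * esum A * vsum (R *v v)" using G by simp
  also have "\<dots> \<le> vsum (A *v (lprod (\<lambda>j. a (i + j)) K *v (R *v v)))"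
    by (intro adm_block_vsum A nR)
  finally show ?thesis by (simp add: R matrix_vector_mul_assoc)
qed

text \<open>Completing the \<open>l\<close> letters to a block of length \<open>K\<close> raises the
  entry sum by at most \<open>G ^ K\<close>, and the completed block keeps a share
  \<open>\<kappa>\<close>. So no short run of letters can annihilate a product.\<close>

lemma adm_esum_pos_step:
  assumes A: "nonneg_mat A" and l: "l \<le> K"
  shows "\<kappa> / G ^ K * esum A \<le> esum (A ** lprod (\<lambda>j. a (i + j)) l)"
proof -
  have "\<kappa> * esum A \<le> esum (A ** lprod (\<lambda>j. a (i + j)) K)" by (intro adm_block_esum A)
  also have "A ** lprod (\<lambda>j. a (i + j)) K = (A ** lprod (\<lambda>j. a (i + j)) l) ** lprod (\<lambda>j. a (i + l + j)) (K - l)"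
    using lprod_add[of "\<lambda>j. a (i + j)" l "K - l"] l by (simp add: add.assoc matrix_mul_assoc)
  also have "esum \<dots> \<le> G ^ (K - l) * esum (A ** lprod (\<lambda>j. a (i + j)) l)"
    by (intro adm_esum_le nonneg_mat_mult A adm_nonneg)
  also have "\<dots> \<le> G ^ K * esum (A ** lprod (\<lambda>j. a (i + j)) l)"
    using G by (intro mult_right_mono power_increasing esum_nonneg nonneg_mat_mult A adm_nonneg) auto
  finally show ?thesis using G by (simp add: field_simps)
qed

text \<open>A second factor of length at least \<open>K\<close> begins with a mixing block; a
  shorter one is bounded, at the price of another \<open>G ^ K\<close> and of the dimension.
  Together with \<open>esum_mult_le\<close> this makes the logarithm additive up to a
  constant.\<close>

lemma adm_esum_mult_ge:
  assumes A: "nonneg_mat A"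
  shows "\<kappa> / G ^ (2 * K) * esum A * esum (lprod (\<lambda>j. a (i + j)) l)
    \<le> esum (A ** lprod (\<lambda>j. a (i + j)) l) * vsum (1 :: real ^ 'd)"
proof (cases "K \<le> l")
  case True
  have n: "0 \<le> esum (lprod (\<lambda>j. a (i + j)) l)" "0 \<le> esum (A ** lprod (\<lambda>j. a (i + j)) l)"
    by (intro esum_nonneg adm_nonneg nonneg_mat_mult A)+
  have "\<kappa> / G ^ (2 * K) \<le> \<kappa> / G ^ K"
    using G \<kappa> by (intro divide_left_mono power_increasing) (auto intro!: mult_pos_pos)
  then have "\<kappa> / G ^ (2 * K) * esum A * esum (lprod (\<lambda>j. a (i + j)) l)
     \<le> \<kappa> / G ^ K * esum A * esum (lprod (\<lambda>j. a (i + j)) l)"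
    using n esum_nonneg[OF A] by (intro mult_right_mono) auto
  also have "\<dots> \<le> esum (A ** lprod (\<lambda>j. a (i + j)) l)"
    using adm_vec_long[OF A nonneg_vec_one True, of i]
    by (simp add: esum_eq_vsum matrix_vector_mul_assoc)
  also have "\<dots> \<le> esum (A ** lprod (\<lambda>j. a (i + j)) l) * vsum (1 :: real ^ 'd)"
    using vsum_one n mult_left_mono by fastforce
  finally show ?thesis .
next
  case False
  then have l: "l \<le> K" by simp
  have "esum (lprod (\<lambda>j. a (i + j)) l) \<le> G ^ l * vsum (1 :: real ^ 'd)"
    using adm_esum_le[OF nonneg_mat_one, of i l] by (simp add: esum_one)
  also have "\<dots> \<le> G ^ K * vsum (1 :: real ^ 'd)"
    using G vsum_one[where ?'d = 'd] l by (intro mult_right_mono power_increasing) auto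
  finally have "\<kappa> / G ^ (2 * K) * esum A * esum (lprod (\<lambda>j. a (i + j)) l)
     \<le> \<kappa> / G ^ (2 * K) * esum A * (G ^ K * vsum (1 :: real ^ 'd))"
    using G \<kappa> esum_nonneg[OF A] by (intro mult_left_mono) auto
  also have "\<dots> = (\<kappa> / G ^ K * esum A) * vsum (1 :: real ^ 'd)"
    using G by (simp add: power_mult power2_eq_square mult_2 power_add field_simps)
  also have "\<dots> \<le> esum (A ** lprod (\<lambda>j. a (i + j)) l) * vsum (1 :: real ^ 'd)"
    using vsum_one[where ?'d = 'd] by (intro mult_right_mono adm_esum_pos_step A l) auto
  finally show ?thesis .
qed

lemma adm_letter: "\<kappa> / G ^ K \<le> esum (a i)"
proof -
  have "\<kappa> / G ^ K * 1 \<le> \<kappa> / G ^ K * esum (mat 1 :: real ^ 'd ^ 'd)"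
    using G \<kappa> vsum_one[where ?'d = 'd] by (intro mult_left_mono) (auto simp: esum_one)
  also have "\<dots> \<le> esum (mat 1 ** lprod (\<lambda>j. a (i + j)) 1)"
    using K by (intro adm_esum_pos_step nonneg_mat_one) auto
  finally show ?thesis by simp
qed

text \<open>Here the mixing block sits at the far end, next to the vector: the direction of the
  starting vector costs only a constant.\<close>

lemma adm_family_end:
  assumes v: "nonneg_vec v" and m: "K \<le> m"
  shows "\<kappa> / G ^ K * esum (lprod a m) * vsum v \<le> vsum (lprod a m *v v)"
proof -
  define P where "P = lprod a (m - K)"
  have nP: "nonneg_mat P" unfolding P_def by (rule adm_nonneg0)
  have e: "lprod a m = P ** lprod (\<lambda>j. a (m - K + j)) K"
    using lprod_add[of a "m - K" K] m by (simp add: P_def)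
  have "esum (lprod a m) \<le> G ^ K * esum P"
    unfolding e by (intro adm_esum_le nP)
  then have "\<kappa> / G ^ K * esum (lprod a m) * vsum v \<le> \<kappa> / G ^ K * (G ^ K * esum P) * vsum v"
    using \<kappa> G vsum_nonneg[OF v] by (intro mult_right_mono mult_left_mono) auto
  also have "\<dots> = \<kappa> * esum P * vsum v" using G by simp
  also have "\<dots> \<le> vsum (P *v (lprod (\<lambda>j. a (m - K + j)) K *v v))"
    by (intro adm_block_vsum nP v)
  finally show ?thesis by (simp add: e matrix_vector_mul_assoc)
qed

text \<open>The factor \<open>a j\<close> itself may have zero columns, so the split leaves out one letter.\<close>

lemma adm_family_split:
  assumes v: "nonneg_vec v" and m: "2 * K \<le> m" and j: "j < m"
  shows "(\<kappa> / G ^ K)\<^sup>2 * esum (lprod a j) * vsum (lprod (\<lambda>i. a (Suc j + i)) (m - Suc j) *v v)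
    \<le> vsum (lprod a m *v v)"
proof -
  define c where "c = \<kappa> / G ^ K"
  have c: "0 < c" "c \<le> 1" using \<kappa> G by (auto simp: c_def divide_le_eq intro: order_trans[OF _ one_le_power])
  define R where "R = lprod (\<lambda>i. a (Suc j + i)) (m - Suc j)"
  have e: "lprod a m = lprod a (Suc j) ** R"
    using lprod_add[of a "Suc j" "m - Suc j"] j by (simp add: R_def)
  have nR: "nonneg_vec (R *v v)"
    unfolding R_def by (intro nonneg_vec_mult v adm_nonneg)
  \<comment> \<open>The letter \<open>a j\<close> left out of the split is put back at the price of
    one factor \<open>c\<close>.\<close>
  have 1: "c * esum (lprod a j) \<le> esum (lprod a (Suc j))"
    using adm_esum_pos_step[OF adm_nonneg0, of 1 j j] K by (simp add: c_def)
  have 2: "c * esum (lprod a (Suc j)) * vsum (R *v v) \<le> vsum (lprod a (Suc j) *v (R *v v))"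
  \<comment> \<open>The mixing block is the end of the prefix or the beginning of the remainder;
    \<open>2 * K \<le> m\<close> makes one of the two long enough.\<close>
  proof (cases "K \<le> Suc j")
    case True
    then show ?thesis unfolding c_def by (intro adm_family_end nR)
  next
    case False
    then have "K \<le> m - Suc j" using m by auto
    then show ?thesis unfolding c_def R_def by (intro adm_vec_long adm_nonneg0 v)
  qed
  have "c\<^sup>2 * esum (lprod a j) * vsum (R *v v) = c * (c * esum (lprod a j)) * vsum (R *v v)"
    by (simp add: power2_eq_square)
  also have "\<dots> \<le> c * esum (lprod a (Suc j)) * vsum (R *v v)"
    using c by (intro mult_right_mono mult_left_mono 1 vsum_nonneg nR) auto
  finally show ?thesis using 2 unfolding c_def R_def[symmetric] e by (simp add: matrix_vector_mul_assoc)
qed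

end

section \<open>Sequence spaces\<close>

text \<open>The joint law of all coordinates is the law of the identity map, hence the product
  measure itself.\<close>

lemma indep_vars_PiM_coords:
  assumes "\<And>i. i \<in> I \<Longrightarrow> prob_space (N i)" "I \<noteq> {}"
  shows "prob_space.indep_vars (PiM I N) N (\<lambda>i \<omega>. \<omega> i) I"
proof -
  interpret prob_space "PiM I N" using assms(1) by (rule prob_space_PiM)
  have "distr (PiM I N) (PiM I N) (\<lambda>x. \<lambda>i\<in>I. x i) = distr (PiM I N) (PiM I N) (\<lambda>x. x)"
    by (intro distr_cong) (auto simp: space_PiM PiE_restrict)
  also have "\<dots> = PiM I N" by (rule distr_id)
  also have "\<dots> = (\<Pi>\<^sub>M i\<in>I. distr (PiM I N) (N i) (\<lambda>\<omega>. \<omega> i))"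
    by (intro PiM_cong refl) (simp add: distr_PiM_component assms)
  finally show ?thesis
    using assms(2) by (subst indep_vars_iff_distr_eq_PiM') auto
qed

text \<open>Serves for time reversal, for shifted coordinates and for the individuals of one brood.
  Injectivity keeps a finite intersection from naming the same variable twice.\<close>

lemma (in prob_space) indep_vars_reindex:
  assumes inj: "inj_on f J" and ind: "indep_vars N X (f ` J)"
  shows "indep_vars (\<lambda>i. N (f i)) (\<lambda>i. X (f i)) J"
  unfolding indep_vars_def2 indep_sets_def
proof (intro conjI ballI allI impI)
  let ?F = "\<lambda>i. {X i -` A \<inter> space M |A. A \<in> sets (N i)}"
  show "random_variable (N (f i)) (X (f i))" if "i \<in> J" for i
    using ind that by (auto simp: indep_vars_def)
  show "?F (f i) \<subseteq> events" if "i \<in> J" for i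
    using ind that by (auto simp: indep_vars_def2 indep_sets_def)
  fix K A assume K: "K \<subseteq> J" "K \<noteq> {}" "finite K" and A: "A \<in> Pi K (\<lambda>i. ?F (f i))"
  have iK: "inj_on f K" using inj K(1) by (rule inj_on_subset)
  define B where "B = A \<circ> the_inv_into K f"
  have B: "B (f i) = A i" if "i \<in> K" for i
    using that iK by (simp add: B_def the_inv_into_f_f)
  have "indep_sets ?F (f ` J)" using ind by (simp add: indep_vars_def2)
  then have "prob (\<Inter>j\<in>f ` K. B j) = (\<Prod>j\<in>f ` K. prob (B j))"
    by (rule indep_setsD) (use K A B in auto)
  then show "prob (\<Inter>j\<in>K. A j) = (\<Prod>j\<in>K. prob (A j))"
    using iK by (simp add: prod.reindex B)
qed

lemma borel_measurable_matrix_mult [measurable]: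
  fixes f g :: "'w \<Rightarrow> real ^ 'd ^ 'd"
  assumes "f \<in> borel_measurable M" "g \<in> borel_measurable M"
  shows "(\<lambda>x. f x ** g x) \<in> borel_measurable M"
  by (rule borel_measurable_continuous_Pair[OF assms])
    (auto simp: matrix_matrix_mult_def intro!: continuous_intros)

lemma borel_measurable_matrix_vector_mult [measurable]:
  fixes f :: "'w \<Rightarrow> real ^ 'd ^ 'd" and g :: "'w \<Rightarrow> real ^ 'd"
  assumes "f \<in> borel_measurable M" "g \<in> borel_measurable M"
  shows "(\<lambda>x. f x *v g x) \<in> borel_measurable M"
  by (rule borel_measurable_continuous_Pair[OF assms])
    (auto simp: matrix_vector_mult_def intro!: continuous_intros)

lemma borel_measurable_esum [measurable]: "esum \<in> borel_measurable borel"
  unfolding esum_def by (intro borel_measurable_continuous_onI continuous_intros)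

lemma borel_measurable_vsum [measurable]: "vsum \<in> borel_measurable borel"
  unfolding vsum_def by (intro borel_measurable_continuous_onI continuous_intros)

lemma borel_measurable_infnorm_cart [measurable]:
  "(infnorm :: real ^ 'd \<Rightarrow> real) \<in> borel_measurable borel"
  by (intro borel_measurable_continuous_onI continuous_intros)

lemma borel_measurable_lprod [measurable]:
  fixes f :: "nat \<Rightarrow> 'w \<Rightarrow> real ^ 'd ^ 'd"
  assumes [measurable]: "\<And>i. f i \<in> borel_measurable M"
  shows "(\<lambda>x. lprod (\<lambda>i. f i x) n) \<in> borel_measurable M"
  by (induction n) simp_all

context sequence_space
begin

lemma distr_shift: "distr S S (\<lambda>x i. x (m + i)) = S"
  using distr_PiM_reindex[where K = "UNIV::nat set" and M = "\<lambda>_. M" and I = UNIV and f = "\<lambda>i. m + i"]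
  by (simp add: M.prob_space_axioms restrict_UNIV)

lemma measurable_shift: "(\<lambda>x i. x (m + i)) \<in> S \<rightarrow>\<^sub>M S"
  by (rule measurable_PiM_single') (auto simp: space_PiM)

lemma AE_shift:
  assumes "AE x in S. P x"
  shows "AE x in S. P (\<lambda>i. x (m + i))"
proof -
  have "AE x in distr S S (\<lambda>x i. x (m + i)). P x" unfolding distr_shift by (rule assms)
  then show ?thesis by (rule AE_distrD[OF measurable_shift])
qed

lemma AE_case_nat:
  assumes "AE x in S. P x"
  shows "AE z in M. AE x in S. P (case_nat z x)"
proof -
  have "AE x in distr (M \<Otimes>\<^sub>M S) S (\<lambda>(s, \<omega>). case_nat s \<omega>). P x" unfolding PiM_iter by (rule assms)
  then have "AE p in M \<Otimes>\<^sub>M S. P (case_nat (fst p) (snd p))"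
    by (subst (asm) case_prod_unfold, intro AE_distrD[where f="\<lambda>p. case_nat (fst p) (snd p)"]) auto
  interpret pair_sigma_finite M S ..
  from AE_pair[OF \<open>AE p in M \<Otimes>\<^sub>M S. P (case_nat (fst p) (snd p))\<close>] show ?thesis by simp
qed

lemma nn_integral_case_nat:
  assumes [measurable]: "h \<in> borel_measurable S"
  shows "(\<integral>\<^sup>+x. h x \<partial>S) = (\<integral>\<^sup>+z. \<integral>\<^sup>+x. h (case_nat z x) \<partial>S \<partial>M)"
proof -
  have "(\<integral>\<^sup>+x. h x \<partial>S) = (\<integral>\<^sup>+x. h x \<partial>distr (M \<Otimes>\<^sub>M S) S (\<lambda>(s, \<omega>). case_nat s \<omega>))"
    by (simp add: PiM_iter)
  also have "\<dots> = (\<integral>\<^sup>+p. h (case_nat (fst p) (snd p)) \<partial>(M \<Otimes>\<^sub>M S))"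
    by (subst nn_integral_distr) (auto simp: case_prod_unfold)
  also have "\<dots> = (\<integral>\<^sup>+z. \<integral>\<^sup>+x. h (case_nat z x) \<partial>S \<partial>M)"
    by (subst P.nn_integral_fst[symmetric]) auto
  finally show ?thesis .
qed

lemma integral_case_nat:
  fixes h :: "(nat \<Rightarrow> 'a) \<Rightarrow> real"
  assumes [measurable]: "integrable S h"
  shows "(\<integral>x. h x \<partial>S) = (\<integral>z. \<integral>x. h (case_nat z x) \<partial>S \<partial>M)"
proof -
  interpret pair_sigma_finite M S ..
  have i: "integrable (M \<Otimes>\<^sub>M S) (\<lambda>p. h (case_nat (fst p) (snd p)))"
    using assms by (subst (asm) PiM_iter[symmetric], subst (asm) integrable_distr_eq)
      (auto simp: case_prod_unfold)
  have "(\<integral>x. h x \<partial>S) = (\<integral>x. h x \<partial>distr (M \<Otimes>\<^sub>M S) S (\<lambda>(s, \<omega>). case_nat s \<omega>))"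
    by (simp add: PiM_iter)
  also have "\<dots> = (\<integral>p. h (case_nat (fst p) (snd p)) \<partial>(M \<Otimes>\<^sub>M S))"
    by (subst integral_distr) (auto simp: case_prod_unfold)
  also have "\<dots> = (\<integral>z. \<integral>x. h (case_nat z x) \<partial>S \<partial>M)"
    using integral_fst'[OF i] by simp
  finally show ?thesis .
qed

lemma nn_integral_coords_prod:
  assumes "finite J" and [measurable]: "\<And>m. h m \<in> M \<rightarrow>\<^sub>M (borel :: ennreal measure)"
    and inj: "inj_on f J"
  shows "(\<integral>\<^sup>+x. (\<Prod>m\<in>J. h m (x (f m))) \<partial>S) = (\<Prod>m\<in>J. \<integral>\<^sup>+z. h m z \<partial>M)"
proof -
  have "indep_vars (\<lambda>i. M) (\<lambda>i \<omega>. \<omega> i) UNIV"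
    by (rule indep_vars_PiM_coords) (auto simp: M.prob_space_axioms)
  then have "indep_vars (\<lambda>_. M) (\<lambda>i \<omega>. \<omega> i) (f ` J)" by (rule indep_vars_subset) auto
  then have "indep_vars (\<lambda>_. M) (\<lambda>i \<omega>. \<omega> (f i)) J"
    using indep_vars_reindex[OF inj, of "\<lambda>_. M" "\<lambda>i \<omega>. \<omega> i"] by (simp add: comp_def)
  then have "indep_vars (\<lambda>_. borel) (\<lambda>m x. h m (x (f m))) J"
    by (rule indep_vars_compose2[where Y = h]) auto
  then have "(\<integral>\<^sup>+x. (\<Prod>m\<in>J. h m (x (f m))) \<partial>S) = (\<Prod>m\<in>J. \<integral>\<^sup>+x. h m (x (f m)) \<partial>S)"
    by (intro indep_vars_nn_integral assms) auto
  moreover have "(\<integral>\<^sup>+x. h m (x (f m)) \<partial>S) = (\<integral>\<^sup>+z. h m z \<partial>M)" for m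
    by (subst PiM_component[of "f m", symmetric]) (auto simp: nn_integral_distr)
  ultimately show ?thesis by simp
qed

text \<open>The factorisation behind the decomposition at the last bad time. Gluing the first
  \<open>r\<close> coordinates of one sample to a second independent sample by
  \<open>comb_seq\<close> preserves \<open>S\<close>; the past then reads only the first sample and
  the later factors only the second.\<close>

lemma nn_integral_past_future:
  assumes [measurable]: "\<phi> \<in> borel_measurable S" "\<And>m. h m \<in> M \<rightarrow>\<^sub>M (borel :: ennreal measure)"
    and past: "\<And>x x'. (\<And>i. i < r \<Longrightarrow> x i = x' i) \<Longrightarrow> \<phi> x = \<phi> x'"
    and J: "finite J" "J \<subseteq> {r..}"
  shows "(\<integral>\<^sup>+x. \<phi> x * (\<Prod>m\<in>J. h m (x m)) \<partial>S) = (\<integral>\<^sup>+x. \<phi> x \<partial>S) * (\<Prod>m\<in>J. \<integral>\<^sup>+z. h m z \<partial>M)"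
proof -
  have c: "comb_seq r x x' m = x' (m - r)" if "m \<in> J" for x x' :: "nat \<Rightarrow> 'a" and m
    using J(2) that comb_seq_add[of r x x' "m - r"] by auto
  have [measurable]: "(\<lambda>p. comb_seq r (fst p) (snd p) m) \<in> S \<Otimes>\<^sub>M S \<rightarrow>\<^sub>M M" for m
    by (rule measurable_compose[OF measurable_comb_seq'[OF measurable_fst measurable_snd]
        measurable_component_singleton[OF UNIV_I]])
  have "(\<integral>\<^sup>+x. \<phi> x * (\<Prod>m\<in>J. h m (x m)) \<partial>S)
     = (\<integral>\<^sup>+x. \<phi> x * (\<Prod>m\<in>J. h m (x m)) \<partial>distr (S \<Otimes>\<^sub>M S) S (\<lambda>(\<omega>, \<omega>'). comb_seq r \<omega> \<omega>'))"
    by (simp add: PiM_comb_seq)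
  also have "\<dots> = (\<integral>\<^sup>+p. \<phi> (comb_seq r (fst p) (snd p)) * (\<Prod>m\<in>J. h m (comb_seq r (fst p) (snd p) m)) \<partial>(S \<Otimes>\<^sub>M S))"
    by (subst nn_integral_distr) (auto simp: case_prod_unfold)
  also have "\<dots> = (\<integral>\<^sup>+x. \<integral>\<^sup>+x'. \<phi> (comb_seq r x x') * (\<Prod>m\<in>J. h m (comb_seq r x x' m)) \<partial>S \<partial>S)"
    by (subst P.nn_integral_fst[symmetric]) auto
  \<comment> \<open>By \<open>past\<close> the glued sequence may be replaced by \<open>x\<close>
    inside \<open>\<phi>\<close>, while coordinates from \<open>r\<close> on come from
    \<open>x'\<close>, shifted by \<open>r\<close>.\<close>
  also have "\<dots> = (\<integral>\<^sup>+x. \<integral>\<^sup>+x'. \<phi> x * (\<Prod>m\<in>J. h m (x' (m - r))) \<partial>S \<partial>S)"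
    using past[of "comb_seq r x x'" x for x x']
    by (intro nn_integral_cong) (simp add: comb_seq_less c cong: prod.cong)
  also have "\<dots> = (\<integral>\<^sup>+x. \<phi> x * (\<integral>\<^sup>+x'. (\<Prod>m\<in>J. h m (x' (m - r))) \<partial>S) \<partial>S)"
    by (intro nn_integral_cong nn_integral_cmult) measurable
  also have "\<dots> = (\<integral>\<^sup>+x. \<phi> x \<partial>S) * (\<integral>\<^sup>+x'. (\<Prod>m\<in>J. h m (x' (m - r))) \<partial>S)"
    by (intro nn_integral_multc) measurable
  also have "(\<integral>\<^sup>+x'. (\<Prod>m\<in>J. h m (x' (m - r))) \<partial>S) = (\<Prod>m\<in>J. \<integral>\<^sup>+z. h m z \<partial>M)"
    using J(2) by (intro nn_integral_coords_prod J(1)) (auto simp: inj_on_def subset_eq intro: eq_diff_iff[THEN iffD1, rotated 2])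
  finally show ?thesis .
qed

end

section \<open>Concentration of matrix products\<close>

text \<open>
  The coordinates \<open>x i\<close> play the role of the pairs \<open>(A, Y)\<close> read backwards from the present, so that
  the products \<open>lprod\<close> grow to the right.
\<close>

locale iid_environment = sequence_space N
  for N :: "((real ^ 'd ^ 'd) \<times> (real ^ 'd)) measure" +
  fixes G \<kappa> lam :: real and K :: nat
  assumes sets_N [measurable_cong]: "sets N = sets (borel \<Otimes>\<^sub>M borel)"
    and G: "1 \<le> G" and \<kappa>: "0 < \<kappa>" "\<kappa> \<le> 1" and K: "1 \<le> K" and lam: "0 < lam"
    and AE_admissible: "AE x in S. admissible G \<kappa> K (\<lambda>i. fst (x i))"
    and AE_lyapunov: "AE x in S. (\<lambda>n. ln (esum (lprod (\<lambda>i. fst (x i)) n)) / real n) \<longlonglongrightarrow> - lam"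
    and AE_nonneg: "AE z in N. nonneg_vec (snd z)"
begin

text \<open>\<open>B\<close> stands for the product of the letters already revealed; carrying it
  along lets the induction in \<open>mgf_bound\<close> integrate out one letter at a time.\<close>

definition L :: "real ^ 'd ^ 'd \<Rightarrow> nat \<Rightarrow> (nat \<Rightarrow> (real ^ 'd ^ 'd) \<times> (real ^ 'd)) \<Rightarrow> real" where
  "L B n x = ln (esum (B ** lprod (\<lambda>i. fst (x i)) n))"

abbreviation Sn :: "nat \<Rightarrow> (nat \<Rightarrow> (real ^ 'd ^ 'd) \<times> (real ^ 'd)) \<Rightarrow> real" where
  "Sn \<equiv> L (mat 1)"

text \<open>Error of additivity of the logarithm: minus the logarithm of the constant in
  \<open>adm_esum_mult_ge\<close>, raised by 1 so that \<open>D\<close> is at least 1.\<close>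

definition D :: real where "D = 1 - ln (\<kappa> / G ^ (2 * K) / vsum (1 :: real ^ 'd))"

abbreviation good :: "(nat \<Rightarrow> (real ^ 'd ^ 'd) \<times> (real ^ 'd)) \<Rightarrow> bool" where
  "good x \<equiv> admissible G \<kappa> K (\<lambda>i. fst (x i))"

lemma Sn_eq: "Sn n x = ln (esum (lprod (\<lambda>i. fst (x i)) n))"
  by (simp add: L_def)

lemma measurable_fst_coord [measurable]: "(\<lambda>x. fst (x i)) \<in> borel_measurable S"
  by (rule measurable_compose[OF measurable_component_singleton[OF UNIV_I]]) simp

lemma measurable_snd_coord [measurable]: "(\<lambda>x. snd (x i)) \<in> borel_measurable S"
  by (rule measurable_compose[OF measurable_component_singleton[OF UNIV_I]]) simp

lemma measurable_L [measurable]: "L B n \<in> borel_measurable S"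
  unfolding L_def by measurable

lemma measurable_L_Pair [measurable]:
  "(\<lambda>p. L (B ** fst (fst p)) n (snd p)) \<in> borel_measurable (N \<Otimes>\<^sub>M S)"
proof -
  have [measurable]: "(\<lambda>p. fst (snd p i)) \<in> borel_measurable (N \<Otimes>\<^sub>M S)" for i
    by (rule measurable_compose[OF measurable_snd measurable_fst_coord])
  show ?thesis unfolding L_def by measurable
qed

definition c0 :: real where "c0 = \<kappa> / G ^ (2 * K) / vsum (1 :: real ^ 'd)"

lemma c0_pos: "0 < c0"
  using \<kappa> G vsum_one[where ?'d = 'd] by (auto simp: c0_def intro!: divide_pos_pos)

text \<open>These comparisons let the single constant \<open>D\<close> also dominate the logarithm
  of one letter and that of the dimension.\<close>

lemma c0_le: "c0 \<le> \<kappa> / G ^ K" "c0 \<le> 1 / G" "c0 \<le> 1 / vsum (1 :: real ^ 'd)"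
proof -
  have "G ^ K \<le> G ^ (2 * K)" "G ^ 1 \<le> G ^ (2 * K)" "1 \<le> G ^ (2 * K)"
    using G K power_increasing[of 1 "2 * K" G] by (auto intro!: power_increasing)
  then have p: "G ^ K \<le> G ^ (2 * K) * vsum (1 :: real ^ 'd)" "G \<le> G ^ (2 * K) * vsum (1 :: real ^ 'd)"
     "1 * vsum (1 :: real ^ 'd) \<le> G ^ (2 * K) * vsum (1 :: real ^ 'd)"
    using vsum_one[where ?'d = 'd] G mult_mono[of "G ^ K" "G ^ (2 * K)" 1 "vsum (1 :: real ^ 'd)"]
      mult_mono[of "G" "G ^ (2 * K)" 1 "vsum (1 :: real ^ 'd)"]
    by (auto intro!: mult_right_mono)
  have e: "c0 = \<kappa> / (G ^ (2 * K) * vsum (1 :: real ^ 'd))" by (simp add: c0_def)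
  have gp: "0 < G ^ K" "0 < G" "0 < vsum (1 :: real ^ 'd)" using G vsum_one[where ?'d = 'd] by auto
  show "c0 \<le> \<kappa> / G ^ K" unfolding e
    using p(1) \<kappa> gp by (intro divide_left_mono) auto
  show "c0 \<le> 1 / G" unfolding e
    using p(2) \<kappa> gp by (intro frac_le) auto
  show "c0 \<le> 1 / vsum (1 :: real ^ 'd)" unfolding e
    using p(3) \<kappa> gp by (intro frac_le) auto
qed

lemma D_eq: "D = 1 - ln c0" by (simp add: D_def c0_def)

lemma D_ge1: "1 \<le> D"
proof -
  have "c0 \<le> 1"
    using c0_le(2) G by (auto simp: divide_le_eq intro: order_trans)
  then show ?thesis using c0_pos by (simp add: D_eq)
qed

lemma good_esum_pos:
  assumes "good x" "nonneg_mat B" "0 < esum B"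
  shows "0 < esum (B ** lprod (\<lambda>i. fst (x i)) n)"
proof (induction n)
  case (Suc n)
  have nn: "nonneg_mat (B ** lprod (\<lambda>i. fst (x i)) n)"
    using assms by (intro nonneg_mat_mult adm_nonneg0[OF G \<kappa> K]) auto
  have "0 < \<kappa> / G ^ K * esum (B ** lprod (\<lambda>i. fst (x i)) n)"
    using Suc \<kappa> G by (intro mult_pos_pos) auto
  also have "\<dots> \<le> esum ((B ** lprod (\<lambda>i. fst (x i)) n) ** lprod (\<lambda>j. fst (x (n + j))) 1)"
    using K assms by (intro adm_esum_pos_step[OF G \<kappa> K, of "\<lambda>i. fst (x i)"] nn) auto
  finally show ?case by (simp add: matrix_mul_assoc)
qed (use assms in simp)

text \<open>Upper half by submultiplicativity, lower half by \<open>adm_esum_mult_ge\<close>. The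
  prefix \<open>B\<close> is arbitrary, so that it can be any product of letters fixed
  before.\<close>

lemma near_additive:
  assumes x: "good x" and B: "nonneg_mat B" "0 < esum B"
  shows "\<bar>L B n x - (ln (esum B) + Sn n x)\<bar> \<le> D"
proof -
  define P where "P = lprod (\<lambda>i. fst (x i)) n"
  have nP: "nonneg_mat P" unfolding P_def by (rule adm_nonneg0[OF G \<kappa> K x])
  have pP: "0 < esum P" using good_esum_pos[OF x nonneg_mat_one, of n] vsum_one[where ?'d = 'd]
    by (simp add: P_def esum_one)
  have pBP: "0 < esum (B ** P)" unfolding P_def by (rule good_esum_pos[OF x B])
  have "esum (B ** P) \<le> esum B * esum P" by (rule esum_mult_le[OF B(1) nP])
  then have "ln (esum (B ** P)) \<le> ln (esum B * esum P)" using pBP B pP by simp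
  then have 1: "ln (esum (B ** P)) \<le> ln (esum B) + ln (esum P)" using B pP by (simp add: ln_mult)
  have "\<kappa> / G ^ (2 * K) * esum B * esum (lprod (\<lambda>i. fst (x (0 + i))) n)
      \<le> esum (B ** lprod (\<lambda>i. fst (x (0 + i))) n) * vsum (1 :: real ^ 'd)"
    by (rule adm_esum_mult_ge[OF G \<kappa> K x B(1)])
  then have "\<kappa> / G ^ (2 * K) * esum B * esum P / vsum (1 :: real ^ 'd) \<le> esum (B ** P)"
    using vsum_one[where ?'d = 'd] by (subst pos_divide_le_eq) (auto simp: P_def)
  then have "c0 * (esum B * esum P) \<le> esum (B ** P)" by (simp add: c0_def)
  moreover have "0 < c0 * (esum B * esum P)" using c0_pos B pP by simp
  ultimately have "ln (c0 * (esum B * esum P)) \<le> ln (esum (B ** P))" using pBP by simp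
  then have "ln c0 + (ln (esum B) + ln (esum P)) \<le> ln (esum (B ** P))"
    using c0_pos B pP by (simp add: ln_mult)
  with 1 show ?thesis using D_ge1 by (simp add: L_def P_def D_eq)
qed

lemma letter_bound:
  assumes x: "good x" shows "0 < esum (fst (x i))" "\<bar>ln (esum (fst (x i)))\<bar> \<le> D"
proof -
  have "c0 \<le> \<kappa> / G ^ K" by (rule c0_le)
  also have "\<dots> \<le> esum (fst (x i))" by (rule adm_letter[OF G \<kappa> K x])
  finally have 1: "c0 \<le> esum (fst (x i))" .
  then show "0 < esum (fst (x i))" using c0_pos by simp
  have "esum (fst (x i)) \<le> G" using x by (simp add: admissible_def)
  also have "G \<le> 1 / c0" using c0_le(2) c0_pos G by (simp add: field_simps)
  finally have "ln (esum (fst (x i))) \<le> ln (1 / c0)" using 1 c0_pos by simp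
  moreover have "ln c0 \<le> ln (esum (fst (x i)))" using 1 c0_pos by simp
  ultimately show "\<bar>ln (esum (fst (x i)))\<bar> \<le> D" using c0_pos by (simp add: D_eq ln_div)
qed

text \<open>One \<open>D\<close> each for attaching the letter, for the size of the letter and for
  attaching the rest. The value compared with does not involve \<open>z\<close>, so the first letter
  moves the logarithm within a range of length \<open>6 * D\<close>.\<close>

lemma L_Suc_bound:
  assumes x: "good (case_nat z x)" and B: "nonneg_mat B" "0 < esum B"
  shows "nonneg_mat (B ** fst z)" "0 < esum (B ** fst z)"
    "\<bar>L (B ** fst z) n x - (ln (esum B) + Sn n x)\<bar> \<le> 3 * D" "good x"
proof -
  show gx: "good x" using admissible_shift[OF x, of 1] by simp
  have e: "B ** lprod (\<lambda>i. fst (case_nat z x i)) 1 = B ** fst z" by simp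
  show n: "nonneg_mat (B ** fst z)"
    using x B by (auto intro!: nonneg_mat_mult simp: admissible_def dest: spec[of _ 0])
  show p: "0 < esum (B ** fst z)" using good_esum_pos[OF x B, of 1] by simp
  have "\<bar>L B 1 (case_nat z x) - (ln (esum B) + Sn 1 (case_nat z x))\<bar> \<le> D"
    by (rule near_additive[OF x B])
  then have "\<bar>ln (esum (B ** fst z)) - (ln (esum B) + ln (esum (fst z)))\<bar> \<le> D"
    by (simp add: L_def)
  moreover have "\<bar>ln (esum (fst z))\<bar> \<le> D" using letter_bound(2)[OF x, of 0] by simp
  moreover have "\<bar>L (B ** fst z) n x - (ln (esum (B ** fst z)) + Sn n x)\<bar> \<le> D"
    by (rule near_additive[OF gx n p])
  ultimately show "\<bar>L (B ** fst z) n x - (ln (esum B) + Sn n x)\<bar> \<le> 3 * D" by linarith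
qed

text \<open>The entry sum of the identity matrix is the dimension, so \<open>Sn 0\<close> is the
  logarithm of the dimension and not 0.\<close>

lemma Sn_0_bound: "\<bar>Sn 0 x\<bar> \<le> D"
proof -
  have "vsum (1 :: real ^ 'd) \<le> 1 / c0"
    using c0_le(3) c0_pos vsum_one[where ?'d = 'd] by (simp add: field_simps)
  then have "ln (vsum (1 :: real ^ 'd)) \<le> ln (1 / c0)"
    using vsum_one[where ?'d = 'd] c0_pos by (subst ln_le_cancel_iff) auto
  then show ?thesis using vsum_one[where ?'d = 'd] c0_pos
    by (simp add: Sn_eq esum_one D_eq ln_div)
qed

lemma Sn_add:
  assumes x: "good x"
  shows "\<bar>Sn (m + n) x - (Sn m x + Sn n (\<lambda>i. x (m + i)))\<bar> \<le> D"
proof -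
  let ?P = "lprod (\<lambda>i. fst (x i)) m"
  have "L ?P n (\<lambda>i. x (m + i)) = Sn (m + n) x"
    by (simp add: L_def lprod_add)
  moreover have "good (\<lambda>i. x (m + i))" by (rule admissible_shift[OF x])
  moreover have "nonneg_mat ?P" by (rule adm_nonneg0[OF G \<kappa> K x])
  moreover have "0 < esum ?P" using good_esum_pos[OF x nonneg_mat_one, of m] vsum_one[where ?'d = 'd]
    by (simp add: esum_one)
  ultimately show ?thesis using near_additive[of "\<lambda>i. x (m + i)" ?P n] by (simp add: Sn_eq)
qed

lemma Sn_bound:
  assumes x: "good x"
  shows "\<bar>Sn n x\<bar> \<le> D * (2 * real n + 1)"
proof (induction n)
  case (Suc n)
  have "\<bar>Sn (n + 1) x - (Sn n x + Sn 1 (\<lambda>i. x (n + i)))\<bar> \<le> D" by (rule Sn_add[OF x])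
  moreover have "\<bar>Sn 1 (\<lambda>i. x (n + i))\<bar> \<le> D"
    using letter_bound(2)[OF x, of n] by (simp add: Sn_eq)
  ultimately show ?case using Suc by (simp add: algebra_simps)
qed (use Sn_0_bound in simp)

lemma L_bound:
  assumes "good x" "nonneg_mat B" "0 < esum B"
  shows "\<bar>L B n x\<bar> \<le> \<bar>ln (esum B)\<bar> + D + D * (2 * real n + 1)"
  using near_additive[OF assms, of n] Sn_bound[OF assms(1), of n] by linarith

lemma integrable_L:
  assumes "nonneg_mat B" "0 < esum B"
  shows "integrable S (L B n)"
  by (rule P.integrable_const_bound[of _ "\<bar>ln (esum B)\<bar> + D + D * (2 * real n + 1)"])
    (use AE_admissible assms in \<open>auto elim!: eventually_mono intro!: L_bound\<close>)

lemma esum_mat1_pos: "0 < esum (mat 1 :: real ^ 'd ^ 'd)"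
  using vsum_one[where ?'d = 'd] by (simp add: esum_one)

lemma integrable_Sn: "integrable S (Sn n)"
  by (intro integrable_L nonneg_mat_one esum_mat1_pos)

lemma L_case_nat: "L B (Suc n) (case_nat z x) = L (B ** fst z) n x"
  by (simp only: L_def lprod_Suc_shift) (simp add: matrix_mul_assoc)

lemma AE_good_case_nat: "AE z in N. AE x in S. good (case_nat z x)"
  by (rule AE_case_nat[OF AE_admissible])

text \<open>
  Hoeffding's lemma applied to the first letter: given the later letters, replacing it moves the
  logarithm by at most \<open>6 * D\<close>.
\<close>

lemma mgf_bound:
  assumes \<theta>: "0 < \<theta>" and \<sigma>: "\<bar>\<sigma>\<bar> = 1" and B: "nonneg_mat B" "0 < esum B"
  shows "(\<integral>\<^sup>+x. ennreal (exp (\<theta> * (\<sigma> * L B n x))) \<partial>S)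
    \<le> ennreal (exp (\<theta> * (\<sigma> * (\<integral>x. L B n x \<partial>S)) + \<theta>\<^sup>2 * (6 * D)\<^sup>2 / 8 * real n))"
  using B
proof (induction n arbitrary: B)
  case 0
  then show ?case by (simp add: L_def P.emeasure_space_1 P.prob_space)
next
  case (Suc n)
  define W where "W = \<theta>\<^sup>2 * (6 * D)\<^sup>2 / 8"
  define g where "g z = (\<integral>x. L (B ** fst z) n x \<partial>S)" for z :: "(real ^ 'd ^ 'd) \<times> (real ^ 'd)"
  have gm [measurable]: "g \<in> borel_measurable N"
    unfolding g_def by (rule P.borel_measurable_lebesgue_integral) (simp add: case_prod_unfold)
  \<comment> \<open>Centre of the range of \<open>g\<close>; it does not depend on the first
    letter.\<close>
  define ctr where "ctr = ln (esum B) + (\<integral>x. Sn n x \<partial>S)"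
  have g: "AE z in N. nonneg_mat (B ** fst z) \<and> 0 < esum (B ** fst z) \<and> \<sigma> * g z \<in> {\<sigma> * ctr - 3 * D..\<sigma> * ctr + 3 * D}"
    using AE_good_case_nat
  proof eventually_elim
    case (elim z)
    \<comment> \<open>Facts about \<open>z\<close> alone are read off from one admissible
      continuation, which exists because almost every continuation is admissible.\<close>
    then have "\<exists>x. good (case_nat z x)"
      using P.AE_False by (metis (mono_tags, lifting) eventually_mono)
    then obtain x0 where x0: "good (case_nat z x0)" by blast
    note nn = L_Suc_bound(1,2)[OF x0 Suc.prems]
    have "\<bar>g z - ctr\<bar> = \<bar>\<integral>x. L (B ** fst z) n x - (ln (esum B) + Sn n x) \<partial>S\<bar>"
      unfolding g_def ctr_def using nn
      by (simp add: integrable_L integrable_Sn P.prob_space)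
    also have "\<dots> \<le> (\<integral>x. 3 * D \<partial>S)"
      using elim nn Suc.prems
      by (intro integral_abs_bound[THEN order_trans] integral_mono_AE integrable_abs
          Bochner_Integration.integrable_diff Bochner_Integration.integrable_add integrable_L integrable_Sn)
        (auto elim!: eventually_mono intro!: L_Suc_bound(3))
    finally have "\<bar>g z - ctr\<bar> \<le> 3 * D" by (simp add: P.prob_space)
    moreover have "\<sigma> = 1 \<or> \<sigma> = -1" using \<sigma> by linarith
    ultimately show ?case using nn by auto
  qed
  have Eg: "(\<integral>z. g z \<partial>N) = (\<integral>x. L B (Suc n) x \<partial>S)"
    using integral_case_nat[OF integrable_L[OF Suc.prems, of "Suc n"]] by (simp add: g_def L_case_nat)
  \<comment> \<open>The sign \<open>\<sigma>\<close> is carried along so that one induction yields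
    both tails. Hoeffding's lemma sees an interval of length \<open>6 * D\<close>.\<close>
  interpret ib: interval_bounded_random_variable N "\<lambda>z. \<sigma> * g z" "\<sigma> * ctr - 3 * D" "\<sigma> * ctr + 3 * D"
    using g by unfold_locales (auto elim: eventually_mono)
  have hoeff: "(\<integral>\<^sup>+z. ennreal (exp (\<theta> * (\<sigma> * g z - M.expectation (\<lambda>z. \<sigma> * g z)))) \<partial>N) \<le> ennreal (exp W)"
    using ib.Hoeffdings_lemma_nn_integral[OF \<theta>] by (simp add: W_def)
  have "(\<integral>\<^sup>+x. ennreal (exp (\<theta> * (\<sigma> * L B (Suc n) x))) \<partial>S)
     = (\<integral>\<^sup>+z. \<integral>\<^sup>+x. ennreal (exp (\<theta> * (\<sigma> * L (B ** fst z) n x))) \<partial>S \<partial>N)"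
    by (subst nn_integral_case_nat) (auto simp: L_case_nat)
  also have "\<dots> \<le> (\<integral>\<^sup>+z. ennreal (exp (\<theta> * (\<sigma> * g z) + W * real n)) \<partial>N)"
  proof (rule nn_integral_mono_AE)
    show "AE z in N. (\<integral>\<^sup>+x. ennreal (exp (\<theta> * (\<sigma> * L (B ** fst z) n x))) \<partial>S)
        \<le> ennreal (exp (\<theta> * (\<sigma> * g z) + W * real n))"
      using g
    proof eventually_elim
      case (elim z)
      then show ?case using Suc.IH[of "B ** fst z"] by (simp only: g_def W_def)
    qed
  qed
  also have "\<dots> = (\<integral>\<^sup>+z. ennreal (exp (\<theta> * (\<sigma> * g z - M.expectation (\<lambda>z. \<sigma> * g z))))
      * ennreal (exp (\<theta> * M.expectation (\<lambda>z. \<sigma> * g z) + W * real n)) \<partial>N)"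
    by (intro nn_integral_cong) (simp add: ennreal_mult[symmetric] exp_add[symmetric] algebra_simps)
  also have "\<dots> = (\<integral>\<^sup>+z. ennreal (exp (\<theta> * (\<sigma> * g z - M.expectation (\<lambda>z. \<sigma> * g z)))) \<partial>N)
      * ennreal (exp (\<theta> * M.expectation (\<lambda>z. \<sigma> * g z) + W * real n))"
    by (rule nn_integral_multc) measurable
  also have "\<dots> \<le> ennreal (exp W) * ennreal (exp (\<theta> * M.expectation (\<lambda>z. \<sigma> * g z) + W * real n))"
    by (intro mult_right_mono hoeff) auto
  also have "\<dots> = ennreal (exp (\<theta> * (\<sigma> * (\<integral>x. L B (Suc n) x \<partial>S)) + W * real (Suc n)))"
    by (simp add: ennreal_mult[symmetric] exp_add[symmetric] Eg algebra_simps)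
  finally show ?case by (simp add: W_def)
qed

section \<open>The mean of the logarithm\<close>

lemma integral_Sn_shift: "(\<integral>x. Sn n (\<lambda>i. x (m + i)) \<partial>S) = (\<integral>x. Sn n x \<partial>S)"
  "integrable S (\<lambda>x. Sn n (\<lambda>i. x (m + i)))"
proof -
  have "(\<integral>x. Sn n x \<partial>S) = (\<integral>x. Sn n x \<partial>distr S S (\<lambda>x i. x (m + i)))"
    unfolding distr_shift ..
  also have "\<dots> = (\<integral>x. Sn n (\<lambda>i. x (m + i)) \<partial>S)"
    by (intro integral_distr measurable_shift measurable_L)
  finally show "(\<integral>x. Sn n (\<lambda>i. x (m + i)) \<partial>S) = (\<integral>x. Sn n x \<partial>S)" ..
  have "integrable (distr S S (\<lambda>x i. x (m + i))) (Sn n)"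
    unfolding distr_shift by (rule integrable_Sn)
  then show "integrable S (\<lambda>x. Sn n (\<lambda>i. x (m + i)))"
    by (subst (asm) integrable_distr_eq) (auto intro: measurable_shift)
qed

lemma mean_add: "\<bar>(\<integral>x. Sn (m + n) x \<partial>S) - ((\<integral>x. Sn m x \<partial>S) + (\<integral>x. Sn n x \<partial>S))\<bar> \<le> D"
proof -
  have "\<bar>(\<integral>x. Sn (m + n) x \<partial>S) - ((\<integral>x. Sn m x \<partial>S) + (\<integral>x. Sn n x \<partial>S))\<bar>
     = \<bar>\<integral>x. Sn (m + n) x - (Sn m x + Sn n (\<lambda>i. x (m + i))) \<partial>S\<bar>"
    by (simp add: integrable_Sn integral_Sn_shift)
  also have "\<dots> \<le> (\<integral>x. D \<partial>S)"
    by (intro integral_abs_bound[THEN order_trans] integral_mono_AE integrable_abs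
         Bochner_Integration.integrable_diff Bochner_Integration.integrable_add integral_Sn_shift integrable_Sn)
      (use AE_admissible in \<open>auto elim!: eventually_mono intro: Sn_add\<close>)
  finally show ?thesis by (simp add: P.prob_space)
qed

lemma mean_mult: "\<bar>(\<integral>x. Sn (k * n) x \<partial>S) - real k * (\<integral>x. Sn n x \<partial>S)\<bar> \<le> (real k + 1) * D"
proof (induction k)
  case 0
  have "\<bar>\<integral>x. Sn 0 x \<partial>S\<bar> \<le> (\<integral>x. D \<partial>S)"
    by (intro integral_abs_bound[THEN order_trans] integral_mono_AE integrable_abs integrable_Sn)
      (auto intro: Sn_0_bound)
  then show ?case by (simp add: P.prob_space)
next
  case (Suc k)
  then show ?case using mean_add[of n "k * n"] by (simp add: algebra_simps)
qed

text \<open>Dominated convergence: \<open>Sn_bound\<close> keeps \<open>Sn n x / real n\<close>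
  below \<open>3 * D\<close> in absolute value.\<close>

lemma mean_limit: "(\<lambda>n. (\<integral>x. Sn n x \<partial>S) / real n) \<longlonglongrightarrow> - lam"
proof -
  have "(\<lambda>n. \<integral>x. Sn n x / real n \<partial>S) \<longlonglongrightarrow> (\<integral>x. - lam \<partial>S)"
  proof (rule integral_dominated_convergence[where w="\<lambda>_. 3 * D"])
    show "AE x in S. (\<lambda>i. Sn i x / real i) \<longlonglongrightarrow> - lam"
      using AE_lyapunov by (simp add: Sn_eq)
    show "AE x in S. norm (Sn n x / real n) \<le> 3 * D" for n
      using AE_admissible
    proof eventually_elim
      case (elim x)
      show ?case
      proof (cases "n = 0")
        case False
        have "\<bar>Sn n x\<bar> \<le> D * (2 * real n + 1)" by (rule Sn_bound[OF elim])
        also have "\<dots> \<le> D * (3 * real n)" using D_ge1 False by (intro mult_left_mono) auto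
        finally show ?thesis using False by (simp add: divide_le_eq mult_ac)
      qed (use D_ge1 in auto)
    qed
  qed auto
  then show ?thesis by (simp add: P.prob_space)
qed

text \<open>The Hyers-Ulam argument for almost additive sequences: \<open>mean_mult\<close> compares
  \<open>n\<close> with its multiples at a cost of one \<open>D\<close> per multiple, so dividing by
  the multiplier and letting it grow leaves the limit and an error of a single \<open>D\<close>.
  This makes the centring valid for every \<open>n\<close>, not just asymptotically.\<close>

lemma mean_bound: "\<bar>(\<integral>x. Sn n x \<partial>S) + lam * real n\<bar> \<le> D"
proof (cases "n = 0")
  case True
  then show ?thesis using mean_mult[of 0 0] by simp
next
  case False
  define a where "a n = (\<integral>x. Sn n x \<partial>S)" for n
  \<comment> \<open>Multipliers of the form \<open>Suc k\<close> avoid division by zero.\<close>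
  have "filterlim (\<lambda>k. Suc k * n) at_top sequentially"
    using False by (intro filterlim_subseq strict_monoI) auto
  from filterlim_compose[OF mean_limit this]
  have "(\<lambda>k. a (Suc k * n) / real (Suc k * n) * real n) \<longlonglongrightarrow> - lam * real n"
    unfolding a_def by (intro tendsto_mult_right)
  then have l1: "(\<lambda>k. a (Suc k * n) / real (Suc k)) \<longlonglongrightarrow> - lam * real n"
    using False by (simp del: of_nat_Suc mult_Suc)
  have l2: "(\<lambda>k. \<bar>a (Suc k * n) / real (Suc k) - a n\<bar>) \<longlonglongrightarrow> \<bar>- lam * real n - a n\<bar>"
    by (intro tendsto_intros l1)
  have l3: "(\<lambda>k. (real (Suc k) + 1) * D / real (Suc k)) \<longlonglongrightarrow> D"
    by real_asymp
  have "\<bar>a (Suc k * n) / real (Suc k) - a n\<bar> \<le> (real (Suc k) + 1) * D / real (Suc k)" for k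
  proof -
    have "\<bar>a (Suc k * n) / real (Suc k) - a n\<bar> = \<bar>a (Suc k * n) - real (Suc k) * a n\<bar> / real (Suc k)"
    proof -
      have "a (Suc k * n) / real (Suc k) - a n = (a (Suc k * n) - real (Suc k) * a n) / real (Suc k)"
        by (simp add: field_simps del: of_nat_Suc mult_Suc)
      then show ?thesis by (simp add: abs_divide del: of_nat_Suc mult_Suc)
    qed
    also have "\<dots> \<le> (real (Suc k) + 1) * D / real (Suc k)"
      unfolding a_def by (intro divide_right_mono mean_mult) auto
    finally show ?thesis .
  qed
  then have "\<bar>- lam * real n - a n\<bar> \<le> D"
    by (intro LIMSEQ_le[OF l2 l3]) auto
  then show ?thesis by (simp add: a_def abs_if split: if_splits)
qed

section \<open>Gaussian tails and bad times\<close>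

definition dev :: "nat \<Rightarrow> (nat \<Rightarrow> (real ^ 'd ^ 'd) \<times> (real ^ 'd)) \<Rightarrow> real" where
  "dev n x = \<bar>Sn n x + lam * real n\<bar>"

lemma measurable_dev [measurable]: "dev n \<in> borel_measurable S"
  unfolding dev_def by measurable

text \<open>Chernoff's bound with the exponential moments of \<open>mgf_bound\<close>.\<close>

lemma one_sided_tail:
  assumes t: "0 < t" and n: "0 < n" and \<sigma>: "\<bar>\<sigma>\<bar> = 1"
  shows "P.prob {x \<in> space S. t \<le> \<sigma> * (Sn n x - (\<integral>x. Sn n x \<partial>S))} \<le> exp (- (t\<^sup>2 / (18 * D\<^sup>2 * real n)))"
proof -
  \<comment> \<open>This is \<open>(6 * D)\<^sup>2 / 8 * real n\<close>, the coefficient of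
    \<open>\<theta>\<^sup>2\<close> in \<open>mgf_bound\<close>.\<close>
  define W where "W = 9 / 2 * D\<^sup>2 * real n"
  have W: "0 < W" using D_ge1 n by (simp add: W_def)
  \<comment> \<open>The minimiser of \<open>- \<theta> * t + \<theta>\<^sup>2 * W\<close>; the
    minimum is \<open>- (t\<^sup>2 / (4 * W))\<close>.\<close>
  define \<theta> where "\<theta> = t / (2 * W)"
  have \<theta>: "0 < \<theta>" using t W by (simp add: \<theta>_def)
  define e where "e = \<sigma> * (\<integral>x. Sn n x \<partial>S)"
  have "(\<integral>\<^sup>+x. ennreal (exp (\<theta> * (\<sigma> * Sn n x))) \<partial>S) \<le> ennreal (exp (\<theta> * e + \<theta>\<^sup>2 * W))"
    using mgf_bound[OF \<theta> \<sigma> nonneg_mat_one esum_mat1_pos, of n] by (simp add: W_def e_def power_mult_distrib mult_ac)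
  note mgf = this
  have "emeasure S {x \<in> space S. t \<le> \<sigma> * (Sn n x - (\<integral>x. Sn n x \<partial>S))}
     = (\<integral>\<^sup>+x. indicator {x \<in> space S. t \<le> \<sigma> * (Sn n x - (\<integral>x. Sn n x \<partial>S))} x \<partial>S)"
    by (subst nn_integral_indicator) auto
  also have "\<dots> \<le> (\<integral>\<^sup>+x. ennreal (exp (- \<theta> * (t + e))) * ennreal (exp (\<theta> * (\<sigma> * Sn n x))) \<partial>S)"
  proof (rule nn_integral_mono)
    fix x show "indicator {x \<in> space S. t \<le> \<sigma> * (Sn n x - (\<integral>x. Sn n x \<partial>S))} x
       \<le> ennreal (exp (- \<theta> * (t + e))) * ennreal (exp (\<theta> * (\<sigma> * Sn n x)))"
    proof (cases "t \<le> \<sigma> * (Sn n x - (\<integral>x. Sn n x \<partial>S))")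
      case True
      then have "0 \<le> \<sigma> * Sn n x - e - t" by (simp add: e_def right_diff_distrib)
      then have "0 \<le> \<theta> * (\<sigma> * Sn n x - e - t)" using \<theta> by simp
      then have "1 \<le> exp (- \<theta> * (t + e) + \<theta> * (\<sigma> * Sn n x))" by (simp add: algebra_simps)
      then show ?thesis
        by (auto simp: indicator_def ennreal_mult[symmetric] exp_add[symmetric] simp del: ennreal_1 simp flip: ennreal_1)
    qed simp
  qed
  also have "\<dots> = ennreal (exp (- \<theta> * (t + e))) * (\<integral>\<^sup>+x. ennreal (exp (\<theta> * (\<sigma> * Sn n x))) \<partial>S)"
    by (rule nn_integral_cmult) measurable
  also have "\<dots> \<le> ennreal (exp (- \<theta> * (t + e))) * ennreal (exp (\<theta> * e + \<theta>\<^sup>2 * W))"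
    by (intro mult_left_mono mgf) auto
  also have "\<dots> = ennreal (exp (- \<theta> * t + \<theta>\<^sup>2 * W))"
    by (simp add: ennreal_mult[symmetric] exp_add[symmetric] algebra_simps)
  also have "- \<theta> * t + \<theta>\<^sup>2 * W = - (t\<^sup>2 / (18 * D\<^sup>2 * real n))"
  proof -
    have "- \<theta> * t + \<theta>\<^sup>2 * W = - (t\<^sup>2 / (4 * W))"
      using W by (simp add: \<theta>_def power2_eq_square field_simps)
    also have "4 * W = 18 * D\<^sup>2 * real n" by (simp add: W_def)
    finally show ?thesis .
  qed
  finally show ?thesis by (simp add: P.emeasure_eq_measure)
qed

text \<open>The additional \<open>D\<close> replaces the true mean by \<open>- lam * real n\<close>,
  see \<open>mean_bound\<close>.\<close>

lemma dev_tail: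
  assumes t: "0 < t" and n: "0 < n"
  shows "P.prob {x \<in> space S. t + D < dev n x} \<le> 2 * exp (- (t\<^sup>2 / (18 * D\<^sup>2 * real n)))"
proof -
  let ?A = "\<lambda>\<sigma>. {x \<in> space S. t \<le> \<sigma> * (Sn n x - (\<integral>x. Sn n x \<partial>S))}"
  have "P.prob {x \<in> space S. t + D < dev n x} \<le> P.prob (?A 1 \<union> ?A (-1))"
    using mean_bound[of n] by (intro P.finite_measure_mono) (auto simp: dev_def)
  also have "\<dots> \<le> P.prob (?A 1) + P.prob (?A (-1))"
    by (intro measure_Un_le) auto
  also have "\<dots> \<le> 2 * exp (- (t\<^sup>2 / (18 * D\<^sup>2 * real n)))"
    using one_sided_tail[OF t n, of 1] one_sided_tail[OF t n, of "-1"] by simp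
  finally show ?thesis .
qed

text \<open>Time 0 counts as bad so that a last bad time always exists. All prefixes
  \<open>j \<le> l\<close> are controlled by the one bound \<open>real l powr \<alpha>\<close>,
  because the variance of a large family involves every intermediate product.\<close>

definition bad :: "real \<Rightarrow> nat \<Rightarrow> (nat \<Rightarrow> (real ^ 'd ^ 'd) \<times> (real ^ 'd)) \<Rightarrow> bool" where
  "bad \<alpha> l x \<longleftrightarrow> l = 0 \<or> (\<exists>j\<le>l. real l powr \<alpha> < dev j x)"

lemma measurable_bad [measurable]: "Measurable.pred S (bad \<alpha> l)"
  unfolding bad_def by measurable

lemma bad_past:
  assumes "\<And>i. i < l \<Longrightarrow> x i = x' i"
  shows "bad \<alpha> l x = bad \<alpha> l x'"
proof -
  have "lprod (\<lambda>i. fst (x i)) j = lprod (\<lambda>i. fst (x' i)) j" if "j \<le> l" for j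
    using that assms by (intro lprod_cong) auto
  then show ?thesis by (auto simp: bad_def dev_def Sn_eq)
qed

text \<open>A union bound over the prefixes \<open>j \<le> l\<close> gives the factor
  \<open>real l + 1\<close>; for a deviation of order \<open>real l powr \<alpha>\<close> the tail
  bound is largest at \<open>j = l\<close>.\<close>

lemma bad_prob:
  assumes \<alpha>: "1/2 < \<alpha>"
  shows "\<exists>c>0. \<exists>C>0. \<forall>l. P.prob {x \<in> space S. bad \<alpha> l x} \<le> C * ((real l + 1) * exp (- c * real l powr (2 * \<alpha> - 1)))"
proof -
  \<comment> \<open>The tail bound is applied with half of \<open>real l powr \<alpha>\<close>;
    squaring the half turns 18 into 72.\<close>
  define c where "c = 1 / (72 * D\<^sup>2)"
  have c: "0 < c" using D_ge1 by (simp add: c_def)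
  have "eventually (\<lambda>l::nat. 2 * D \<le> real l powr \<alpha>) sequentially"
    using \<alpha> by real_asymp
  then obtain l0 where l0: "\<And>l. l0 \<le> l \<Longrightarrow> 2 * D \<le> real l powr \<alpha>"
    by (auto simp: eventually_sequentially)
  \<comment> \<open>The second entry makes the claim trivial for the finitely many \<open>l\<close>
    below \<open>l0\<close>.\<close>
  define C where "C = max 2 (exp (c * real l0 powr (2 * \<alpha> - 1)))"
  have "P.prob {x \<in> space S. bad \<alpha> l x} \<le> C * ((real l + 1) * exp (- c * real l powr (2 * \<alpha> - 1)))" for l
  proof (cases "l0 \<le> l \<and> 0 < l")
    case True
    define e where "e = exp (- c * real l powr (2 * \<alpha> - 1))"
    have s: "{x \<in> space S. bad \<alpha> l x} \<subseteq> (\<Union>j\<in>{..l}. {x \<in> space S. real l powr \<alpha> < dev j x})"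
      using True by (auto simp: bad_def)
    have "P.prob {x \<in> space S. bad \<alpha> l x} \<le> P.prob (\<Union>j\<in>{..l}. {x \<in> space S. real l powr \<alpha> < dev j x})"
      by (intro P.finite_measure_mono s) auto
    also have "\<dots> \<le> (\<Sum>j\<in>{..l}. P.prob {x \<in> space S. real l powr \<alpha> < dev j x})"
      by (intro P.finite_measure_subadditive_finite) auto
    also have "\<dots> \<le> (\<Sum>j\<in>{..l}. 2 * e)"
    proof (rule sum_mono)
      fix j assume j: "j \<in> {..l}"
      \<comment> \<open>Half of the permitted deviation absorbs the shift by \<open>D\<close> in
        \<open>dev_tail\<close>.\<close>
      have lD: "2 * D \<le> real l powr \<alpha>" using l0 True by auto
      show "P.prob {x \<in> space S. real l powr \<alpha> < dev j x} \<le> 2 * e"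
      proof (cases "j = 0")
        case True
        have "\<not> real l powr \<alpha> < dev j x" for x
          using Sn_0_bound[of x] lD D_ge1 True by (simp add: dev_def)
        then show ?thesis by (simp add: e_def)
      next
        case False
        define t where "t = real l powr \<alpha> / 2"
        have t: "0 < t" using lD D_ge1 unfolding t_def by linarith
        have "P.prob {x \<in> space S. real l powr \<alpha> < dev j x} \<le> P.prob {x \<in> space S. t + D < dev j x}"
          using lD by (intro P.finite_measure_mono) (auto simp: t_def)
        also have "\<dots> \<le> 2 * exp (- (t\<^sup>2 / (18 * D\<^sup>2 * real j)))" using False by (intro dev_tail t) auto
        also have "\<dots> \<le> 2 * exp (- (t\<^sup>2 / (18 * D\<^sup>2 * real l)))"
          using j False D_ge1 by (simp add: frac_le mult_left_mono)
        also have "t\<^sup>2 / (18 * D\<^sup>2 * real l) = c * real l powr (2 * \<alpha> - 1)"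
          using \<open>l0 \<le> l \<and> 0 < l\<close> D_ge1 by (simp add: t_def c_def power2_eq_square powr_diff powr_add[symmetric] field_simps)
        finally show ?thesis by (simp add: e_def)
      qed
    qed
    also have "\<dots> = 2 * ((real l + 1) * e)" by simp
    also have "\<dots> \<le> C * ((real l + 1) * e)" by (intro mult_right_mono) (auto simp: C_def e_def)
    finally show ?thesis by (simp add: e_def)
  next
    case False
    then have ll: "l \<le> l0" by auto
    have "P.prob {x \<in> space S. bad \<alpha> l x} \<le> 1" by simp
    also have "1 \<le> exp (c * real l0 powr (2 * \<alpha> - 1)) * exp (- c * real l powr (2 * \<alpha> - 1))"
      using ll c \<alpha> by (simp add: exp_add[symmetric] powr_mono2)
    also have "\<dots> \<le> C * ((real l + 1) * exp (- c * real l powr (2 * \<alpha> - 1)))"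
      by (intro mult_mono) (auto simp: C_def)
    finally show ?thesis .
  qed
  moreover have "0 < C" by (simp add: C_def)
  ultimately show ?thesis using c by blast
qed

end

section \<open>Sums of products of probabilities\<close>

text \<open>Comparison with the integral: by the mean value theorem each summand is at most the
  increment of \<open>x powr (1 - b) / (1 - b)\<close>.\<close>

lemma sum_powr_minus_le:
  fixes b :: real
  assumes b: "0 < b" "b < 1"
  shows "(\<Sum>m\<le>r. (real m + 1) powr (- b)) \<le> (real r + 1) powr (1 - b) / (1 - b)"
proof (induction r)
  case 0
  then show ?case using b by (simp add: le_divide_eq)
next
  case (Suc r)
  define x where "x = real r + 1"
  have x: "0 < x" by (simp add: x_def)
  have "\<exists>z>x. z < x + 1 \<and> (x + 1) powr (1 - b) - x powr (1 - b) = (x + 1 - x) * ((1 - b) * z powr (- b))"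
    by (rule MVT2) (use x in \<open>auto intro!: derivative_eq_intros\<close>)
  then obtain z where z: "x < z" "z < x + 1"
    "(x + 1) powr (1 - b) - x powr (1 - b) = (1 - b) * z powr (- b)" by auto
  have "(x + 1) powr (- b) \<le> z powr (- b)"
    using z x b by (intro powr_mono2') auto
  also have "z powr (- b) = ((x + 1) powr (1 - b) - x powr (1 - b)) / (1 - b)"
    using b by (simp add: z(3))
  finally have "(x + 1) powr (- b) \<le> (x + 1) powr (1 - b) / (1 - b) - x powr (1 - b) / (1 - b)"
    by (simp add: diff_divide_distrib)
  with Suc show ?case by (simp add: x_def add_ac)
qed

lemma one_div_le_exp:
  fixes r r0 :: real
  assumes "0 < r0" "r0 \<le> r" "r \<le> 1"
  shows "inverse r \<le> exp ((1 - r) / r0)"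
proof -
  have "inverse r = 1 + (1 - r) / r" using assms by (simp add: field_simps)
  also have "\<dots> \<le> 1 + (1 - r) / r0" using assms by (intro add_left_mono divide_left_mono) auto
  also have "\<dots> \<le> exp ((1 - r) / r0)" by (rule exp_ge_add_one_self)
  finally show ?thesis .
qed

text \<open>Since \<open>u < v\<close>, the growing exponent is eventually at most half of the
  decaying one.\<close>

lemma stretched_exp_summable:
  fixes c C u v :: real
  assumes "0 < c" "0 < u" "u < v"
  shows "summable (\<lambda>r. (real r + 1) * exp (- c * real r powr v) * exp (C * (real r + 1) powr u))"
proof (rule summable_comparison_test_bigo)
  show "summable (\<lambda>r. norm (real r powr (-2)))"
    by (simp add: summable_real_powr_iff)
  have l: "((\<lambda>r::nat. (C * (real r + 1) powr u) / real r powr v) \<longlongrightarrow> 0) sequentially"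
    using assms by real_asymp
  have "eventually (\<lambda>r::nat. (C * (real r + 1) powr u) / real r powr v < c / 2) sequentially"
    using assms by (intro order_tendstoD(2)[OF l]) auto
  then have "eventually (\<lambda>r::nat. (real r + 1) * exp (- c * real r powr v) * exp (C * (real r + 1) powr u)
      \<le> (real r + 1) * exp (- (c / 2) * real r powr v)) sequentially"
    using eventually_gt_at_top[of 0]
  proof eventually_elim
    case (elim r)
    then have "C * (real r + 1) powr u \<le> c / 2 * real r powr v" by (simp add: field_simps)
    then show ?case by (simp add: mult.assoc exp_add[symmetric])
  qed
  then have "(\<lambda>r. (real r + 1) * exp (- c * real r powr v) * exp (C * (real r + 1) powr u))
    \<in> O(\<lambda>r. (real r + 1) * exp (- (c / 2) * real r powr v))"
    by (intro bigoI[where c = 1]) (auto elim!: eventually_mono)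
  also have "(\<lambda>r. (real r + 1) * exp (- (c / 2) * real r powr v)) \<in> O(\<lambda>r::nat. real r powr (-2))"
    using assms by real_asymp
  finally show "(\<lambda>r. (real r + 1) * exp (- c * real r powr v) * exp (C * (real r + 1) powr u))
    \<in> O(\<lambda>r. real r powr (-2))" .
qed

text \<open>Giving up the factors up to a bad time \<open>r\<close> costs the inverse of their
  product. Tails of order \<open>(real m + 1) powr (- b)\<close> add up to order
  \<open>(real r + 1) powr (1 - b)\<close>, and \<open>1 - b < v\<close> lets the stretched
  exponential in the bound for \<open>w r\<close> win.\<close>

lemma summable_bad_inverse_prod:
  fixes \<rho> w :: "nat \<Rightarrow> real"
  assumes \<rho>0: "0 < \<rho>0" "\<And>m. \<rho>0 \<le> \<rho> m" "\<And>m. \<rho> m \<le> 1"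
    and b: "0 < b" "b < 1" "1 - b < v"
    and tail: "\<And>m. 1 - \<rho> m \<le> C1 * (real m + 1) powr (- b)"
    and w: "\<And>r. 0 \<le> w r" "\<And>r. w r \<le> C2 * ((real r + 1) * exp (- c * real r powr v))" "0 < c" "0 < C2"
  shows "summable (\<lambda>r. w r * inverse (\<Prod>m\<le>r. \<rho> m))"
proof (rule summable_comparison_test')
  define C where "C = C1 / \<rho>0 / (1 - b)"
  have C1: "0 \<le> C1" using tail[of 0] \<rho>0(3)[of 0] by (simp add: powr_minus)
  show "summable (\<lambda>r. C2 * ((real r + 1) * exp (- c * real r powr v) * exp (C * (real r + 1) powr (1 - b))))"
    using b w by (intro summable_mult stretched_exp_summable) auto
  fix r :: nat assume "0 \<le> r"
  have pos: "0 < \<rho> m" for m using \<rho>0 by (meson less_le_trans)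
  have "inverse (\<Prod>m\<le>r. \<rho> m) = (\<Prod>m\<le>r. inverse (\<rho> m))"
    using prod_inversef[of \<rho> "{..r}"] by (simp add: comp_def)
  also have "\<dots> \<le> (\<Prod>m\<le>r. exp ((1 - \<rho> m) / \<rho>0))"
    using \<rho>0 pos by (intro prod_mono conjI one_div_le_exp) (auto simp: less_imp_le)
  also have "\<dots> = exp ((\<Sum>m\<le>r. 1 - \<rho> m) / \<rho>0)"
    by (simp add: exp_sum sum_divide_distrib)
  also have "\<dots> \<le> exp ((\<Sum>m\<le>r. C1 * (real m + 1) powr (- b)) / \<rho>0)"
    using \<rho>0 by (simp add: divide_right_mono sum_mono tail)
  also have "\<dots> = exp (C1 * (\<Sum>m\<le>r. (real m + 1) powr (- b)) / \<rho>0)"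
    by (simp add: sum_distrib_left)
  also have "\<dots> \<le> exp (C1 * ((real r + 1) powr (1 - b) / (1 - b)) / \<rho>0)"
    using \<rho>0 C1 b by (intro exp_le_cancel_iff[THEN iffD2] divide_right_mono mult_left_mono sum_powr_minus_le) auto
  also have "\<dots> = exp (C * (real r + 1) powr (1 - b))" by (simp add: C_def)
  finally have i: "inverse (\<Prod>m\<le>r. \<rho> m) \<le> exp (C * (real r + 1) powr (1 - b))" .
  have "0 \<le> inverse (\<Prod>m\<le>r. \<rho> m)" using pos by (simp add: prod_nonneg less_imp_le)
  then have "norm (w r * inverse (\<Prod>m\<le>r. \<rho> m)) = w r * inverse (\<Prod>m\<le>r. \<rho> m)"
    using w(1) by simp
  also have "\<dots> \<le> (C2 * ((real r + 1) * exp (- c * real r powr v))) * exp (C * (real r + 1) powr (1 - b))"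
    using \<open>0 \<le> inverse (\<Prod>m\<le>r. \<rho> m)\<close> w by (intro mult_mono w i) auto
  finally show "norm (w r * inverse (\<Prod>m\<le>r. \<rho> m))
     \<le> C2 * ((real r + 1) * exp (- c * real r powr v) * exp (C * (real r + 1) powr (1 - b)))"
    by (simp add: mult_ac)
qed

text \<open>Each \<open>g m\<close> is at most \<open>\<rho> m\<close> times 1 plus the relative
  excess; as the total excess is finite, all of it costs one constant factor, whatever the finite
  set \<open>J\<close>.\<close>

lemma prod_ratio_le_exp:
  fixes \<rho> g :: "nat \<Rightarrow> real"
  assumes \<rho>0: "0 < \<rho>0" "\<And>m. \<rho>0 \<le> \<rho> m" and g: "\<And>m. 0 \<le> g m"
    and s: "summable (\<lambda>m. max 0 (g m - \<rho> m))" and J: "finite J"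
  shows "(\<Prod>m\<in>J. g m) \<le> exp ((\<Sum>m. max 0 (g m - \<rho> m)) / \<rho>0) * (\<Prod>m\<in>J. \<rho> m)"
proof -
  have pos: "0 < \<rho> m" for m using \<rho>0 by (meson less_le_trans)
  have "g m \<le> exp (max 0 (g m - \<rho> m) / \<rho>0) * \<rho> m" for m
  proof -
    have "g m \<le> \<rho> m + max 0 (g m - \<rho> m)" by simp
    also have "\<dots> \<le> \<rho> m + max 0 (g m - \<rho> m) / \<rho>0 * \<rho> m"
      using \<rho>0(1) \<rho>0(2)[of m] mult_left_mono[OF \<rho>0(2)[of m], of "max 0 (g m - \<rho> m)"]
      by (simp add: le_divide_eq)
    also have "\<dots> = (1 + max 0 (g m - \<rho> m) / \<rho>0) * \<rho> m" by (simp add: algebra_simps)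
    also have "\<dots> \<le> exp (max 0 (g m - \<rho> m) / \<rho>0) * \<rho> m"
      using pos[of m] by (intro mult_right_mono exp_ge_add_one_self) auto
    finally show ?thesis .
  qed
  then have "(\<Prod>m\<in>J. g m) \<le> (\<Prod>m\<in>J. exp (max 0 (g m - \<rho> m) / \<rho>0) * \<rho> m)"
    using g by (intro prod_mono) auto
  also have "\<dots> = exp ((\<Sum>m\<in>J. max 0 (g m - \<rho> m)) / \<rho>0) * (\<Prod>m\<in>J. \<rho> m)"
    using J by (simp add: prod.distrib exp_sum sum_divide_distrib)
  also have "\<dots> \<le> exp ((\<Sum>m. max 0 (g m - \<rho> m)) / \<rho>0) * (\<Prod>m\<in>J. \<rho> m)"
    using \<rho>0 pos J by (intro mult_right_mono) (auto intro!: prod_nonneg divide_right_mono sum_le_suminf s simp: less_imp_le)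
  finally show ?thesis .
qed

text \<open>Behind \<open>r\<close> the factors \<open>g\<close> are replaced by
  \<open>\<rho>\<close> at a constant cost; up to \<open>r\<close> the missing factors are restored
  by dividing. What remains is the product of \<open>\<rho>\<close> below \<open>n\<close> times a
  convergent series in \<open>r\<close>, so summability is inherited.\<close>

lemma summable_last_bad_heavy:
  fixes \<rho> g w :: "nat \<Rightarrow> real"
  assumes \<rho>0: "0 < \<rho>0" "\<And>m. \<rho>0 \<le> \<rho> m" "\<And>m. \<rho> m \<le> 1" and g: "\<And>m. 0 \<le> g m"
    and s: "summable (\<lambda>m. max 0 (g m - \<rho> m))"
    and w: "\<And>r. 0 \<le> w r" "summable (\<lambda>r. w r * inverse (\<Prod>m\<le>r. \<rho> m))"
    and R: "summable (\<lambda>n. \<Prod>m<n. \<rho> m)"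
  shows "summable (\<lambda>n. \<Sum>r\<le>n. w r * (\<Prod>m\<in>{r<..<n}. g m))"
proof (rule summable_comparison_test')
  define E where "E = exp ((\<Sum>m. max 0 (g m - \<rho> m)) / \<rho>0)"
  define V where "V = (\<Sum>r. w r * inverse (\<Prod>m\<le>r. \<rho> m))"
  show "summable (\<lambda>n. E * V * (\<Prod>m<n. \<rho> m))" by (intro summable_mult R)
  fix n :: nat assume "0 \<le> n"
  have pos: "0 < \<rho> m" for m using \<rho>0 by (meson less_le_trans)
  have pp: "0 < (\<Prod>m\<in>J. \<rho> m)" for J using pos by (simp add: prod_pos)
  have "(\<Sum>r\<le>n. w r * (\<Prod>m\<in>{r<..<n}. g m)) \<le> (\<Sum>r\<le>n. E * (\<Prod>m<n. \<rho> m) * (w r * inverse (\<Prod>m\<le>r. \<rho> m)))"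
  proof (rule sum_mono)
    fix r assume "r \<in> {..n}"
    have "(\<Prod>m\<in>{..r}. \<rho> m) * (\<Prod>m\<in>{r<..<n}. \<rho> m) = (\<Prod>m\<in>{..r} \<union> {r<..<n}. \<rho> m)"
      by (subst prod.union_disjoint) auto
    \<comment> \<open>For \<open>r = n\<close> the union contains the extra index \<open>n\<close>,
      whose factor is at most 1.\<close>
    also have "\<dots> \<le> (\<Prod>m<n. \<rho> m)"
    proof -
      have "{..r} \<union> {r<..<n} = {..<n} \<union> (({..r} \<union> {r<..<n}) - {..<n})" by auto
      then have "(\<Prod>m\<in>{..r} \<union> {r<..<n}. \<rho> m) = (\<Prod>m<n. \<rho> m) * (\<Prod>m\<in>({..r} \<union> {r<..<n}) - {..<n}. \<rho> m)"
        by (metis (no_types, lifting) Diff_disjoint finite_Diff finite_Un finite_atMost finite_greaterThanLessThan finite_lessThan prod.union_disjoint)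
      also have "\<dots> \<le> (\<Prod>m<n. \<rho> m) * 1"
        using pp[of "{..<n}"] pos \<rho>0 by (intro mult_left_mono prod_le_1) (auto simp: less_imp_le)
      finally show ?thesis by simp
    qed
    finally have "(\<Prod>m\<in>{r<..<n}. \<rho> m) \<le> (\<Prod>m<n. \<rho> m) * inverse (\<Prod>m\<le>r. \<rho> m)"
      using pp[of "{..r}"] by (simp add: field_simps)
    then have "E * (\<Prod>m\<in>{r<..<n}. \<rho> m) \<le> E * ((\<Prod>m<n. \<rho> m) * inverse (\<Prod>m\<le>r. \<rho> m))"
      by (intro mult_left_mono) (auto simp: E_def)
    moreover have "(\<Prod>m\<in>{r<..<n}. g m) \<le> E * (\<Prod>m\<in>{r<..<n}. \<rho> m)"
      unfolding E_def by (intro prod_ratio_le_exp \<rho>0 g s) auto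
    ultimately have "w r * (\<Prod>m\<in>{r<..<n}. g m) \<le> w r * (E * ((\<Prod>m<n. \<rho> m) * inverse (\<Prod>m\<le>r. \<rho> m)))"
      using w(1)[of r] by (intro mult_left_mono) auto
    then show "w r * (\<Prod>m\<in>{r<..<n}. g m) \<le> E * (\<Prod>m<n. \<rho> m) * (w r * inverse (\<Prod>m\<le>r. \<rho> m))"
      by (simp add: mult_ac)
  qed
  also have "\<dots> = E * (\<Prod>m<n. \<rho> m) * (\<Sum>r\<le>n. w r * inverse (\<Prod>m\<le>r. \<rho> m))"
    by (simp add: sum_distrib_left)
  also have "\<dots> \<le> E * (\<Prod>m<n. \<rho> m) * V"
    unfolding V_def using pp w(1)
    by (intro mult_left_mono sum_le_suminf w(2)) (auto simp: E_def less_imp_le)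
  finally show "norm (\<Sum>r\<le>n. w r * (\<Prod>m\<in>{r<..<n}. g m)) \<le> E * V * (\<Prod>m<n. \<rho> m)"
    using w(1) g by (simp add: sum_nonneg prod_nonneg mult_ac)
qed

lemma prod_ratio_telescope:
  assumes "r < n"
  shows "(\<Prod>m\<in>{r<..<n}. (real m / (real m + 1)) powr a) = ((real r + 1) / real n) powr a"
  using assms
proof (induction n)
  case (Suc n)
  show ?case
  proof (cases "r = n")
    case True
    then have "{r<..<Suc n} = {}" by auto
    moreover have "(real n + 1) / (1 + real n) = 1" by simp
    ultimately show ?thesis using True by (simp add: add.commute)
  next
    case False
    with Suc.prems have "r < n" by simp
    then have "{r<..<Suc n} = insert n {r<..<n}" by auto
    with \<open>r < n\<close> Suc.IH show ?thesis
      by (simp add: powr_mult[symmetric] add_ac)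
  qed
qed simp

text \<open>Up to finitely many factors, \<open>1 - a / real m\<close> lies below
  \<open>(real m / (real m + 1)) powr a\<close>, whose products telescope to
  \<open>((real r + 1) / real n) powr a\<close>. As \<open>a > 1\<close> this is summable in
  \<open>n\<close>, and \<open>w\<close> pays for the power of \<open>r\<close>.\<close>

lemma summable_last_bad_light:
  fixes g w :: "nat \<Rightarrow> real"
  assumes a: "1 < a" and g: "\<And>m. 0 \<le> g m" "\<And>m. g m \<le> H" "\<And>m. m1 \<le> m \<Longrightarrow> g m \<le> 1 - a / real m"
    and w: "\<And>r. 0 \<le> w r" "summable (\<lambda>r. w r * (real r + 1) powr a)"
  shows "summable (\<lambda>n. \<Sum>r\<le>n. w r * (\<Prod>m\<in>{r<..<n}. g m))"
proof (rule summable_comparison_test')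
  define h where "h m = (real m / (real m + 1)) powr a" for m :: nat
  \<comment> \<open>Price of one factor below \<open>m1\<close>: there \<open>g m\<close> is only
    known to be at most \<open>H\<close>, and \<open>h m\<close> is at least
    \<open>2 powr (- a)\<close>.\<close>
  define C where "C = max 1 (H * 2 powr a)"
  define V where "V = (\<Sum>r. w r * (real r + 1) powr a)"
  show "summable (\<lambda>n. C ^ m1 * V * real n powr (- a))"
    using a by (intro summable_mult) (simp add: summable_real_powr_iff)
  fix n :: nat assume n: "1 \<le> n"
  have h_ge: "1 \<le> 2 powr a * h m" if "1 \<le> m" for m
  proof -
    have "2 powr a * h m = (2 * (real m / (real m + 1))) powr a"
      unfolding h_def by (subst powr_mult) auto
    also have "\<dots> \<ge> 1" using that a by (intro ge_one_powr_ge_zero) (auto simp: field_simps)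
    finally show ?thesis .
  qed
  have g_le: "g m \<le> (if m < m1 then C else 1) * h m" if "1 \<le> m" for m
  proof (cases "m < m1")
    case True
    have "g m \<le> H * 1" using g by simp
    also have "\<dots> \<le> H * (2 powr a * h m)"
      using h_ge[OF that] g(1,2)[of m] by (intro mult_left_mono) auto
    also have "\<dots> \<le> C * h m" by (simp add: C_def h_def mult.assoc[symmetric] mult_right_mono)
    finally show ?thesis using True by simp
  next
    case False
    have "ln ((real m + 1) / real m) \<le> 1 / real m"
      using that ln_add_one_self_le_self[of "1 / real m"] by (simp add: add_divide_distrib)
    then have "a * ln ((real m + 1) / real m) \<le> a * (1 / real m)"
      using a by (intro mult_left_mono) auto
    then have "exp (- (a / real m)) \<le> exp (- (a * ln ((real m + 1) / real m)))" by simp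
    also have "\<dots> = h m" using that by (simp add: h_def powr_def ln_div algebra_simps)
    finally have 1: "exp (- (a / real m)) \<le> h m" .
    have "g m \<le> 1 + - (a / real m)" using g(3) False by simp
    also have "\<dots> \<le> exp (- (a / real m))" by (rule exp_ge_add_one_self)
    finally show ?thesis using 1 False by simp
  qed
  have prod_le: "(\<Prod>m\<in>{r<..<n}. g m) \<le> C ^ m1 * ((real r + 1) powr a * real n powr (- a))" if "r \<le> n" for r
  proof -
    have "(\<Prod>m\<in>{r<..<n}. g m) \<le> (\<Prod>m\<in>{r<..<n}. (if m < m1 then C else 1) * h m)"
      using g g_le by (intro prod_mono) auto
    also have "\<dots> = (\<Prod>m\<in>{r<..<n}. (if m < m1 then C else 1)) * (\<Prod>m\<in>{r<..<n}. h m)"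
      by (rule prod.distrib)
    also have "\<dots> \<le> C ^ m1 * ((real r + 1) / real n) powr a"
    proof (rule mult_mono)
      have "(\<Prod>m\<in>{r<..<n}. (if m < m1 then C else 1)) = C ^ card ({r<..<n} \<inter> {m. m < m1})"
        by (simp add: prod.If_cases)
      also have "\<dots> \<le> C ^ card {..<m1}"
        by (intro power_increasing card_mono) (auto simp: C_def)
      finally show "(\<Prod>m\<in>{r<..<n}. (if m < m1 then C else 1)) \<le> C ^ m1" by simp
      show "(\<Prod>m\<in>{r<..<n}. h m) \<le> ((real r + 1) / real n) powr a"
      proof (cases "r < n")
        case True
        then show ?thesis unfolding h_def by (simp add: prod_ratio_telescope)
      next
        case False
        then have "{r<..<n} = {}" by auto
        then show ?thesis using False n that a by (simp add: ge_one_powr_ge_zero)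
      qed
    qed (auto simp: C_def h_def intro!: prod_nonneg)
    also have "((real r + 1) / real n) powr a = (real r + 1) powr a * real n powr (- a)"
      using n by (simp add: divide_inverse powr_mult inverse_powr powr_minus)
    finally show ?thesis .
  qed
  have "(\<Sum>r\<le>n. w r * (\<Prod>m\<in>{r<..<n}. g m)) \<le> (\<Sum>r\<le>n. w r * (C ^ m1 * ((real r + 1) powr a * real n powr (- a))))"
    using w by (intro sum_mono mult_left_mono prod_le) auto
  also have "\<dots> = C ^ m1 * real n powr (- a) * (\<Sum>r\<le>n. w r * (real r + 1) powr a)"
    by (simp add: sum_distrib_left mult_ac)
  also have "\<dots> \<le> C ^ m1 * real n powr (- a) * V"
    unfolding V_def using w by (intro mult_left_mono sum_le_suminf) (auto simp: C_def)
  finally show "norm (\<Sum>r\<le>n. w r * (\<Prod>m\<in>{r<..<n}. g m)) \<le> C ^ m1 * V * real n powr (- a)"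
    using w(1) g by (simp add: sum_nonneg prod_nonneg mult_ac)
qed

section \<open>Upper and lower bounds for the reversed process\<close>

lemma card_nat_interval_le:
  fixes lam l w :: real
  assumes "0 < lam" "0 \<le> w"
  shows "real (card {m. m < n \<and> \<bar>lam * real m - l\<bar> \<le> w}) \<le> 2 * w / lam + 1"
proof -
  let ?I = "{\<lceil>(l - w) / lam\<rceil>..\<lfloor>(l + w) / lam\<rfloor>}"
  have "{m. m < n \<and> \<bar>lam * real m - l\<bar> \<le> w} \<subseteq> nat ` ?I"
  proof
    fix m assume "m \<in> {m. m < n \<and> \<bar>lam * real m - l\<bar> \<le> w}"
    then have "(l - w) / lam \<le> real_of_int (int m)" "real_of_int (int m) \<le> (l + w) / lam"
      using assms by (auto simp: field_simps abs_le_iff)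
    then have "int m \<in> ?I" by (simp only: atLeastAtMost_iff ceiling_le_iff le_floor_iff)
    then show "m \<in> nat ` ?I" by (metis image_eqI nat_int)
  qed
  then have "card {m. m < n \<and> \<bar>lam * real m - l\<bar> \<le> w} \<le> card (nat ` ?I)"
    by (intro card_mono) auto
  also have "\<dots> \<le> card ?I" by (rule card_image_le) simp
  finally have 1: "real (card {m. m < n \<and> \<bar>lam * real m - l\<bar> \<le> w}) \<le> real (card ?I)" by simp
  have e: "(l + w) / lam = (l - w) / lam + 2 * w / lam"
    unfolding add_divide_distrib[symmetric] by simp
  have "real_of_int (\<lfloor>(l + w) / lam\<rfloor> - \<lceil>(l - w) / lam\<rceil> + 1) \<le> 2 * w / lam + 1"
    unfolding of_int_add of_int_diff of_int_1
    using of_int_floor_le[of "(l + w) / lam"] le_of_int_ceiling[of "(l - w) / lam"] e by linarith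
  moreover have "0 \<le> 2 * w / lam + 1" using assms by simp
  ultimately have "real (card ?I) \<le> 2 * w / lam + 1" by simp
  with 1 show ?thesis by simp
qed

text \<open>Layer-cake bound by counting the naturals below \<open>W\<close>; it lets an expectation
  be estimated by a series of tail probabilities.\<close>

lemma real_le_suminf_indicator:
  assumes "0 \<le> W"
  shows "ennreal W \<le> (\<Sum>k. indicator {k. real k < W} k)"
proof -
  have "ennreal W \<le> ennreal (real (nat \<lceil>W\<rceil>))" by (intro ennreal_leI) linarith
  also have "\<dots> = (\<Sum>k<nat \<lceil>W\<rceil>. 1)" by (simp add: ennreal_of_nat_eq_real_of_nat)
  also have "\<dots> = (\<Sum>k<nat \<lceil>W\<rceil>. indicator {k. real k < W} k)"
    by (intro sum.cong refl) (auto simp: indicator_def, linarith)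
  also have "\<dots> \<le> (\<Sum>k. indicator {k. real k < W} k)"
    by (intro sum_le_suminf) auto
  finally show ?thesis .
qed

section \<open>The law of the immigration norm and its thresholds\<close>

context iid_environment
begin

definition Q :: "real \<Rightarrow> real" where
  "Q t = measure N {z \<in> space N. infnorm (snd z) \<le> t}"

lemma infnorm_event [measurable]: "{z \<in> space N. infnorm (snd z) \<le> t} \<in> sets N"
  by measurable

lemma Q_le1: "Q t \<le> 1" and Q_nonneg: "0 \<le> Q t"
  unfolding Q_def by auto

lemma Q_mono: "s \<le> t \<Longrightarrow> Q s \<le> Q t"
  unfolding Q_def by (intro M.finite_measure_mono) auto

lemma one_minus_Q: "1 - Q t = measure N {z \<in> space N. t < infnorm (snd z)}"
proof -
  have "{z \<in> space N. t < infnorm (snd z)} = space N - {z \<in> space N. infnorm (snd z) \<le> t}" by auto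
  then show ?thesis unfolding Q_def by (simp add: M.prob_compl[OF infnorm_event])
qed

lemma Q_diff: "s \<le> t \<Longrightarrow> Q t - Q s = measure N {z \<in> space N. s < infnorm (snd z) \<and> infnorm (snd z) \<le> t}"
proof -
  assume st: "s \<le> t"
  have "{z \<in> space N. s < infnorm (snd z) \<and> infnorm (snd z) \<le> t}
     = {z \<in> space N. infnorm (snd z) \<le> t} - {z \<in> space N. infnorm (snd z) \<le> s}" by auto
  moreover have "measure N ({z \<in> space N. infnorm (snd z) \<le> t} - {z \<in> space N. infnorm (snd z) \<le> s}) = Q t - Q s"
    unfolding Q_def using st by (intro M.finite_measure_Diff infnorm_event) auto
  ultimately show ?thesis by simp
qed

text \<open>Count the windows for a fixed \<open>z\<close> before integrating: \<open>z\<close> lies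
  in window \<open>m\<close> only if \<open>lam * real m\<close> differs from the logarithm
  \<open>l\<close> of its norm by order \<open>real m powr \<alpha>\<close>, and there are only
  order \<open>W z\<close> such \<open>m\<close>. The series is thus bounded by a multiple of the
  expectation of \<open>W\<close>, finite because \<open>\<alpha> < \<beta>\<close>.\<close>

lemma band_summable:
  assumes tail: "\<And>x. x0 \<le> x \<Longrightarrow> 1 - Q (exp x) \<le> x powr (- \<beta>)"
    and a: "0 < \<alpha>" "\<alpha> < \<beta>" "\<alpha> < 1" and c: "0 \<le> c"
  shows "summable (\<lambda>m. measure N {z \<in> space N.
     exp (lam * real m - 3 * real m powr \<alpha> - c) < infnorm (snd z) \<and>
     infnorm (snd z) \<le> exp (lam * real m + 3 * real m powr \<alpha> + c)})"
proof -
  define A where "A m = {z \<in> space N.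
     exp (lam * real m - 3 * real m powr \<alpha> - c) < infnorm (snd z) \<and>
     infnorm (snd z) \<le> exp (lam * real m + 3 * real m powr \<alpha> + c)}" for m :: nat
  have [measurable]: "A m \<in> sets N" for m unfolding A_def by measurable
  \<comment> \<open>The summand 1 gives \<open>W z \<ge> 1\<close>, so that additive constants can
    be absorbed into multiples of \<open>W z\<close>.\<close>
  define W where "W z = (1 + max 0 (ln (infnorm (snd z)))) powr \<alpha>" for z :: "(real ^ 'd ^ 'd) \<times> (real ^ 'd)"
  have [measurable]: "W \<in> borel_measurable N" unfolding W_def by measurable
  have W1: "1 \<le> W z" for z unfolding W_def using a by (intro ge_one_powr_ge_zero) auto
  have "eventually (\<lambda>m::nat. 3 * real m powr \<alpha> + c \<le> lam * real m / 2) sequentially"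
    using a lam by real_asymp
  then obtain m0 where m0: "\<And>m. m0 \<le> m \<Longrightarrow> 3 * real m powr \<alpha> + c \<le> lam * real m / 2"
    by (auto simp: eventually_sequentially)
  \<comment> \<open>Covers the finitely many \<open>m\<close> below \<open>m0\<close> as well;
    \<open>C0 \<ge> 1\<close> is used to absorb \<open>l\<close> into a multiple of
    \<open>1 + max 0 l\<close>.\<close>
  define C0 where "C0 = 3 * real m0 powr \<alpha> + c + 1"
  have C0: "3 * real m powr \<alpha> + c \<le> lam * real m / 2 + C0" for m
  proof (cases "m0 \<le> m")
    case True
    moreover have "0 \<le> C0" using c by (simp add: C0_def)
    ultimately show ?thesis using m0[of m] by simp
  next
    case False
    then have "real m powr \<alpha> \<le> real m0 powr \<alpha>" using a by (intro powr_mono2) auto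
    then show ?thesis using lam by (simp add: C0_def add_increasing)
  qed
  have C01: "1 \<le> C0" using c by (simp add: C0_def)
  \<comment> \<open>A window containing \<open>z\<close> has index at most
    \<open>2 * C0 / lam * (1 + max 0 l)\<close>, so its half-width is at most
    \<open>C4 * W z\<close>.\<close>
  define C4 where "C4 = 3 * (2 * C0 / lam) powr \<alpha> + c"
  define C5 where "C5 = 2 * C4 / lam + 1"
  have C5: "0 \<le> C5" using lam c by (simp add: C5_def C4_def)
  have count: "(\<Sum>m. indicator (A m) z) \<le> ennreal C5 * (\<Sum>k. indicator {k. real k < W z} k)" for z
  proof -
    define l where "l = ln (infnorm (snd z))"
    have in_A: "\<bar>lam * real m - l\<bar> \<le> C4 * W z" if "z \<in> A m" for m
    proof -
      have p: "0 < infnorm (snd z)" using that unfolding A_def by (auto intro: less_trans[OF exp_gt_zero])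
      have "lam * real m - 3 * real m powr \<alpha> - c < l" "l \<le> lam * real m + 3 * real m powr \<alpha> + c"
        using that p ln_less_cancel_iff[of "exp (lam * real m - 3 * real m powr \<alpha> - c)" "infnorm (snd z)"]
          ln_le_cancel_iff[of "infnorm (snd z)" "exp (lam * real m + 3 * real m powr \<alpha> + c)"]
        unfolding A_def l_def by auto
      then have 1: "\<bar>lam * real m - l\<bar> \<le> 3 * real m powr \<alpha> + c" by (simp add: abs_le_iff)
      then have "lam * real m / 2 \<le> l + C0" using C0[of m] by (simp add: abs_le_iff)
      also have "\<dots> \<le> C0 * (1 + max 0 l)"
        using C01 mult_right_mono[of 1 C0 "max 0 l"] by (simp add: algebra_simps)
      finally have "real m \<le> 2 * C0 / lam * (1 + max 0 l)" using lam by (simp add: field_simps)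
      then have "real m powr \<alpha> \<le> (2 * C0 / lam * (1 + max 0 l)) powr \<alpha>" using a by (intro powr_mono2) auto
      also have "\<dots> = (2 * C0 / lam) powr \<alpha> * W z"
        unfolding W_def l_def[symmetric] by (subst powr_mult) (use lam C01 in auto)
      finally have "3 * real m powr \<alpha> + c \<le> 3 * ((2 * C0 / lam) powr \<alpha> * W z) + c * W z"
        using W1[of z] c mult_left_mono[of 1 "W z" c] by simp
      with 1 show ?thesis by (simp add: C4_def algebra_simps)
    qed
    have C4: "0 \<le> C4 * W z" using c W1[of z] by (auto simp: C4_def)
    have "(\<Sum>m<n. indicator (A m) z) \<le> ennreal (C5 * W z)" for n
    proof -
      have "(\<Sum>m<n. indicator (A m) z) = (\<Sum>m<n. if z \<in> A m then 1 else 0 :: ennreal)"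
        by (intro sum.cong) (auto simp: indicator_def)
      also have "\<dots> = (\<Sum>m\<in>{m \<in> {..<n}. z \<in> A m}. 1)"
        by (rule sum.inter_filter[symmetric]) simp
      also have "\<dots> = of_nat (card {m. m < n \<and> z \<in> A m})" by simp
      also have "\<dots> = ennreal (real (card {m. m < n \<and> z \<in> A m}))"
        by (simp add: ennreal_of_nat_eq_real_of_nat)
      also have "\<dots> \<le> ennreal (C5 * W z)"
      proof (rule ennreal_leI)
        have "real (card {m. m < n \<and> z \<in> A m}) \<le> real (card {m. m < n \<and> \<bar>lam * real m - l\<bar> \<le> C4 * W z})"
          using in_A by (intro of_nat_mono card_mono) auto
        also have "\<dots> \<le> 2 * (C4 * W z) / lam + 1" by (rule card_nat_interval_le[OF lam C4])
        also have "\<dots> \<le> C5 * W z" using W1[of z] by (simp add: C5_def algebra_simps)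
        finally show "real (card {m. m < n \<and> z \<in> A m}) \<le> C5 * W z" .
      qed
      finally show ?thesis .
    qed
    then have "(\<Sum>m. indicator (A m) z) \<le> ennreal (C5 * W z)"
      by (intro suminf_le_const) auto
    also have "\<dots> = ennreal C5 * ennreal (W z)" using C5 W1[of z] by (simp add: ennreal_mult)
    also have "\<dots> \<le> ennreal C5 * (\<Sum>k. indicator {k. real k < W z} k)"
      using W1[of z] by (intro mult_left_mono real_le_suminf_indicator) auto
    finally show ?thesis .
  qed
  define t where "t k = measure N {z \<in> space N. real k < W z}" for k :: nat
  \<comment> \<open>\<open>W\<close> exceeds \<open>k\<close> only if the logarithm of the norm
    exceeds \<open>real k powr (1 / \<alpha>) - 1\<close>. This has probability of order
    \<open>real k powr (- (\<beta> / \<alpha>))\<close>, and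
    \<open>\<beta> / \<alpha> > 1\<close>.\<close>
  have t_sum: "summable t"
  proof (rule summable_comparison_test_bigo)
    show "summable (\<lambda>k. norm (real k powr (- (\<beta> / \<alpha>))))"
      using a by (simp add: summable_real_powr_iff)
    have "eventually (\<lambda>k::nat. max 1 x0 \<le> real k powr (1 / \<alpha>) - 1) sequentially"
      using a by real_asymp
    then have "eventually (\<lambda>k. t k \<le> (real k powr (1 / \<alpha>) - 1) powr (- \<beta>)) sequentially"
    proof eventually_elim
      case (elim k)
      define x where "x = real k powr (1 / \<alpha>) - 1"
      have x: "1 \<le> x" "x0 \<le> x" using elim by (auto simp: x_def)
      have "{z \<in> space N. real k < W z} \<subseteq> {z \<in> space N. exp x < infnorm (snd z)}"
      proof safe
        fix z assume z: "z \<in> space N" "real k < W z"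
        define v where "v = max 0 (ln (infnorm (snd z)))"
        have "real k powr (1 / \<alpha>) < ((1 + v) powr \<alpha>) powr (1 / \<alpha>)"
          using z(2) a unfolding W_def v_def[symmetric] by (intro powr_less_mono2) auto
        also have "\<dots> = 1 + v" using a by (simp add: powr_powr v_def)
        finally have "x < v" by (simp add: x_def)
        then have "x < ln (infnorm (snd z))" using x by (auto simp: v_def max_def split: if_splits)
        moreover have "0 < infnorm (snd z)"
          using calculation x infnorm_pos_le[of "snd z"] by (cases "infnorm (snd z) = 0") auto
        ultimately show "exp x < infnorm (snd z)"
          using exp_less_cancel_iff[of x "ln (infnorm (snd z))"] by simp
      qed
      then have "t k \<le> measure N {z \<in> space N. exp x < infnorm (snd z)}"
        unfolding t_def by (intro M.finite_measure_mono) auto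
      also have "\<dots> \<le> x powr (- \<beta>)" using tail[OF x(2)] by (simp add: one_minus_Q)
      finally show ?case by (simp add: x_def)
    qed
    then have "t \<in> O(\<lambda>k. (real k powr (1 / \<alpha>) - 1) powr (- \<beta>))"
      by (intro bigoI[where c = 1]) (auto elim!: eventually_mono simp: t_def)
    also have "(\<lambda>k. (real k powr (1 / \<alpha>) - 1) powr (- \<beta>)) \<in> O(\<lambda>k. real k powr (- (\<beta> / \<alpha>)))"
      using a by real_asymp
    finally show "t \<in> O(\<lambda>k. real k powr (- (\<beta> / \<alpha>)))" .
  qed
  have tt: "(\<Sum>k. ennreal (t k)) \<noteq> \<top>"
    by (intro ennreal_suminf_neq_top t_sum) (simp add: t_def)
  have "(\<Sum>m. ennreal (measure N (A m))) = (\<Sum>m. \<integral>\<^sup>+z. indicator (A m) z \<partial>N)"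
    by (simp add: M.emeasure_eq_measure)
  also have "\<dots> = (\<integral>\<^sup>+z. (\<Sum>m. indicator (A m) z) \<partial>N)"
    by (rule nn_integral_suminf[symmetric]) measurable
  also have "\<dots> \<le> (\<integral>\<^sup>+z. ennreal C5 * (\<Sum>k. indicator {k. real k < W z} k) \<partial>N)"
    by (intro nn_integral_mono count)
  also have "\<dots> = ennreal C5 * (\<integral>\<^sup>+z. (\<Sum>k. indicator {k. real k < W z} k) \<partial>N)"
    by (rule nn_integral_cmult) (simp add: indicator_def)
  also have "(\<integral>\<^sup>+z. (\<Sum>k. indicator {k. real k < W z} k) \<partial>N) = (\<Sum>k. \<integral>\<^sup>+z. indicator {k. real k < W z} k \<partial>N)"
    by (rule nn_integral_suminf) (simp add: indicator_def)
  also have "\<dots> = (\<Sum>k. ennreal (t k))"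
  proof (rule suminf_cong)
    fix k
    have "(\<integral>\<^sup>+z. indicator {k. real k < W z} k \<partial>N) = (\<integral>\<^sup>+z. indicator {z \<in> space N. real k < W z} z \<partial>N)"
      by (intro nn_integral_cong) (auto simp: indicator_def)
    also have "\<dots> = ennreal (t k)" by (subst nn_integral_indicator) (auto simp: t_def M.emeasure_eq_measure)
    finally show "(\<integral>\<^sup>+z. indicator {k. real k < W z} k \<partial>N) = ennreal (t k)" .
  qed
  also have "ennreal C5 * (\<Sum>k. ennreal (t k)) < \<top>"
    using tt by (simp add: ennreal_mult_eq_top_iff less_top[symmetric])
  finally have "(\<Sum>m. ennreal (measure N (A m))) \<noteq> \<top>" by simp
  then have "summable (\<lambda>m. measure N (A m))" by (intro summable_suminf_not_top) auto
  then show ?thesis by (simp add: A_def)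
qed

text \<open>Of the three summands \<open>real m powr \<alpha>\<close> one pays for the deviation of
  the product at a time that is not bad; the other two keep the surviving mean large enough to beat
  the variance of a family.\<close>

definition T :: "real \<Rightarrow> nat \<Rightarrow> real" where
  "T \<alpha> m = exp (lam * real m + 3 * real m powr \<alpha>)"

text \<open>Summable in \<open>m\<close>, and at least 1 at any finite number of early ages once
  \<open>c\<close> is large, so that statements valid only for late ages can be used from the
  start.\<close>

definition slack :: "real \<Rightarrow> nat \<Rightarrow> real" where
  "slack c m = c / (real m + 1)\<^sup>2"

text \<open>
  In every term \<open>r\<close> stands for the last bad time; \<open>slack\<close> allows for the chance that a family dies out
  although its ancestors were many.
\<close>

definition survival_bound :: "real \<Rightarrow> real \<Rightarrow> nat \<Rightarrow> (nat \<Rightarrow> (real ^ 'd ^ 'd) \<times> (real ^ 'd)) \<Rightarrow> ennreal" where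
  "survival_bound \<alpha> c n x = (\<Sum>r\<le>n. (if bad \<alpha> r x then 1 else 0) *
     (\<Prod>m\<in>{r<..<n}. ennreal ((if infnorm (snd (x m)) \<le> T \<alpha> m then 1 else 0) + slack c m)))"

lemma measurable_survival_bound [measurable]: "survival_bound \<alpha> c n \<in> borel_measurable S"
  unfolding survival_bound_def by measurable

lemma slack_nonneg: "0 \<le> c \<Longrightarrow> 0 \<le> slack c m"
  by (simp add: slack_def)

lemma summable_slack: "summable (slack c)"
proof (rule summable_comparison_test_bigo)
  show "summable (\<lambda>m. norm (real m powr (-2)))" by (simp add: summable_real_powr_iff)
  show "slack c \<in> O(\<lambda>m. real m powr (-2))" unfolding slack_def by real_asymp
qed

text \<open>\<open>bad \<alpha> r\<close> reads coordinates below \<open>r\<close>, and the product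
  reads coordinates above \<open>r\<close>, one per factor, so each term falls under
  \<open>nn_integral_past_future\<close>.\<close>

lemma nn_integral_survival_bound:
  assumes c: "0 \<le> c"
  shows "(\<integral>\<^sup>+x. survival_bound \<alpha> c n x \<partial>S) =
    ennreal (\<Sum>r\<le>n. P.prob {x \<in> space S. bad \<alpha> r x} * (\<Prod>m\<in>{r<..<n}. Q (T \<alpha> m) + slack c m))"
proof -
  have g: "(\<integral>\<^sup>+z. ennreal ((if infnorm (snd z) \<le> t then 1 else 0) + e) \<partial>N) = ennreal (Q t + e)"
    if "0 \<le> e" for t e
  proof -
    have "(\<integral>\<^sup>+z. ennreal ((if infnorm (snd z) \<le> t then 1 else 0) + e) \<partial>N)
        = (\<integral>\<^sup>+z. indicator {z \<in> space N. infnorm (snd z) \<le> t} z + ennreal e \<partial>N)"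
      using that by (intro nn_integral_cong) (auto simp: indicator_def)
    also have "\<dots> = (\<integral>\<^sup>+z. indicator {z \<in> space N. infnorm (snd z) \<le> t} z \<partial>N) + (\<integral>\<^sup>+z. ennreal e \<partial>N)"
      by (rule nn_integral_add) auto
    also have "\<dots> = ennreal (Q t + e)"
      using that Q_nonneg[of t] by (simp add: Q_def M.emeasure_eq_measure M.prob_space)
    finally show ?thesis .
  qed
  have b: "(\<integral>\<^sup>+x. (if bad \<alpha> r x then 1 else 0) \<partial>S) = ennreal (P.prob {x \<in> space S. bad \<alpha> r x})" for r
  proof -
    have "(\<integral>\<^sup>+x. (if bad \<alpha> r x then 1 else 0) \<partial>S) = (\<integral>\<^sup>+x. indicator {x \<in> space S. bad \<alpha> r x} x \<partial>S)"
      by (intro nn_integral_cong) (auto simp: indicator_def)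
    then show ?thesis by (simp add: P.emeasure_eq_measure)
  qed
  have q0: "0 \<le> Q (T \<alpha> m) + slack c m" for m using Q_nonneg slack_nonneg[OF c] by (simp add: add_nonneg_nonneg)
  have "(\<integral>\<^sup>+x. survival_bound \<alpha> c n x \<partial>S) = (\<Sum>r\<le>n. \<integral>\<^sup>+x. (if bad \<alpha> r x then 1 else 0) *
     (\<Prod>m\<in>{r<..<n}. ennreal ((if infnorm (snd (x m)) \<le> T \<alpha> m then 1 else 0) + slack c m)) \<partial>S)"
    unfolding survival_bound_def by (rule nn_integral_sum) measurable
  also have "\<dots> = (\<Sum>r\<le>n. (\<integral>\<^sup>+x. (if bad \<alpha> r x then 1 else 0) \<partial>S) *
     (\<Prod>m\<in>{r<..<n}. \<integral>\<^sup>+z. ennreal ((if infnorm (snd z) \<le> T \<alpha> m then 1 else 0) + slack c m) \<partial>N))"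
  proof (intro sum.cong refl nn_integral_past_future[where
          h = "\<lambda>m z. ennreal ((if infnorm (snd z) \<le> T \<alpha> m then 1 else 0) + slack c m)"])
    show "(if bad \<alpha> r x then 1 else 0 :: ennreal) = (if bad \<alpha> r x' then 1 else 0)"
      if "\<And>i. i < r \<Longrightarrow> x i = x' i" for r x x'
      using bad_past[OF that] by (rule if_cong) auto
  qed auto
  also have "\<dots> = (\<Sum>r\<le>n. ennreal (P.prob {x \<in> space S. bad \<alpha> r x} * (\<Prod>m\<in>{r<..<n}. Q (T \<alpha> m) + slack c m)))"
    unfolding b g[OF slack_nonneg[OF c]]
    using q0 by (intro sum.cong refl) (simp add: prod_ennreal ennreal_mult prod_nonneg)
  also have "\<dots> = ennreal (\<Sum>r\<le>n. P.prob {x \<in> space S. bad \<alpha> r x} * (\<Prod>m\<in>{r<..<n}. Q (T \<alpha> m) + slack c m))"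
    using q0 by (intro sum_ennreal) (auto intro!: mult_nonneg_nonneg prod_nonneg)
  finally show ?thesis .
qed

lemma survival_bound_ge:
  assumes r: "r \<le> n" "bad \<alpha> r x"
  shows "(\<Prod>m\<in>{r<..<n}. ennreal ((if infnorm (snd (x m)) \<le> T \<alpha> m then 1 else 0) + slack c m)) \<le> survival_bound \<alpha> c n x"
proof -
  let ?f = "\<lambda>r. (if bad \<alpha> r x then 1 else 0) *
     (\<Prod>m\<in>{r<..<n}. ennreal ((if infnorm (snd (x m)) \<le> T \<alpha> m then 1 else 0) + slack c m))"
  have "?f r \<le> (\<Sum>r\<le>n. ?f r)" using r by (intro member_le_sum) auto
  then show ?thesis unfolding survival_bound_def using r by simp
qed

lemma last_bad:
  obtains r where "r \<le> n" "bad \<alpha> r x" "\<And>m. m \<in> {r<..<n} \<Longrightarrow> \<not> bad \<alpha> m x"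
proof -
  have f: "finite {r. r \<le> n \<and> bad \<alpha> r x}" "{r. r \<le> n \<and> bad \<alpha> r x} \<noteq> {}"
    by (auto simp: bad_def intro!: exI[of _ 0])
  define r where "r = Max {r. r \<le> n \<and> bad \<alpha> r x}"
  have "r \<in> {r. r \<le> n \<and> bad \<alpha> r x}" unfolding r_def by (rule Max_in[OF f])
  moreover have "m \<le> r" if "m \<le> n" "bad \<alpha> m x" for m
    unfolding r_def using f that by (intro Max_ge) auto
  ultimately show ?thesis by (intro that[of r]) (auto simp: not_le[symmetric])
qed

text \<open>The thresholds in both series have logarithm asymptotic to \<open>lam * real m\<close>.
  There the tail of the norm is about \<open>\<eta> / (lam * real m)\<close> or more, with
  \<open>\<eta> / lam > 1\<close>, so the factors drop below \<open>1 - a / real m\<close> for some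
  \<open>a > 1\<close>.\<close>

lemma light_case:
  assumes \<alpha>: "1/2 < \<alpha>" "\<alpha> < 1"
    and L: "Liminf at_top (\<lambda>x::real. ereal (x * (1 - Q (exp x)))) > ereal lam" and y: "0 < y" and c: "0 \<le> c"
  shows "summable (\<lambda>n. \<Prod>m<n. Q (y * exp (real m * lam)))"
    and "summable (\<lambda>n. \<Sum>r\<le>n. P.prob {x \<in> space S. bad \<alpha> r x} * (\<Prod>m\<in>{r<..<n}. Q (T \<alpha> m) + slack c m))"
proof -
  obtain \<eta> where \<eta>: "ereal lam < ereal \<eta>" "ereal \<eta> < Liminf at_top (\<lambda>x::real. ereal (x * (1 - Q (exp x))))"
    using ereal_dense2[OF L] by blast
  \<comment> \<open>Strictly between 1 and \<open>\<eta> / lam\<close>: the room above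
    \<open>a\<close> absorbs the corrections to the thresholds and the slack.\<close>
  define a where "a = (1 + \<eta> / lam) / 2"
  have a: "1 < a" "a < \<eta> / lam" using \<eta>(1) lam by (auto simp: a_def field_simps)
  have "eventually (\<lambda>x. ereal \<eta> < ereal (x * (1 - Q (exp x)))) at_top"
    using less_LiminfD[OF \<eta>(2)] .
  then have ev: "eventually (\<lambda>x. 0 < x \<and> Q (exp x) \<le> 1 - \<eta> / x) at_top"
    using eventually_gt_at_top[of 0] by eventually_elim (auto simp: field_simps)
  have "filterlim (\<lambda>m::nat. lam * real m + 3 * real m powr \<alpha>) at_top sequentially"
    using lam \<alpha> by real_asymp
  from eventually_compose_filterlim[OF ev this]
  have e1: "eventually (\<lambda>m. Q (T \<alpha> m) \<le> 1 - \<eta> / (lam * real m + 3 * real m powr \<alpha>)) sequentially"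
    by (auto simp: T_def elim: eventually_mono)
  have "((\<lambda>m::nat. real m * (\<eta> / (lam * real m + 3 * real m powr \<alpha>) - slack c m)) \<longlongrightarrow> \<eta> * inverse lam) sequentially"
    unfolding slack_def using lam \<alpha> by real_asymp
  then have e2: "eventually (\<lambda>m::nat. a < real m * (\<eta> / (lam * real m + 3 * real m powr \<alpha>) - slack c m)) sequentially"
    by (rule order_tendstoD) (use a in \<open>simp add: divide_inverse\<close>)
  have "eventually (\<lambda>m. Q (T \<alpha> m) + slack c m \<le> 1 - a / real m) sequentially"
    using e1 e2 eventually_gt_at_top[of 0]
  proof eventually_elim
    case (elim m)
    then have "a / real m \<le> \<eta> / (lam * real m + 3 * real m powr \<alpha>) - slack c m"
      by (simp add: divide_le_eq mult.commute)
    with elim show ?case by simp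
  qed
  then obtain m1 where m1: "\<And>m. m1 \<le> m \<Longrightarrow> Q (T \<alpha> m) + slack c m \<le> 1 - a / real m"
    by (auto simp: eventually_sequentially)
  obtain cc C where C: "0 < cc" "0 < C" "\<And>l. P.prob {x \<in> space S. bad \<alpha> l x} \<le> C * ((real l + 1) * exp (- cc * real l powr (2 * \<alpha> - 1)))"
    using bad_prob[OF \<alpha>(1)] by blast
  have "summable (\<lambda>r. (real r + 1) * exp (- cc * real r powr (2 * \<alpha> - 1)) * exp (1 * (real r + 1) powr ((2 * \<alpha> - 1) / 2)))"
    using C \<alpha> by (intro stretched_exp_summable) auto
  note st = this
  \<comment> \<open>Bad times are rarer than any power of \<open>r\<close>: a stretched exponential
    of half the exponent still dominates \<open>(real r + 1) powr a\<close>.\<close>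
  have ws: "summable (\<lambda>r. P.prob {x \<in> space S. bad \<alpha> r x} * (real r + 1) powr a)"
  proof (rule summable_comparison_test_bigo)
    show "summable (\<lambda>r. norm ((real r + 1) * exp (- cc * real r powr (2 * \<alpha> - 1)) * exp (1 * (real r + 1) powr ((2 * \<alpha> - 1) / 2))))"
      using st by (simp add: abs_mult)
    have "(\<lambda>r. P.prob {x \<in> space S. bad \<alpha> r x}) \<in> O(\<lambda>r. (real r + 1) * exp (- cc * real r powr (2 * \<alpha> - 1)))"
      using C by (intro bigoI[where c = C]) auto
    moreover have "(\<lambda>r::nat. (real r + 1) powr a) \<in> O(\<lambda>r. exp (1 * (real r + 1) powr ((2 * \<alpha> - 1) / 2)))"
      using \<alpha> by real_asymp
    ultimately show "(\<lambda>r. P.prob {x \<in> space S. bad \<alpha> r x} * (real r + 1) powr a)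
      \<in> O(\<lambda>r. (real r + 1) * exp (- cc * real r powr (2 * \<alpha> - 1)) * exp (1 * (real r + 1) powr ((2 * \<alpha> - 1) / 2)))"
      by (rule landau_o.big.mult)
  qed
  show "summable (\<lambda>n. \<Sum>r\<le>n. P.prob {x \<in> space S. bad \<alpha> r x} * (\<Prod>m\<in>{r<..<n}. Q (T \<alpha> m) + slack c m))"
  proof (rule summable_last_bad_light[OF a(1) _ _ m1 _ ws])
    show "Q (T \<alpha> m) + slack c m \<le> 1 + c" for m
    proof -
      have "slack c m \<le> c" unfolding slack_def using c
        by (simp add: divide_le_eq mult_le_cancel_left1 one_le_power)
      then show ?thesis using Q_le1 by (intro add_mono) auto
    qed
  qed (use Q_nonneg slack_nonneg[OF c] in \<open>auto intro: add_nonneg_nonneg\<close>)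
  have "filterlim (\<lambda>m::nat. lam * real m + ln y) at_top sequentially"
    using lam by real_asymp
  from eventually_compose_filterlim[OF ev this]
  have e1: "eventually (\<lambda>m. Q (y * exp (real m * lam)) \<le> 1 - \<eta> / (lam * real m + ln y)) sequentially"
    using y by (auto simp: exp_add mult_ac elim: eventually_mono)
  have "((\<lambda>m::nat. real m * (\<eta> / (lam * real m + ln y))) \<longlongrightarrow> \<eta> * inverse lam) sequentially"
    using lam by real_asymp
  then have e2: "eventually (\<lambda>m::nat. a < real m * (\<eta> / (lam * real m + ln y))) sequentially"
    by (rule order_tendstoD) (use a in \<open>simp add: divide_inverse\<close>)
  have "eventually (\<lambda>m. Q (y * exp (real m * lam)) \<le> 1 - a / real m) sequentially"
    using e1 e2 eventually_gt_at_top[of 0]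
  proof eventually_elim
    case (elim m)
    then have "a / real m \<le> \<eta> / (lam * real m + ln y)"
      by (simp add: divide_le_eq mult.commute)
    with elim show ?case by simp
  qed
  then obtain m2 where m2: "\<And>m. m2 \<le> m \<Longrightarrow> Q (y * exp (real m * lam)) \<le> 1 - a / real m"
    by (auto simp: eventually_sequentially)
  \<comment> \<open>With all weight at \<open>r = 0\<close> the lemma on last bad times reduces to
    the plain series of products.\<close>
  define w where "w r = (if r = 0 then 1 else 0 :: real)" for r :: nat
  have s: "summable (\<lambda>n. \<Sum>r\<le>n. w r * (\<Prod>m\<in>{r<..<n}. Q (y * exp (real m * lam))))"
    by (rule summable_last_bad_light[OF a(1) _ _ m2, where H = 1])
      (auto simp: w_def Q_nonneg Q_le1 intro!: summable_finite[of "{0}"] split: if_splits)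
  show "summable (\<lambda>n. \<Prod>m<n. Q (y * exp (real m * lam)))"
  proof (rule summable_comparison_test'[OF s])
    fix n :: nat
    \<comment> \<open>The term \<open>r = 0\<close> starts its product at index 1; the missing
      factor is at most 1.\<close>
    have "(\<Prod>m<n. Q (y * exp (real m * lam))) \<le> (\<Prod>m\<in>{0<..<n}. Q (y * exp (real m * lam)))"
    proof (cases n)
      case (Suc k)
      then have "{..<n} = insert 0 {0<..<n}" by auto
      then have "(\<Prod>m<n. Q (y * exp (real m * lam))) = Q y * (\<Prod>m\<in>{0<..<n}. Q (y * exp (real m * lam)))"
        by simp
      also have "\<dots> \<le> 1 * (\<Prod>m\<in>{0<..<n}. Q (y * exp (real m * lam)))"
        by (intro mult_right_mono Q_le1 prod_nonneg) (auto simp: Q_nonneg)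
      finally show ?thesis by simp
    qed simp
    also have "\<dots> = (\<Sum>r\<in>{0}. w r * (\<Prod>m\<in>{r<..<n}. Q (y * exp (real m * lam))))" by (simp add: w_def)
    also have "\<dots> \<le> (\<Sum>r\<le>n. w r * (\<Prod>m\<in>{r<..<n}. Q (y * exp (real m * lam))))"
      by (intro sum_mono2) (auto simp: w_def Q_nonneg intro!: prod_nonneg)
    finally show "norm (\<Prod>m<n. Q (y * exp (real m * lam))) \<le> (\<Sum>r\<le>n. w r * (\<Prod>m\<in>{r<..<n}. Q (y * exp (real m * lam))))"
      by (simp add: Q_nonneg prod_nonneg)
  qed
qed

end

section \<open>Light logarithmic tails and the dichotomy\<close>

context iid_environment
begin

text \<open>Any thresholds growing at least exponentially inherit the polynomial decay of the
  logarithmic tail; the early ones are swallowed by the constant.\<close>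

lemma tail_powr_bound:
  assumes tail: "\<And>x. x0 \<le> x \<Longrightarrow> 1 - Q (exp x) \<le> x powr (- \<beta>)" and \<beta>: "0 < \<beta>"
    and s: "eventually (\<lambda>m. exp (lam * real m / 4) \<le> s m) sequentially"
  shows "\<exists>C. \<forall>m. 1 - Q (s m) \<le> C * (real m + 1) powr (- \<beta>)"
proof -
  have "filterlim (\<lambda>m::nat. lam * real m / 4) at_top sequentially" using lam by real_asymp
  then have "eventually (\<lambda>m::nat. x0 \<le> lam * real m / 4) sequentially"
    by (simp add: filterlim_at_top)
  with s have "eventually (\<lambda>m. x0 \<le> lam * real m / 4 \<and> exp (lam * real m / 4) \<le> s m \<and> 1 \<le> m) sequentially"
    using eventually_ge_at_top[of 1] by eventually_elim simp
  then obtain m0 where m0: "\<And>m. m0 \<le> m \<Longrightarrow> x0 \<le> lam * real m / 4 \<and> exp (lam * real m / 4) \<le> s m \<and> 1 \<le> m"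
    by (auto simp: eventually_sequentially)
  define C where "C = max ((lam / 8) powr (- \<beta>)) ((real m0 + 1) powr \<beta>)"
  have "1 - Q (s m) \<le> C * (real m + 1) powr (- \<beta>)" for m
  proof (cases "m0 \<le> m")
    case True
    have "1 - Q (s m) \<le> 1 - Q (exp (lam * real m / 4))"
      using m0[OF True] Q_mono by simp
    also have "\<dots> \<le> (lam * real m / 4) powr (- \<beta>)" using m0[OF True] by (intro tail) auto
    \<comment> \<open>Passing from \<open>real m\<close> to \<open>real m + 1\<close> costs a factor
      2 for \<open>m \<ge> 1\<close>, hence \<open>lam / 8\<close>.\<close>
    also have "\<dots> \<le> (lam / 8 * (real m + 1)) powr (- \<beta>)"
    proof (rule powr_mono2')
      have "1 \<le> real m" using m0[OF True] by simp
      then show "lam / 8 * (real m + 1) \<le> lam * real m / 4"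
        using lam mult_left_mono[of 1 "real m" lam] by (simp add: algebra_simps)
    qed (use lam \<beta> in auto)
    also have "\<dots> = (lam / 8) powr (- \<beta>) * (real m + 1) powr (- \<beta>)"
      by (rule powr_mult)
    also have "\<dots> \<le> C * (real m + 1) powr (- \<beta>)"
      by (intro mult_right_mono) (auto simp: C_def)
    finally show ?thesis .
  next
    case False
    have "1 - Q (s m) \<le> 1" using Q_nonneg[of "s m"] by simp
    also have "1 = (real m + 1) powr \<beta> * (real m + 1) powr (- \<beta>)"
      by (simp add: powr_add[symmetric])
    also have "\<dots> \<le> C * (real m + 1) powr (- \<beta>)"
      using False \<beta> by (intro mult_right_mono) (auto simp: C_def intro!: max.coboundedI2 powr_mono2)
    finally show ?thesis .
  qed
  then show ?thesis by blast
qed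

lemma AE_good_nonneg: "AE x in S. good x \<and> (\<forall>m. nonneg_vec (snd (x m)))"
proof -
  have "AE x in S. nonneg_vec (snd (x m))" for m
    by (rule AE_component) (auto intro: AE_nonneg)
  then show ?thesis using AE_admissible by (auto simp: AE_all_countable)
qed

lemma esum_lprod_eq_exp:
  assumes "good x"
  shows "esum (lprod (\<lambda>i. fst (x i)) m) = exp (Sn m x)"
  using good_esum_pos[OF assms nonneg_mat_one esum_mat1_pos, of m] by (simp add: Sn_eq)

text \<open>Require every \<open>infnorm (snd (x m))\<close> to be at most
  \<open>\<theta> m\<close>. Among such paths those with a bad time from \<open>l0\<close> on make
  up at most half of the probability, and on the others every summand has a deterministic summable
  bound, so the whole sum is below a constant not depending on \<open>n\<close>.\<close>

lemma lower_bound: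
  assumes \<alpha>: "1/2 < \<alpha>" and b: "0 < \<beta>" "\<beta> < 1" "1 - \<beta> < 2 * \<alpha> - 1"
    and \<theta>: "\<And>m. \<theta> m = b' * exp (lam * real m - 2 * real m powr \<alpha>)" "0 \<le> b'"
    and \<sigma>0: "0 < \<sigma>0" "\<And>m. \<sigma>0 \<le> Q (\<theta> m)"
    and tail: "\<And>m. 1 - Q (\<theta> m) \<le> C1 * (real m + 1) powr (- \<beta>)"
  shows "\<exists>B>0. \<forall>n. (\<Prod>m<n. Q (\<theta> m)) / 2 \<le>
    P.prob {x \<in> space S. vsum (\<Sum>m<n. lprod (\<lambda>i. fst (x i)) m *v snd (x m)) \<le> B}"
proof -
  define w where "w r = P.prob {x \<in> space S. bad \<alpha> r x}" for r
  define \<sigma> where "\<sigma> m = Q (\<theta> m)" for m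
  have pos: "0 < \<sigma> m" "\<sigma> m \<le> 1" for m
    using \<sigma>0(1) \<sigma>0(2)[of m] Q_le1 by (auto simp: \<sigma>_def)
  have pp: "0 < (\<Prod>m\<in>J. \<sigma> m)" for J using pos by (simp add: prod_pos)
  obtain cc C where C: "0 < cc" "0 < C" "\<And>l. w l \<le> C * ((real l + 1) * exp (- cc * real l powr (2 * \<alpha> - 1)))"
    using bad_prob[OF \<alpha>] unfolding w_def by blast
  have sw: "summable (\<lambda>r. w r * inverse (\<Prod>m\<le>r. \<sigma> m))"
    by (rule summable_bad_inverse_prod[OF \<sigma>0(1) _ _ b tail[folded \<sigma>_def] _ C(3) C(1) C(2)])
      (use \<sigma>0(2) Q_le1 in \<open>auto simp: \<sigma>_def w_def\<close>)
  \<comment> \<open>From \<open>l0\<close> on, the bad times cost less than half of the product in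
    total.\<close>
  obtain l0 where l0: "\<And>n. norm (\<Sum>l\<in>{l0..<n}. w l * inverse (\<Prod>m\<le>l. \<sigma> m)) < 1/2"
  proof -
    have "\<exists>N. \<forall>m\<ge>N. \<forall>n. norm (\<Sum>l\<in>{m..<n}. w l * inverse (\<Prod>m\<le>l. \<sigma> m)) < 1/2"
      using sw[unfolded summable_Cauchy, rule_format, of "1/2"] by simp
    then show ?thesis using that by blast
  qed
  define d where "d = vsum (1 :: real ^ 'd)"
  have d: "1 \<le> d" unfolding d_def by (rule vsum_one)
  \<comment> \<open>Bound for the summand of age \<open>m\<close>. Before \<open>l0\<close> the
    product is estimated crudely by \<open>Sn_bound\<close>; later, one of the two
    \<open>real m powr \<alpha>\<close> in \<open>\<theta>\<close> pays for the deviation and the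
    other remains as decay.\<close>
  define u where "u m = (if m < l0 then exp (D * (2 * real m + 1)) * (d * \<theta> m) else 0) + d * b' * exp (- (real m powr \<alpha>))" for m
  have \<theta>nn: "0 \<le> \<theta> m" for m using \<theta> by simp
  have u0: "0 \<le> u m" for m using d \<theta>nn \<theta>(2) by (simp add: u_def)
  have su: "summable u"
    unfolding u_def
  proof (intro summable_add summable_mult)
    show "summable (\<lambda>m. if m < l0 then exp (D * (2 * real m + 1)) * (d * \<theta> m) else 0)"
      by (rule summable_finite[of "{..<l0}"]) auto
    show "summable (\<lambda>m. exp (- (real m powr \<alpha>)))"
    proof (rule summable_comparison_test_bigo)
      show "summable (\<lambda>k. norm (real k powr (- 2)))" by (simp add: summable_real_powr_iff)
      show "(\<lambda>m. exp (- (real m powr \<alpha>))) \<in> O(\<lambda>k. real k powr (- 2))" using \<alpha> by real_asymp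
    qed
  qed
  define B where "B = suminf u + 1"
  have B: "0 < B" using suminf_nonneg[OF su u0] by (simp add: B_def)
  have "(\<Prod>m<n. \<sigma> m) / 2 \<le> P.prob {x \<in> space S. vsum (\<Sum>m<n. lprod (\<lambda>i. fst (x i)) m *v snd (x m)) \<le> B}" for n
  proof -
    define E where "E l = {x \<in> space S. \<forall>m\<in>{l..<n}. infnorm (snd (x m)) \<le> \<theta> m}" for l
    \<comment> \<open>The conditions on the immigrants before \<open>l\<close> are forgotten because
      they may depend on badness at \<open>l\<close>. The past then factors out, at the price of the
      inverse product controlled by \<open>sw\<close>.\<close>
    define F where "F l = {x \<in> space S. bad \<alpha> l x \<and> (\<forall>m\<in>{l..<n}. infnorm (snd (x m)) \<le> \<theta> m)}" for l
    have [measurable]: "E l \<in> sets S" "F l \<in> sets S" for l unfolding E_def F_def by measurable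
    have key: "(\<integral>\<^sup>+x. \<phi> x * (\<Prod>m\<in>{l..<n}. if infnorm (snd (x m)) \<le> \<theta> m then 1 else 0) \<partial>S)
        = (\<integral>\<^sup>+x. \<phi> x \<partial>S) * ennreal (\<Prod>m\<in>{l..<n}. \<sigma> m)"
      if [measurable]: "\<phi> \<in> borel_measurable S" and past: "\<And>x x'. (\<And>i. i < l \<Longrightarrow> x i = x' i) \<Longrightarrow> \<phi> x = \<phi> x'" for l \<phi>
    proof -
      have "(\<integral>\<^sup>+x. \<phi> x * (\<Prod>m\<in>{l..<n}. if infnorm (snd (x m)) \<le> \<theta> m then 1 else 0) \<partial>S)
        = (\<integral>\<^sup>+x. \<phi> x \<partial>S) * (\<Prod>m\<in>{l..<n}. \<integral>\<^sup>+z. (if infnorm (snd z) \<le> \<theta> m then 1 else 0) \<partial>N)"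
        by (rule nn_integral_past_future[where h = "\<lambda>m z. (if infnorm (snd z) \<le> \<theta> m then 1 else 0)", OF that(1) _ past]) auto
      also have "(\<integral>\<^sup>+z. (if infnorm (snd z) \<le> \<theta> m then 1 else 0) \<partial>N) = ennreal (\<sigma> m)" for m
      proof -
        have "(\<integral>\<^sup>+z. (if infnorm (snd z) \<le> \<theta> m then 1 else 0) \<partial>N)
          = (\<integral>\<^sup>+z. indicator {z \<in> space N. infnorm (snd z) \<le> \<theta> m} z \<partial>N)"
          by (intro nn_integral_cong) (auto simp: indicator_def)
        then show ?thesis by (simp add: \<sigma>_def Q_def M.emeasure_eq_measure)
      qed
      then have "(\<Prod>m\<in>{l..<n}. \<integral>\<^sup>+z. (if infnorm (snd z) \<le> \<theta> m then 1 else 0) \<partial>N) = ennreal (\<Prod>m\<in>{l..<n}. \<sigma> m)"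
        using pos by (simp add: prod_ennreal less_imp_le)
      finally show ?thesis .
    qed
    have pif: "(\<Prod>m\<in>{l..<n}. if infnorm (snd (x m)) \<le> \<theta> m then 1 else 0 :: ennreal)
        = (if \<forall>m\<in>{l..<n}. infnorm (snd (x m)) \<le> \<theta> m then 1 else 0)" for l and x :: "nat \<Rightarrow> (real ^ 'd ^ 'd) \<times> (real ^ 'd)"
      by (auto intro!: prod.neutral simp: prod_zero_iff)
    have PE: "P.prob (E 0) = (\<Prod>m<n. \<sigma> m)"
    proof -
      have "emeasure S (E 0) = (\<integral>\<^sup>+x. indicator (E 0) x \<partial>S)" by simp
      also have "\<dots> = (\<integral>\<^sup>+x. 1 * (\<Prod>m\<in>{0..<n}. if infnorm (snd (x m)) \<le> \<theta> m then 1 else 0) \<partial>S)"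
        unfolding pif by (intro nn_integral_cong) (auto simp: E_def indicator_def)
      also have "\<dots> = ennreal (\<Prod>m\<in>{0..<n}. \<sigma> m)"
        by (subst key) (auto simp: P.emeasure_space_1)
      finally show ?thesis using pp[of "{0..<n}"] by (simp add: P.emeasure_eq_measure atLeast0LessThan)
    qed
    have PF: "P.prob (F l) = w l * (\<Prod>m\<in>{l..<n}. \<sigma> m)" for l
    proof -
      have "emeasure S (F l) = (\<integral>\<^sup>+x. indicator (F l) x \<partial>S)" by simp
      also have "\<dots> = (\<integral>\<^sup>+x. (if bad \<alpha> l x then 1 else 0) * (\<Prod>m\<in>{l..<n}. if infnorm (snd (x m)) \<le> \<theta> m then 1 else 0) \<partial>S)"
        unfolding pif by (intro nn_integral_cong) (auto simp: F_def indicator_def)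
      also have "\<dots> = (\<integral>\<^sup>+x. (if bad \<alpha> l x then 1 else 0) \<partial>S) * ennreal (\<Prod>m\<in>{l..<n}. \<sigma> m)"
      proof (rule key)
        show "(if bad \<alpha> l x then 1 else 0 :: ennreal) = (if bad \<alpha> l x' then 1 else 0)"
          if "\<And>i. i < l \<Longrightarrow> x i = x' i" for x x'
          using bad_past[OF that] by (rule if_cong) auto
      qed measurable
      also have "(\<integral>\<^sup>+x. (if bad \<alpha> l x then 1 else 0) \<partial>S) = (\<integral>\<^sup>+x. indicator {x \<in> space S. bad \<alpha> l x} x \<partial>S)"
        by (intro nn_integral_cong) (auto simp: indicator_def)
      also have "\<dots> = ennreal (w l)" by (simp add: w_def P.emeasure_eq_measure)
      finally show ?thesis using pp[of "{l..<n}"]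
        by (simp add: P.emeasure_eq_measure w_def ennreal_mult[symmetric] less_imp_le)
    qed
    have "(\<Sum>l\<in>{l0..<n}. P.prob (F l)) \<le> (\<Sum>l\<in>{l0..<n}. (\<Prod>m<n. \<sigma> m) * (w l * inverse (\<Prod>m\<le>l. \<sigma> m)))"
    proof (rule sum_mono)
      fix l assume l: "l \<in> {l0..<n}"
      have "(\<Prod>m\<le>l. \<sigma> m) \<le> (\<Prod>m<l. \<sigma> m)"
      proof -
        have "(\<Prod>m\<le>l. \<sigma> m) = (\<Prod>m<l. \<sigma> m) * \<sigma> l" by (simp add: lessThan_Suc_atMost[symmetric])
        also have "\<dots> \<le> (\<Prod>m<l. \<sigma> m) * 1" using pos pp[of "{..<l}"] by (intro mult_left_mono) auto
        finally show ?thesis by simp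
      qed
      then have "(\<Prod>m\<in>{l..<n}. \<sigma> m) * (\<Prod>m\<le>l. \<sigma> m) \<le> (\<Prod>m\<in>{l..<n}. \<sigma> m) * (\<Prod>m<l. \<sigma> m)"
        using pp[of "{l..<n}"] by (intro mult_left_mono) auto
      also have "\<dots> = (\<Prod>m<n. \<sigma> m)"
        using l prod.atLeastLessThan_concat[of 0 l n \<sigma>] by (simp add: atLeast0LessThan mult.commute)
      finally have "(\<Prod>m\<in>{l..<n}. \<sigma> m) \<le> (\<Prod>m<n. \<sigma> m) * inverse (\<Prod>m\<le>l. \<sigma> m)"
        using pp[of "{..l}"] by (simp add: field_simps)
      then have "w l * (\<Prod>m\<in>{l..<n}. \<sigma> m) \<le> w l * ((\<Prod>m<n. \<sigma> m) * inverse (\<Prod>m\<le>l. \<sigma> m))"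
        by (intro mult_left_mono) (auto simp: w_def)
      then show "P.prob (F l) \<le> (\<Prod>m<n. \<sigma> m) * (w l * inverse (\<Prod>m\<le>l. \<sigma> m))"
        by (simp add: PF mult_ac)
    qed
    also have "\<dots> = (\<Prod>m<n. \<sigma> m) * (\<Sum>l\<in>{l0..<n}. w l * inverse (\<Prod>m\<le>l. \<sigma> m))"
      by (simp add: sum_distrib_left)
    also have "\<dots> \<le> (\<Prod>m<n. \<sigma> m) * (1/2)"
      using l0[of n] pp[of "{..<n}"] by (intro mult_left_mono) auto
    finally have sF: "(\<Sum>l\<in>{l0..<n}. P.prob (F l)) \<le> (\<Prod>m<n. \<sigma> m) / 2" by simp
    define R where "R = E 0 - (\<Union>l\<in>{l0..<n}. F l)"
    have [measurable]: "R \<in> sets S" unfolding R_def by auto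
    have "P.prob (E 0) \<le> P.prob (R \<union> (\<Union>l\<in>{l0..<n}. F l))"
      by (intro P.finite_measure_mono) (auto simp: R_def)
    also have "\<dots> \<le> P.prob R + P.prob (\<Union>l\<in>{l0..<n}. F l)"
      by (intro measure_Un_le) auto
    also have "P.prob (\<Union>l\<in>{l0..<n}. F l) \<le> (\<Sum>l\<in>{l0..<n}. P.prob (F l))"
      by (intro P.finite_measure_subadditive_finite) auto
    finally have "(\<Prod>m<n. \<sigma> m) / 2 \<le> P.prob R" using sF by (simp add: PE)
    also have "\<dots> \<le> P.prob {x \<in> space S. vsum (\<Sum>m<n. lprod (\<lambda>i. fst (x i)) m *v snd (x m)) \<le> B}"
    proof (rule P.finite_measure_mono_AE)
      show "AE x in S. x \<in> R \<longrightarrow> x \<in> {x \<in> space S. vsum (\<Sum>m<n. lprod (\<lambda>i. fst (x i)) m *v snd (x m)) \<le> B}"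
        using AE_good_nonneg
      proof (eventually_elim, intro impI)
        fix x assume x: "good x \<and> (\<forall>m. nonneg_vec (snd (x m)))" and R: "x \<in> R"
        have small: "infnorm (snd (x m)) \<le> \<theta> m" if "m < n" for m
          using R that by (auto simp: R_def E_def)
        have nb: "\<not> bad \<alpha> m x" if "l0 \<le> m" "m < n" for m
          using R that small by (auto simp: R_def F_def E_def)
        have summand: "vsum (lprod (\<lambda>i. fst (x i)) m *v snd (x m)) \<le> u m" if m: "m < n" for m
        proof -
          have "vsum (lprod (\<lambda>i. fst (x i)) m *v snd (x m)) \<le> exp (Sn m x) * vsum (snd (x m))"
            using vsum_mult_le[OF adm_nonneg0[OF G \<kappa> K]] x by (metis esum_lprod_eq_exp)
          also have "vsum (snd (x m)) \<le> d * infnorm (snd (x m))"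
            unfolding d_def using x by (intro infnorm_bounds) auto
          also have "\<dots> \<le> d * \<theta> m" using d small[OF m] by (intro mult_left_mono) auto
          finally have 1: "vsum (lprod (\<lambda>i. fst (x i)) m *v snd (x m)) \<le> exp (Sn m x) * (d * \<theta> m)" by simp
          show ?thesis
          proof (cases "m < l0")
            case True
            have "Sn m x \<le> D * (2 * real m + 1)" using Sn_bound[of x m] x by simp
            then have "exp (Sn m x) * (d * \<theta> m) \<le> exp (D * (2 * real m + 1)) * (d * \<theta> m)"
              using d \<theta>nn by (intro mult_right_mono) auto
            also have "\<dots> \<le> u m" using True d \<theta>(2) by (simp add: u_def)
            finally show ?thesis using 1 by simp
          next
            case False
            then have "\<not> bad \<alpha> m x" using nb m by simp
            then have "dev m x \<le> real m powr \<alpha>" by (auto simp: bad_def not_less)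
            then have "Sn m x \<le> - lam * real m + real m powr \<alpha>" by (simp add: dev_def abs_le_iff)
            then have "exp (Sn m x) * (d * \<theta> m) \<le> exp (- lam * real m + real m powr \<alpha>) * (d * \<theta> m)"
              using d \<theta>nn by (intro mult_right_mono) auto
            also have "\<dots> = d * b' * (exp (- lam * real m + real m powr \<alpha>) * exp (lam * real m - 2 * real m powr \<alpha>))"
              by (simp add: \<theta>(1))
            also have "\<dots> = u m" using False by (simp add: u_def exp_add[symmetric])
            finally show ?thesis using 1 by simp
          qed
        qed
        have "vsum (\<Sum>m<n. lprod (\<lambda>i. fst (x i)) m *v snd (x m)) = (\<Sum>m<n. vsum (lprod (\<lambda>i. fst (x i)) m *v snd (x m)))"
          unfolding vsum_def by (simp add: sum_component sum.swap[of _ _ "{..<n}"])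
        also have "\<dots> \<le> (\<Sum>m<n. u m)" by (intro sum_mono summand) auto
        also have "\<dots> \<le> suminf u" by (intro sum_le_suminf su) (auto simp: u0)
        finally show "x \<in> {x \<in> space S. vsum (\<Sum>m<n. lprod (\<lambda>i. fst (x i)) m *v snd (x m)) \<le> B}"
          using R by (auto simp: B_def R_def E_def)
      qed
    qed measurable
    finally show ?thesis .
  qed
  then show ?thesis using B unfolding \<sigma>_def by blast
qed

text \<open>\<open>\<alpha>\<close> is the midpoint of the admissible interval: above
  \<open>(2 - \<beta>) / 2\<close> the bad times are rare enough, below \<open>\<beta>\<close> the
  windows are summable, and the endpoints are in the right order exactly when
  \<open>\<beta> > 2/3\<close>.\<close>

lemma heavy_case:
  assumes \<beta>: "2/3 < \<beta>" "\<beta> < 1" and L: "((\<lambda>x. x powr \<beta> * (1 - Q (exp x))) \<longlongrightarrow> 0) at_top"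
    and y: "0 < y" "0 < Q y"
  defines "\<alpha> \<equiv> ((2 - \<beta>) / 2 + \<beta>) / 2"
  shows "1/2 < \<alpha>" "\<alpha> < 1"
    and "\<And>c. 0 \<le> c \<Longrightarrow> summable (\<lambda>n. \<Prod>m<n. Q (y * exp (real m * lam))) \<Longrightarrow>
      summable (\<lambda>n. \<Sum>r\<le>n. P.prob {x \<in> space S. bad \<alpha> r x} * (\<Prod>m\<in>{r<..<n}. Q (T \<alpha> m) + slack c m))"
    and "\<exists>B>0. \<exists>C>0. \<forall>n. C * (\<Prod>m<n. Q (y * exp (real m * lam))) \<le>
      P.prob {x \<in> space S. vsum (\<Sum>m<n. lprod (\<lambda>i. fst (x i)) m *v snd (x m)) \<le> B}"
proof -
  show \<alpha>: "1/2 < \<alpha>" "\<alpha> < 1" using \<beta> by (auto simp: \<alpha>_def field_simps)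
  have \<alpha>2: "1 - \<beta> < 2 * \<alpha> - 1" "\<alpha> < \<beta>" using \<beta> by (auto simp: \<alpha>_def field_simps)
  define \<rho> where "\<rho> m = Q (y * exp (real m * lam))" for m
  have \<rho>: "Q y \<le> \<rho> m" "\<rho> m \<le> 1" for m
    unfolding \<rho>_def using y lam by (auto intro!: Q_mono Q_le1 simp: mult_le_cancel_left1)
  have "eventually (\<lambda>x. x powr \<beta> * (1 - Q (exp x)) < 1) at_top"
    by (rule order_tendstoD(2)[OF L]) simp
  then have "eventually (\<lambda>x. 1 - Q (exp x) \<le> x powr (- \<beta>)) at_top"
    using eventually_gt_at_top[of 0] by eventually_elim (simp add: powr_minus field_simps)
  then obtain x0 where tail: "\<And>x. x0 \<le> x \<Longrightarrow> 1 - Q (exp x) \<le> x powr (- \<beta>)"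
    by (auto simp: eventually_at_top_linorder)
  have "eventually (\<lambda>m::nat. lam * real m / 4 \<le> real m * lam + ln y) sequentially"
    using lam by real_asymp
  then have "eventually (\<lambda>m. exp (lam * real m / 4) \<le> y * exp (real m * lam)) sequentially"
  proof eventually_elim
    case (elim m)
    then have "exp (lam * real m / 4) \<le> exp (real m * lam + ln y)" by simp
    then show ?case using y by (simp add: exp_add mult.commute)
  qed
  from tail_powr_bound[OF tail _ this] obtain C1 where C1: "\<And>m. 1 - \<rho> m \<le> C1 * (real m + 1) powr (- \<beta>)"
    using \<beta> unfolding \<rho>_def by auto
  define w where "w r = P.prob {x \<in> space S. bad \<alpha> r x}" for r
  obtain cc C where C: "0 < cc" "0 < C" "\<And>l. w l \<le> C * ((real l + 1) * exp (- cc * real l powr (2 * \<alpha> - 1)))"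
    using bad_prob[OF \<alpha>(1)] unfolding w_def by blast
  have sw: "summable (\<lambda>r. w r * inverse (\<Prod>m\<le>r. \<rho> m))"
    by (rule summable_bad_inverse_prod[OF y(2) \<rho> _ \<beta>(2) \<alpha>2(1) C1 _ C(3)]) (use \<beta> C in \<open>auto simp: w_def\<close>)
  have "eventually (\<lambda>m::nat. 0 \<le> lam * real m - 2 * real m powr \<alpha>) sequentially"
    using lam \<alpha> by real_asymp
  then obtain m0 where m0: "\<And>m. m0 \<le> m \<Longrightarrow> 0 \<le> lam * real m - 2 * real m powr \<alpha>"
    by (auto simp: eventually_sequentially)
  define C0 where "C0 = 2 * real m0 powr \<alpha>"
  have C0: "- C0 \<le> lam * real m - 2 * real m powr \<alpha>" for m
  proof (cases "m0 \<le> m")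
    case True
    then have "0 \<le> lam * real m - 2 * real m powr \<alpha>" by (rule m0)
    moreover have "0 \<le> C0" by (simp add: C0_def)
    ultimately show ?thesis by linarith
  next
    case False
    then have "real m powr \<alpha> \<le> real m0 powr \<alpha>" using \<alpha> by (intro powr_mono2) auto
    moreover have "0 \<le> lam * real m" using lam by simp
    ultimately show ?thesis unfolding C0_def by linarith
  qed
  \<comment> \<open>Scaled so that every threshold \<open>\<theta> m\<close> is at least
    \<open>y\<close>, which keeps \<open>Q (\<theta> m)\<close> above \<open>Q y\<close> uniformly
    in \<open>m\<close>.\<close>
  define b' where "b' = y * exp C0"
  have b': "0 < b'" using y by (simp add: b'_def)
  define \<theta> where "\<theta> m = b' * exp (lam * real m - 2 * real m powr \<alpha>)" for m
  have \<theta>y: "y \<le> \<theta> m" for m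
  proof -
    have "y * 1 \<le> y * exp (C0 + (lam * real m - 2 * real m powr \<alpha>))"
      using y C0[of m] by (intro mult_left_mono) auto
    then show ?thesis by (simp add: \<theta>_def b'_def exp_add mult_ac)
  qed
  \<comment> \<open>Makes the windows wide enough to contain the thresholds of all three products:
    \<open>T \<alpha> m\<close>, \<open>y * exp (real m * lam)\<close> and
    \<open>\<theta> m\<close>.\<close>
  define cb where "cb = \<bar>ln y\<bar> + \<bar>ln b'\<bar>"
  define band where "band m = measure N {z \<in> space N.
     exp (lam * real m - 3 * real m powr \<alpha> - cb) < infnorm (snd z) \<and>
     infnorm (snd z) \<le> exp (lam * real m + 3 * real m powr \<alpha> + cb)}" for m :: nat
  have sb: "summable band"
    unfolding band_def by (rule band_summable[OF tail]) (use \<alpha> \<alpha>2 in \<open>auto simp: cb_def\<close>)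
  have band_nn: "0 \<le> band m" for m unfolding band_def by simp
  have band: "Q t - Q s \<le> band m"
    if "exp (lam * real m - 3 * real m powr \<alpha> - cb) \<le> s" "t \<le> exp (lam * real m + 3 * real m powr \<alpha> + cb)" for s t m
  proof (cases "s \<le> t")
    case True
    then have "Q t - Q s = measure N {z \<in> space N. s < infnorm (snd z) \<and> infnorm (snd z) \<le> t}"
      by (rule Q_diff)
    also have "\<dots> \<le> band m" unfolding band_def using that by (intro M.finite_measure_mono) auto
    finally show ?thesis .
  next
    case False
    then have "Q t \<le> Q s" by (intro Q_mono) auto
    then show ?thesis using band_nn[of m] by simp
  qed
  have yexp: "y * exp (real m * lam) = exp (lam * real m + ln y)" for m
    using y by (simp add: exp_add mult_ac)
  have ybexp: "\<theta> m = exp (lam * real m - 2 * real m powr \<alpha> + ln b')" for m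
    using b' by (simp add: \<theta>_def exp_add mult_ac)
  have b1: "Q (T \<alpha> m) - \<rho> m \<le> band m" for m
    unfolding \<rho>_def yexp T_def
    by (rule band; unfold exp_le_cancel_iff cb_def) (use powr_ge_zero[of "real m" \<alpha>] in linarith)+
  have b2: "\<rho> m - Q (\<theta> m) \<le> band m" for m
    unfolding \<rho>_def yexp ybexp
    by (rule band; unfold exp_le_cancel_iff cb_def) (use powr_ge_zero[of "real m" \<alpha>] in linarith)+
  show "summable (\<lambda>n. \<Sum>r\<le>n. P.prob {x \<in> space S. bad \<alpha> r x} * (\<Prod>m\<in>{r<..<n}. Q (T \<alpha> m) + slack c m))"
    if c: "0 \<le> c" and R: "summable (\<lambda>n. \<Prod>m<n. Q (y * exp (real m * lam)))" for c
  proof -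
    \<comment> \<open>Raising the threshold from that of (RR) to \<open>T \<alpha> m\<close> gains
      at most the window probability, and the slack is summable by choice.\<close>
    have "summable (\<lambda>m. max 0 (Q (T \<alpha> m) + slack c m - \<rho> m))"
    proof (rule summable_comparison_test')
      show "summable (\<lambda>m. band m + slack c m)" by (intro summable_add sb summable_slack)
      show "norm (max 0 (Q (T \<alpha> m) + slack c m - \<rho> m)) \<le> band m + slack c m" for m
        using b1[of m] band_nn[of m] slack_nonneg[OF c, of m] by simp
    qed
    from summable_last_bad_heavy[OF y(2) \<rho> _ this _ sw] show ?thesis
      using R Q_nonneg slack_nonneg[OF c] by (simp add: w_def \<rho>_def add_nonneg_nonneg)
  qed
  have "eventually (\<lambda>m::nat. lam * real m / 4 \<le> lam * real m - 2 * real m powr \<alpha> + ln b') sequentially"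
    using lam \<alpha> by real_asymp
  then have "eventually (\<lambda>m. exp (lam * real m / 4) \<le> \<theta> m) sequentially"
    by (simp add: ybexp)
  from tail_powr_bound[OF tail _ this] obtain C2 where C2: "\<And>m. 1 - Q (\<theta> m) \<le> C2 * (real m + 1) powr (- \<beta>)"
    using \<beta> by auto
  obtain B where B: "0 < B" "\<And>n. (\<Prod>m<n. Q (\<theta> m)) / 2 \<le>
    P.prob {x \<in> space S. vsum (\<Sum>m<n. lprod (\<lambda>i. fst (x i)) m *v snd (x m)) \<le> B}"
    using lower_bound[OF \<alpha>(1) _ \<beta>(2) \<alpha>2(1) \<theta>_def _ y(2) _ C2] \<beta> b' \<theta>y Q_mono by (auto simp: less_imp_le)
  define e where "e = exp ((\<Sum>m. max 0 (\<rho> m - Q (\<theta> m))) / Q y)"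
  have s3: "summable (\<lambda>m. max 0 (\<rho> m - Q (\<theta> m)))"
  proof (rule summable_comparison_test'[OF sb])
    show "norm (max 0 (\<rho> m - Q (\<theta> m))) \<le> band m" for m
      using b2[of m] band_nn[of m] by simp
  qed
  have "inverse (2 * e) * (\<Prod>m<n. Q (y * exp (real m * lam))) \<le>
      P.prob {x \<in> space S. vsum (\<Sum>m<n. lprod (\<lambda>i. fst (x i)) m *v snd (x m)) \<le> B}" for n
  proof -
    have "(\<Prod>m<n. \<rho> m) \<le> e * (\<Prod>m<n. Q (\<theta> m))"
      unfolding e_def by (rule prod_ratio_le_exp[OF y(2) _ _ s3]) (auto simp: \<rho>_def Q_nonneg intro!: Q_mono \<theta>y)
    then have "inverse (2 * e) * (\<Prod>m<n. \<rho> m) \<le> (\<Prod>m<n. Q (\<theta> m)) / 2"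
      by (simp add: e_def field_simps)
    then show ?thesis using B(2)[of n] by (simp add: \<rho>_def)
  qed
  moreover have "0 < inverse (2 * e)" by (simp add: e_def)
  ultimately show "\<exists>B>0. \<exists>C>0. \<forall>n. C * (\<Prod>m<n. Q (y * exp (real m * lam))) \<le>
      P.prob {x \<in> space S. vsum (\<Sum>m<n. lprod (\<lambda>i. fst (x i)) m *v snd (x m)) \<le> B}"
    using B(1) by blast
qed

text \<open>The convergent side is claimed for every \<open>c\<close> because each bound on the norm
  needs its own slack. In the second alternative of the tail condition \<open>R\<close> is always
  finite, so the divergent side concerns the first alternative only.\<close>

theorem dichotomy:
  assumes REG: "\<exists>\<beta>::real. 2/3 < \<beta> \<and> \<beta> < 1 \<and>
      (((\<lambda>x::real. x powr \<beta> * (1 - Q (exp x))) \<longlongrightarrow> 0) at_top \<or>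
       Liminf at_top (\<lambda>x::real. ereal (x * (1 - Q (exp x)))) > ereal lam)"
    and y: "0 < y" "0 < Q y"
  defines "R \<equiv> (\<Sum>n. ennreal (\<Prod>m=0..n. Q (y * exp (real m * lam))))"
  shows "\<exists>\<alpha>. 1/2 < \<alpha> \<and> \<alpha> < 1 \<and>
    (R \<noteq> \<infinity> \<longrightarrow> (\<forall>c\<ge>0. (\<Sum>n. \<integral>\<^sup>+x. survival_bound \<alpha> c n x \<partial>S) \<noteq> \<infinity>)) \<and>
    (R = \<infinity> \<longrightarrow> (\<exists>B>0. (\<Sum>n. ennreal (P.prob {x \<in> space S.
       vsum (\<Sum>m<n. lprod (\<lambda>i. fst (x i)) m *v snd (x m)) \<le> B})) = \<infinity>))"
proof -
  define \<rho> where "\<rho> m = Q (y * exp (real m * lam))" for m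
  have \<rho>0: "0 \<le> \<rho> m" for m by (simp add: \<rho>_def Q_nonneg)
  have p0: "0 \<le> (\<Prod>m<n. \<rho> m)" for n by (simp add: prod_nonneg \<rho>0)
  have R: "R = (\<Sum>n. ennreal (\<Prod>m<Suc n. \<rho> m))"
    unfolding R_def \<rho>_def by (simp only: atLeast0AtMost lessThan_Suc_atMost)
  \<comment> \<open>The products in \<open>R\<close> include the index \<open>n\<close>; a shift of
    the summation index does not affect convergence.\<close>
  have Rs: "R \<noteq> \<infinity> \<longleftrightarrow> summable (\<lambda>n. \<Prod>m<n. \<rho> m)"
  proof
    assume "R \<noteq> \<infinity>"
    then have "summable (\<lambda>n. \<Prod>m<Suc n. \<rho> m)"
      unfolding R infinity_ennreal_def by (intro summable_suminf_not_top p0)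
    then show "summable (\<lambda>n. \<Prod>m<n. \<rho> m)" by (rule summable_Suc_iff[THEN iffD1])
  next
    assume "summable (\<lambda>n. \<Prod>m<n. \<rho> m)"
    then have "summable (\<lambda>n. \<Prod>m<Suc n. \<rho> m)" by (rule summable_Suc_iff[THEN iffD2])
    then show "R \<noteq> \<infinity>"
      unfolding R infinity_ennreal_def by (intro ennreal_suminf_neq_top p0)
  qed
  have finite: "(\<Sum>n. \<integral>\<^sup>+x. survival_bound \<alpha> c n x \<partial>S) \<noteq> \<infinity>"
    if c: "0 \<le> c" and s: "summable (\<lambda>n. \<Sum>r\<le>n. P.prob {x \<in> space S. bad \<alpha> r x} * (\<Prod>m\<in>{r<..<n}. Q (T \<alpha> m) + slack c m))" for c \<alpha>
    unfolding nn_integral_survival_bound[OF c] infinity_ennreal_def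
    by (intro ennreal_suminf_neq_top s)
      (auto intro!: sum_nonneg mult_nonneg_nonneg prod_nonneg add_nonneg_nonneg slack_nonneg c Q_nonneg)
  obtain \<beta> where \<beta>: "2/3 < \<beta>" "\<beta> < 1" "((\<lambda>x::real. x powr \<beta> * (1 - Q (exp x))) \<longlongrightarrow> 0) at_top \<or>
       Liminf at_top (\<lambda>x::real. ereal (x * (1 - Q (exp x)))) > ereal lam" using REG by blast
  from \<beta>(3) show ?thesis
  proof
    assume L: "((\<lambda>x::real. x powr \<beta> * (1 - Q (exp x))) \<longlongrightarrow> 0) at_top"
    note h = heavy_case[OF \<beta>(1,2) L y]
    define \<alpha> where "\<alpha> = ((2 - \<beta>) / 2 + \<beta>) / 2"
    have "\<exists>B>0. (\<Sum>n. ennreal (P.prob {x \<in> space S.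
       vsum (\<Sum>m<n. lprod (\<lambda>i. fst (x i)) m *v snd (x m)) \<le> B})) = \<infinity>" if Ri: "R = \<infinity>"
    proof -
      obtain B C where B: "0 < B" "0 < C" "\<And>n. C * (\<Prod>m<n. \<rho> m) \<le>
        P.prob {x \<in> space S. vsum (\<Sum>m<n. lprod (\<lambda>i. fst (x i)) m *v snd (x m)) \<le> B}"
        using h(4) unfolding \<rho>_def by blast
      have "(\<Sum>n. ennreal (P.prob {x \<in> space S.
          vsum (\<Sum>m<n. lprod (\<lambda>i. fst (x i)) m *v snd (x m)) \<le> B})) = \<infinity>"
      proof (rule ccontr)
        assume "\<not> ?thesis"
        then have "summable (\<lambda>n. P.prob {x \<in> space S.
          vsum (\<Sum>m<n. lprod (\<lambda>i. fst (x i)) m *v snd (x m)) \<le> B})"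
          by (intro summable_suminf_not_top) auto
        then have "summable (\<lambda>n. C * (\<Prod>m<n. \<rho> m))"
          by (rule summable_comparison_test'[where N = 0]) (use B p0 in \<open>auto simp: abs_of_nonneg\<close>)
        then have "summable (\<lambda>n. \<Prod>m<n. \<rho> m)" using B by simp
        then show False using Rs Ri by simp
      qed
      then show ?thesis using B by blast
    qed
    moreover have "(\<Sum>n. \<integral>\<^sup>+x. survival_bound \<alpha> c n x \<partial>S) \<noteq> \<infinity>" if "R \<noteq> \<infinity>" "0 \<le> c" for c
      using that h(3)[OF that(2)] Rs unfolding \<alpha>_def \<rho>_def by (intro finite) auto
    ultimately show ?thesis using h(1,2) by (intro exI[of _ \<alpha>]) (auto simp: \<alpha>_def)
  next
    assume L: "Liminf at_top (\<lambda>x::real. ereal (x * (1 - Q (exp x)))) > ereal lam"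
    \<comment> \<open>Every exponent strictly between 1/2 and 1 is suitable here; 3/4 is one of
      them.\<close>
    note h = light_case[of "3/4", OF _ _ L y(1)]
    have "R \<noteq> \<infinity>" unfolding Rs using h(1)[of 0] unfolding \<rho>_def by simp
    moreover have "(\<Sum>n. \<integral>\<^sup>+x. survival_bound (3/4) c n x \<partial>S) \<noteq> \<infinity>" if "0 \<le> c" for c
      using h(2)[of c] that by (intro finite) auto
    ultimately show ?thesis by (intro exI[of _ "3/4"]) auto
  qed
qed

end

section \<open>Autoregressive and max-autoregressive processes\<close>

context iid_environment
begin

text \<open>At a time that is not bad the product is at least
  \<open>exp (- lam * real m - real m powr \<alpha>)\<close>, which leaves two of the three
  exponents in \<open>T\<close>. Half a threshold is enough, since rounding immigrants down must be
  affordable.\<close>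

lemma mean_ge:
  assumes x: "good x" and m: "K \<le> m" "\<not> bad \<alpha> m x" and v: "nonneg_vec v" "T \<alpha> m / 2 \<le> vsum v"
  shows "\<kappa> / G ^ K / 2 * exp (2 * real m powr \<alpha>) \<le> vsum (lprod (\<lambda>i. fst (x i)) m *v v)"
proof -
  have "dev m x \<le> real m powr \<alpha>" using m by (auto simp: bad_def not_less)
  then have "- lam * real m - real m powr \<alpha> \<le> Sn m x" by (simp add: dev_def abs_le_iff)
  then have 1: "exp (- lam * real m - real m powr \<alpha>) \<le> esum (lprod (\<lambda>i. fst (x i)) m)"
    by (simp add: esum_lprod_eq_exp[OF x])
  have "\<kappa> / G ^ K / 2 * exp (2 * real m powr \<alpha>) = \<kappa> / G ^ K * exp (- lam * real m - real m powr \<alpha>) * (T \<alpha> m / 2)"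
    by (simp add: T_def exp_add[symmetric])
  also have "\<dots> \<le> \<kappa> / G ^ K * esum (lprod (\<lambda>i. fst (x i)) m) * vsum v"
    using v \<kappa> G 1 order_trans[OF exp_ge_zero 1] by (intro mult_mono mult_left_mono) (auto simp: T_def)
  also have "\<dots> \<le> vsum (lprod (\<lambda>i. fst (x i)) m *v v)"
    by (rule adm_family_end[OF G \<kappa> K x v(1) m(1)])
  finally show ?thesis .
qed

text \<open>\<open>q m\<close> is the conditional probability that the contribution of age
  \<open>m\<close> stays small. Factors up to the last bad time are bounded by 1; behind it, a large
  immigrant vector leaves only the slack, and below age \<open>k\<close> the slack exceeds 1 by the
  choice of \<open>c\<close>.\<close>

lemma survival_bound_prod:
  fixes q :: "nat \<Rightarrow> real"
  assumes q: "\<And>m. m < n \<Longrightarrow> 0 \<le> q m" "\<And>m. m < n \<Longrightarrow> q m \<le> 1"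
    and big: "\<And>m. m < n \<Longrightarrow> k \<le> m \<Longrightarrow> \<not> bad \<alpha> m x \<Longrightarrow> T \<alpha> m < infnorm (snd (x m)) \<Longrightarrow> q m \<le> slack c m"
    and c: "(real k + 1)\<^sup>2 \<le> c"
  shows "ennreal (\<Prod>m<n. q m) \<le> survival_bound \<alpha> c n x"
proof -
  obtain r where r: "r \<le> n" "bad \<alpha> r x" "\<And>m. m \<in> {r<..<n} \<Longrightarrow> \<not> bad \<alpha> m x"
    using last_bad[of n \<alpha> x] by blast
  have c0: "0 \<le> c" using c by (rule order_trans[rotated]) simp
  have "(\<Prod>m<n. q m) = (\<Prod>m\<in>{..<n} - {r<..<n}. q m) * (\<Prod>m\<in>{r<..<n}. q m)"
    by (rule prod.subset_diff) auto
  also have "\<dots> \<le> 1 * (\<Prod>m\<in>{r<..<n}. q m)"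
    using q by (intro mult_right_mono prod_le_1 prod_nonneg) auto
  also have "\<dots> \<le> (\<Prod>m\<in>{r<..<n}. (if infnorm (snd (x m)) \<le> T \<alpha> m then 1 else 0) + slack c m)"
    unfolding mult_1
  proof (intro prod_mono conjI)
    fix m assume m: "m \<in> {r<..<n}"
    show "0 \<le> q m" using q m by auto
    show "q m \<le> (if infnorm (snd (x m)) \<le> T \<alpha> m then 1 else 0) + slack c m"
    proof (cases "k \<le> m")
      case True
      then show ?thesis
        using big[of m] r(3)[OF m] m q(2)[of m] slack_nonneg[OF c0, of m] by (auto simp: not_le)
    next
      case False
      then have "(real m + 1)\<^sup>2 \<le> (real k + 1)\<^sup>2" by (intro power_mono) auto
      then have "(real m + 1)\<^sup>2 \<le> c" using c by (rule order_trans)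
      then have "1 \<le> slack c m" by (simp add: slack_def le_divide_eq)
      then show ?thesis using q(2)[of m] m by auto
    qed
  qed
  finally have "ennreal (\<Prod>m<n. q m) \<le> ennreal (\<Prod>m\<in>{r<..<n}. (if infnorm (snd (x m)) \<le> T \<alpha> m then 1 else 0) + slack c m)"
    by (rule ennreal_leI)
  also have "\<dots> = (\<Prod>m\<in>{r<..<n}. ennreal ((if infnorm (snd (x m)) \<le> T \<alpha> m then 1 else 0) + slack c m))"
    using slack_nonneg[OF c0] by (intro prod_ennreal[symmetric]) auto
  also have "\<dots> \<le> survival_bound \<alpha> c n x" by (rule survival_bound_ge[OF r(1,2)])
  finally show ?thesis .
qed

text \<open>The case \<open>q m = 1\<close>: without reproduction noise a large immigrant vector at
  a late age that is not bad would push the contribution above \<open>b\<close>, so it cannot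
  occur.\<close>

lemma survival_bound_max:
  assumes \<alpha>: "1/2 < \<alpha>"
  shows "\<exists>c\<ge>0. \<forall>n x. good x \<longrightarrow> (\<forall>m. nonneg_vec (snd (x m))) \<longrightarrow>
    (\<forall>m<n. vsum (lprod (\<lambda>i. fst (x i)) m *v snd (x m)) \<le> b) \<longrightarrow> 1 \<le> survival_bound \<alpha> c n x"
proof -
  have kG: "0 < \<kappa> / G ^ K / 2" using \<kappa> G by simp
  have "filterlim (\<lambda>m::nat. \<kappa> / G ^ K / 2 * exp (2 * real m powr \<alpha>)) at_top sequentially"
    using kG \<alpha> by real_asymp
  then have "eventually (\<lambda>m::nat. b < \<kappa> / G ^ K / 2 * exp (2 * real m powr \<alpha>)) sequentially"
    by (simp add: filterlim_at_top_dense)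
  then have "eventually (\<lambda>m::nat. K \<le> m \<and> b < \<kappa> / G ^ K / 2 * exp (2 * real m powr \<alpha>)) sequentially"
    using eventually_ge_at_top[of K] by eventually_elim simp
  then obtain m0 where m0: "\<And>m. m0 \<le> m \<Longrightarrow> K \<le> m \<and> b < \<kappa> / G ^ K / 2 * exp (2 * real m powr \<alpha>)"
    by (auto simp: eventually_sequentially)
  define c where "c = (real m0 + 1)\<^sup>2"
  have "1 \<le> survival_bound \<alpha> c n x"
    if x: "good x" "\<forall>m. nonneg_vec (snd (x m))" "\<forall>m<n. vsum (lprod (\<lambda>i. fst (x i)) m *v snd (x m)) \<le> b" for n x
  proof -
    have "ennreal (\<Prod>m<n. 1) \<le> survival_bound \<alpha> c n x"
    proof (rule survival_bound_prod[where k = m0])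
      fix m assume m: "m < n" "m0 \<le> m" "\<not> bad \<alpha> m x" "T \<alpha> m < infnorm (snd (x m))"
      have nn: "nonneg_vec (snd (x m))" using x by simp
      have "0 < T \<alpha> m" by (simp add: T_def)
      then have "T \<alpha> m / 2 \<le> vsum (snd (x m))" using m(4) infnorm_bounds(1)[OF nn] by simp
      \<comment> \<open>The facts contradict each other: the contribution would exceed
        \<open>b\<close>.\<close>
      from mean_ge[OF x(1) _ m(3) nn this] m0[OF m(2)] x(3) m(1)
      show "1 \<le> slack c m" by fastforce
    qed (auto simp: c_def)
    then show ?thesis by simp
  qed
  moreover have "0 \<le> c" by (simp add: c_def)
  ultimately show ?thesis by blast
qed

end

text \<open>Only countable quantifiers occur on the right, so convergence becomes a measurable
  event.\<close>

lemma LIMSEQ_iff_inverse_Suc: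
  fixes X :: "nat \<Rightarrow> real"
  shows "X \<longlonglongrightarrow> l \<longleftrightarrow> (\<forall>k. \<exists>n0. \<forall>n\<ge>n0. \<bar>X n - l\<bar> < inverse (real (Suc k)))"
proof
  assume "X \<longlonglongrightarrow> l"
  then show "\<forall>k. \<exists>n0. \<forall>n\<ge>n0. \<bar>X n - l\<bar> < inverse (real (Suc k))"
    unfolding LIMSEQ_iff real_norm_def by (simp del: of_nat_Suc)
next
  assume *: "\<forall>k. \<exists>n0. \<forall>n\<ge>n0. \<bar>X n - l\<bar> < inverse (real (Suc k))"
  show "X \<longlonglongrightarrow> l"
    unfolding LIMSEQ_iff real_norm_def
  proof (intro allI impI)
    fix e :: real assume "0 < e"
    then obtain k where "inverse (real (Suc k)) < e" using reals_Archimedean by blast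
    with * show "\<exists>no. \<forall>n\<ge>no. \<bar>X n - l\<bar> < e" by (meson less_trans)
  qed
qed

lemma pred_LIMSEQ [measurable]:
  fixes X :: "nat \<Rightarrow> 'a \<Rightarrow> real"
  assumes [measurable]: "\<And>n. X n \<in> borel_measurable M"
  shows "Measurable.pred M (\<lambda>x. (\<lambda>n. X n x) \<longlonglongrightarrow> l)"
  unfolding LIMSEQ_iff_inverse_Suc by measurable

lemma adm_esum_pos:
  fixes a :: "nat \<Rightarrow> real ^ 'd ^ 'd"
  assumes G: "1 \<le> G" and \<kappa>: "0 < \<kappa>" "\<kappa> \<le> 1" and K: "1 \<le> K" and adm: "admissible G \<kappa> K a"
  shows "0 < esum (lprod a n)"
proof (induction n)
  case 0
  then show ?case using vsum_one[where ?'d = 'd] by (simp add: esum_one)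
next
  case (Suc n)
  have "0 < \<kappa> / G ^ K * esum (lprod a n)" using Suc \<kappa> G by simp
  also have "\<dots> \<le> esum (lprod a n ** lprod (\<lambda>j. a (n + j)) 1)"
    using K by (intro adm_esum_pos_step[OF G \<kappa> K adm] adm_nonneg0[OF G \<kappa> K adm]) auto
  finally show ?case by simp
qed

section \<open>From the given sequences to the coordinate space\<close>

abbreviation pair_borel :: "((real ^ 'd ^ 'd) \<times> (real ^ 'd)) measure" where
  "pair_borel \<equiv> borel \<Otimes>\<^sub>M borel"

lemma borel_measurable_vec_nth [measurable (raw)]:
  fixes f :: "'w \<Rightarrow> 'b::real_normed_vector ^ 'd"
  assumes "f \<in> borel_measurable M"
  shows "(\<lambda>x. f x $ i) \<in> borel_measurable M"
  using assms by (rule borel_measurable_continuous_on[rotated]) (auto intro!: continuous_intros)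

text \<open>Every injective order of reading the positive times produces the same i.i.d. law.
  Reading forwards by \<open>Suc\<close> transfers the hypotheses; reading backwards from
  \<open>n\<close> transfers the conclusions.\<close>

lemma affine_setting_distr:
  fixes A :: "nat \<Rightarrow> 'w \<Rightarrow> real ^ 'd ^ 'd"
  assumes setting: "random_affine_setting M A Y" and f: "inj f" "range f \<subseteq> {1..}"
  shows "(\<lambda>\<omega> i. (A (f i) \<omega>, Y (f i) \<omega>)) \<in> M \<rightarrow>\<^sub>M (\<Pi>\<^sub>M i\<in>UNIV. pair_borel)"
    and "distr M (\<Pi>\<^sub>M i\<in>UNIV. pair_borel) (\<lambda>\<omega> i. (A (f i) \<omega>, Y (f i) \<omega>))
      = (\<Pi>\<^sub>M i\<in>UNIV. distr M pair_borel (\<lambda>\<omega>. (A 1 \<omega>, Y 1 \<omega>)))"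
proof -
  interpret prob_space M using setting by (simp add: random_affine_setting_def)
  let ?V = "\<lambda>n \<omega>. (A n \<omega>, Y n \<omega>)"
  have ind: "indep_vars (\<lambda>_. pair_borel) ?V {1..}"
    and id: "\<And>n. n \<ge> 1 \<Longrightarrow> distr M pair_borel (?V n) = distr M pair_borel (?V 1)"
    using setting unfolding random_affine_setting_def iid_indep_of_initial_def by blast+
  have rv: "?V (f i) \<in> M \<rightarrow>\<^sub>M pair_borel" for i
    using ind f by (auto simp: indep_vars_def)
  then show "(\<lambda>\<omega> i. ?V (f i) \<omega>) \<in> M \<rightarrow>\<^sub>M (\<Pi>\<^sub>M i\<in>UNIV. pair_borel)"
    by (intro measurable_PiM_single') (simp_all add: space_pair_measure)
  have "indep_vars (\<lambda>_. pair_borel) ?V (f ` UNIV)" using ind f(2) by (rule indep_vars_subset)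
  then have "indep_vars (\<lambda>_. pair_borel) (\<lambda>i. ?V (f i)) UNIV" by (rule indep_vars_reindex[OF f(1)])
  moreover have "indep_vars (\<lambda>_. pair_borel) (\<lambda>i. ?V (f i)) UNIV \<longleftrightarrow>
      distr M (\<Pi>\<^sub>M i\<in>UNIV. pair_borel) (\<lambda>\<omega>. \<lambda>i\<in>UNIV. ?V (f i) \<omega>)
      = (\<Pi>\<^sub>M i\<in>UNIV. distr M pair_borel (?V (f i)))"
    by (rule indep_vars_iff_distr_eq_PiM) (rule UNIV_not_empty, rule rv)
  ultimately have "distr M (\<Pi>\<^sub>M i\<in>UNIV. pair_borel) (\<lambda>\<omega>. \<lambda>i\<in>UNIV. ?V (f i) \<omega>)
      = (\<Pi>\<^sub>M i\<in>UNIV. distr M pair_borel (?V (f i)))" by blast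
  also have "\<dots> = (\<Pi>\<^sub>M i\<in>UNIV. distr M pair_borel (?V 1))"
    using f(2) by (intro PiM_cong id refl) auto
  finally show "distr M (\<Pi>\<^sub>M i\<in>UNIV. pair_borel) (\<lambda>\<omega> i. ?V (f i) \<omega>) = (\<Pi>\<^sub>M i\<in>UNIV. distr M pair_borel (?V 1))"
    by (simp add: restrict_UNIV)
qed

lemma affine_setting_iid_environment:
  fixes A :: "nat \<Rightarrow> 'w \<Rightarrow> real ^ 'd ^ 'd"
  assumes setting: "random_affine_setting M A Y"
    and BD1: "\<exists>\<gamma>\<^sub>1::nat. 1 \<le> \<gamma>\<^sub>1 \<and> (AE \<omega> in M. matnorm (A 1 \<omega>) \<le> real \<gamma>\<^sub>1)"
    and PR: "\<exists>\<kappa>>0. \<exists>K\<ge>1. AE \<omega> in M. \<forall>i j. \<kappa> \<le> mat_prod (\<lambda>k. A k \<omega>) K $ i $ j"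
    and lambda: "has_decay_rate M A lam" "0 < lam"
  shows "\<exists>G \<kappa> K. iid_environment (distr M pair_borel (\<lambda>\<omega>. (A 1 \<omega>, Y 1 \<omega>))) G \<kappa> lam K"
proof -
  interpret prob_space M using setting by (simp add: random_affine_setting_def)
  let ?V = "\<lambda>n \<omega>. (A n \<omega>, Y n \<omega>)"
  let ?N = "distr M pair_borel (?V 1)"
  have V1: "?V 1 \<in> M \<rightarrow>\<^sub>M pair_borel"
    using setting unfolding random_affine_setting_def iid_indep_of_initial_def indep_vars_def by blast
  have Ann: "\<And>n \<omega>. n \<ge> 1 \<Longrightarrow> \<omega> \<in> space M \<Longrightarrow> nonneg_mat (A n \<omega>)"
    and Ynn: "\<And>n \<omega>. \<omega> \<in> space M \<Longrightarrow> nonneg_vec (Y n \<omega>)"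
    using setting unfolding random_affine_setting_def nonneg_mat_def nonneg_vec_def by blast+
  obtain \<gamma> :: nat where \<gamma>: "1 \<le> \<gamma>" "AE \<omega> in M. matnorm (A 1 \<omega>) \<le> real \<gamma>" using BD1 by blast
  obtain \<kappa>0 K where K: "0 < \<kappa>0" "1 \<le> K" "AE \<omega> in M. \<forall>i j. \<kappa>0 \<le> mat_prod (\<lambda>k. A k \<omega>) K $ i $ j"
    using PR by blast
  \<comment> \<open>Capping at 1 allows powers and quotients of constants to be compared without
    case distinctions.\<close>
  define \<kappa> where "\<kappa> = min \<kappa>0 1"
  define d where "d = vsum (1 :: real ^ 'd)"
  \<comment> \<open>The bound on \<open>matnorm\<close> becomes a bound on entry sums at the price
    of the dimension.\<close>
  define G where "G = d * real \<gamma>"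
  have d: "1 \<le> d" unfolding d_def by (rule vsum_one)
  have G1: "1 \<le> G" using d \<gamma>(1) mult_mono[of 1 d 1 "real \<gamma>"] by (simp add: G_def)
  have k: "0 < \<kappa>" "\<kappa> \<le> 1" using K by (auto simp: \<kappa>_def)
  interpret N: prob_space ?N by (rule prob_space_distr[OF V1])
  interpret sequence_space ?N by unfold_locales
  have setsN: "sets ?N = sets pair_borel" by simp
  have sS: "sets S = sets (\<Pi>\<^sub>M i\<in>UNIV. pair_borel)" by (intro sets_PiM_cong) auto
  have fm [measurable]: "(\<lambda>x. fst (x i)) \<in> borel_measurable S" for i
    by (rule measurable_compose[OF measurable_component_singleton[OF UNIV_I]]) simp
  have Sucf: "inj Suc" "range Suc \<subseteq> {1..}" by auto
  note fwd = affine_setting_distr[OF setting Sucf]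
  \<comment> \<open>The forward sequence has law \<open>S\<close>, so a measurable property that
    holds almost surely for the given matrices holds almost surely for the coordinates.\<close>
  have AE_S: "AE x in S. P x" if ae: "AE \<omega> in M. P (\<lambda>i. ?V (Suc i) \<omega>)" and [measurable]: "Measurable.pred S P" for P
  proof -
    have "AE x in distr M (\<Pi>\<^sub>M i\<in>UNIV. pair_borel) (\<lambda>\<omega> i. ?V (Suc i) \<omega>). P x"
    proof (subst AE_distr_iff[OF fwd(1)])
      have "{x \<in> space S. P x} \<in> sets S" by measurable
      then show "{x \<in> space (\<Pi>\<^sub>M i\<in>UNIV. pair_borel). P x} \<in> sets (\<Pi>\<^sub>M i\<in>UNIV. pair_borel)"
        using sS sets_eq_imp_space_eq[OF sS] by simp
      show "AE \<omega> in M. P (\<lambda>i. ?V (Suc i) \<omega>)" by (rule ae)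
    qed
    then show ?thesis unfolding fwd(2) .
  qed
  have [measurable]: "fst \<in> borel_measurable pair_borel" "snd \<in> borel_measurable pair_borel"
    by (rule measurable_fst measurable_snd)+
  have AE_fst: "AE z in ?N. nonneg_mat (fst z) \<and> esum (fst z) \<le> G"
  proof (subst AE_distr_iff[OF V1])
    show "{z \<in> space pair_borel. nonneg_mat (fst z) \<and> esum (fst z) \<le> G} \<in> sets pair_borel"
      unfolding nonneg_mat_def by measurable
    show "AE \<omega> in M. nonneg_mat (fst (?V 1 \<omega>)) \<and> esum (fst (?V 1 \<omega>)) \<le> G"
      using \<gamma>(2) AE_space
    proof eventually_elim
      case (elim \<omega>)
      then have n: "nonneg_mat (A 1 \<omega>)" using Ann by simp
      have "esum (A 1 \<omega>) \<le> d * matnorm (A 1 \<omega>)" unfolding d_def by (rule matnorm_bounds[OF n])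
      also have "\<dots> \<le> G" unfolding G_def using elim d by (intro mult_left_mono) auto
      finally show ?case using n by simp
    qed
  qed
  have AE_snd: "AE z in ?N. nonneg_vec (snd z)"
  proof (subst AE_distr_iff[OF V1])
    show "{z \<in> space pair_borel. nonneg_vec (snd z)} \<in> sets pair_borel"
      unfolding nonneg_vec_def by measurable
    show "AE \<omega> in M. nonneg_vec (snd (?V 1 \<omega>))"
      by (rule AE_I2) (simp add: Ynn)
  qed
  have block: "AE x in S. \<forall>p q. \<kappa> \<le> lprod (\<lambda>j. fst (x j)) K $ p $ q"
  proof (rule AE_S)
    show "AE \<omega> in M. \<forall>p q. \<kappa> \<le> lprod (\<lambda>j. fst (?V (Suc j) \<omega>)) K $ p $ q"
      using K(3) by eventually_elim (auto simp: mat_prod_eq_lprod \<kappa>_def min.coboundedI1)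
  qed measurable
  have adm: "AE x in S. admissible G \<kappa> K (\<lambda>i. fst (x i))"
  proof -
    have "AE x in S. \<forall>i. nonneg_mat (fst (x i)) \<and> esum (fst (x i)) \<le> G"
      unfolding AE_all_countable by (intro allI AE_component UNIV_I AE_fst)
    \<comment> \<open>(PR) concerns the first block; shift invariance of \<open>S\<close> extends it
      to all blocks, of which there are countably many.\<close>
    moreover have "AE x in S. \<forall>p q. \<kappa> \<le> lprod (\<lambda>j. fst (x (i + j))) K $ p $ q" for i
      by (rule AE_shift[OF block])
    then have "AE x in S. \<forall>i p q. \<kappa> \<le> lprod (\<lambda>j. fst (x (i + j))) K $ p $ q"
      unfolding AE_all_countable by blast
    ultimately show ?thesis unfolding admissible_def by eventually_elim auto
  qed
  have lyap: "AE x in S. (\<lambda>n. ln (esum (lprod (\<lambda>i. fst (x i)) n)) / real n) \<longlonglongrightarrow> - lam"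
  proof (rule AE_S)
    \<comment> \<open>Admissibility is pulled back to the original space, where it makes all
      products nonzero and their logarithms meaningful.\<close>
    have "AE \<omega> in M. admissible G \<kappa> K (\<lambda>i. A (Suc i) \<omega>)"
    proof -
      have "AE x in distr M (\<Pi>\<^sub>M i\<in>UNIV. pair_borel) (\<lambda>\<omega> i. ?V (Suc i) \<omega>). admissible G \<kappa> K (\<lambda>i. fst (x i))"
        unfolding fwd(2) by (rule adm)
      from AE_distrD[OF fwd(1) this] show ?thesis by simp
    qed
    then show "AE \<omega> in M. (\<lambda>n. ln (esum (lprod (\<lambda>i. fst (?V (Suc i) \<omega>)) n)) / real n) \<longlonglongrightarrow> - lam"
      using lambda(1)[unfolded has_decay_rate_def]
    proof eventually_elim
      case (elim \<omega>)
      define P where "P n = lprod (\<lambda>i. A (Suc i) \<omega>) n" for n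
      have nP: "nonneg_mat (P n)" for n unfolding P_def by (rule adm_nonneg0[OF G1 k K(2) elim(1)])
      have pos: "0 < esum (P n)" for n unfolding P_def by (rule adm_esum_pos[OF G1 k K(2) elim(1)])
      have posm: "0 < matnorm (P n)" for n
        using pos[of n] matnorm_bounds(2)[OF nP[of n]] d unfolding d_def
        by (smt (verit) mult_nonneg_nonpos)
      have b: "0 \<le> ln (esum (P n)) - ln (matnorm (P n))" "ln (esum (P n)) - ln (matnorm (P n)) \<le> ln d" for n
      proof -
        show "0 \<le> ln (esum (P n)) - ln (matnorm (P n))"
          using matnorm_bounds(1)[OF nP[of n]] posm[of n] pos[of n] by simp
        have "ln (esum (P n)) \<le> ln (d * matnorm (P n))"
          using matnorm_bounds(2)[OF nP[of n]] posm[of n] pos[of n] d by (simp add: d_def)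
        then show "ln (esum (P n)) - ln (matnorm (P n)) \<le> ln d" using posm[of n] d by (simp add: ln_mult)
      qed
      have l1: "(\<lambda>n. - (- ln (matnorm (P n)) / real n)) \<longlonglongrightarrow> - lam"
        using elim(2) unfolding P_def mat_prod_eq_lprod by (rule tendsto_minus)
      \<comment> \<open>Passing from \<open>matnorm\<close> to the entry sum changes the logarithm
        by at most \<open>ln d\<close>, which vanishes after division by \<open>n\<close>.\<close>
      have l2: "(\<lambda>n. (ln (esum (P n)) - ln (matnorm (P n))) / real n) \<longlonglongrightarrow> 0"
      proof (rule tendsto_sandwich[where f = "\<lambda>n. 0" and h = "\<lambda>n. ln d / real n"])
        show "(\<lambda>n. ln d / real n) \<longlonglongrightarrow> 0" by real_asymp
        show "(\<lambda>n. 0 :: real) \<longlonglongrightarrow> 0" by simp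
      qed (use b in \<open>auto intro!: always_eventually divide_right_mono\<close>)
      have "(\<lambda>n. - (- ln (matnorm (P n)) / real n) + (ln (esum (P n)) - ln (matnorm (P n))) / real n) \<longlonglongrightarrow> - lam + 0"
        by (rule tendsto_add[OF l1 l2])
      moreover have "- (- ln (matnorm (P n)) / real n) + (ln (esum (P n)) - ln (matnorm (P n))) / real n = ln (esum (P n)) / real n" for n
        by (simp add: diff_divide_distrib)
      ultimately show ?case by (simp add: P_def)
    qed
  qed measurable
  have "iid_environment ?N G \<kappa> lam K"
    by unfold_locales (fact setsN G1 k K(2) lambda(2) adm lyap AE_snd)+
  then show ?thesis by blast
qed

text \<open>Beyond the first \<open>n\<close> coordinates time runs forwards again, merely to
  complete an infinite i.i.d. sequence.\<close>

definition reverse_index :: "nat \<Rightarrow> nat \<Rightarrow> nat" where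
  "reverse_index n i = (if i < n then n - i else Suc i)"

lemma reverse_index: "inj (reverse_index n)" "range (reverse_index n) \<subseteq> {1..}"
  by (auto simp: reverse_index_def inj_on_def split: if_splits)

lemma start_at_zero_simps [simp]: "start_at_zero Y 0 = (\<lambda>\<omega>. 0)" "start_at_zero Y (Suc n) = Y (Suc n)"
  by (simp_all add: start_at_zero_def)

text \<open>Unrolling the recursion and sorting by age \<open>m\<close>. There is no age
  \<open>n\<close> because the chain starts at 0.\<close>

lemma ar_process_eq:
  "ar_process A (start_at_zero Y) n \<omega> = (\<Sum>m<n. lprod (\<lambda>i. A (n - i) \<omega>) m *v Y (n - m) \<omega>)"
proof (induction n)
  case (Suc n)
  have "(\<Sum>m<Suc n. lprod (\<lambda>i. A (Suc n - i) \<omega>) m *v Y (Suc n - m) \<omega>)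
      = Y (Suc n) \<omega> + (\<Sum>m<n. lprod (\<lambda>i. A (Suc n - i) \<omega>) (Suc m) *v Y (n - m) \<omega>)"
    by (subst sum.lessThan_Suc_shift) simp
  also have "\<dots> = Y (Suc n) \<omega> + (\<Sum>m<n. A (Suc n) \<omega> *v (lprod (\<lambda>i. A (n - i) \<omega>) m *v Y (n - m) \<omega>))"
    by (simp only: lprod_Suc_shift matrix_vector_mul_assoc) simp
  also have "\<dots> = A (Suc n) \<omega> *v ar_process A (start_at_zero Y) n \<omega> + Y (Suc n) \<omega>"
    by (simp add: Suc linear_sum[OF matrix_vector_mul_linear])
  finally show ?case by simp
qed simp

lemma mult_vec_mono:
  assumes "nonneg_mat A" "\<And>i. u $ i \<le> v $ i"
  shows "(A *v u) $ i \<le> (A *v v) $ i"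
  unfolding matrix_vector_mult_def using assms by (auto simp: nonneg_mat_def intro!: sum_mono mult_left_mono)

lemma max_ar_process_nonneg:
  assumes "\<And>n. 1 \<le> n \<Longrightarrow> nonneg_mat (A n \<omega>)" "\<And>n. nonneg_vec (Y n \<omega>)"
  shows "nonneg_vec (max_ar_process A (start_at_zero Y) n \<omega>)"
  using assms by (cases n) (auto simp: nonneg_vec_def le_max_iff_disj)

lemma max_ar_process_le:
  assumes "\<And>n. 1 \<le> n \<Longrightarrow> nonneg_mat (A n \<omega>)" "\<And>n. nonneg_vec (Y n \<omega>)"
  shows "max_ar_process A (start_at_zero Y) n \<omega> $ i \<le> ar_process A (start_at_zero Y) n \<omega> $ i"
proof (induction n arbitrary: i)
  case (Suc n)
  have "(A (Suc n) \<omega> *v max_ar_process A (start_at_zero Y) n \<omega>) $ i \<le> (A (Suc n) \<omega> *v ar_process A (start_at_zero Y) n \<omega>) $ i"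
    using assms by (intro mult_vec_mono Suc) auto
  moreover have "0 \<le> (A (Suc n) \<omega> *v max_ar_process A (start_at_zero Y) n \<omega>) $ i"
    using nonneg_vec_mult[OF assms(1)[of "Suc n"] max_ar_process_nonneg[of A \<omega> Y n]] assms
    by (auto simp: nonneg_vec_def)
  moreover have "0 \<le> Y (Suc n) \<omega> $ i" using assms(2) by (auto simp: nonneg_vec_def)
  ultimately show ?case by simp
qed simp

text \<open>Nonnegative matrices are monotone, so the contribution of a single immigration time is
  never lost under the maximum.\<close>

lemma max_ar_process_ge:
  assumes "\<And>n. 1 \<le> n \<Longrightarrow> nonneg_mat (A n \<omega>)" "m < n"
  shows "(lprod (\<lambda>i. A (n - i) \<omega>) m *v Y (n - m) \<omega>) $ i \<le> max_ar_process A (start_at_zero Y) n \<omega> $ i"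
  using assms(2)
proof (induction n arbitrary: m i)
  case (Suc n)
  show ?case
  proof (cases m)
    case 0
    then show ?thesis by simp
  next
    case (Suc m')
    have "(lprod (\<lambda>i. A (Suc n - i) \<omega>) m *v Y (Suc n - m) \<omega>) $ i
      = (A (Suc n) \<omega> *v (lprod (\<lambda>i. A (n - i) \<omega>) m' *v Y (n - m') \<omega>)) $ i"
      unfolding Suc lprod_Suc_shift by (simp add: matrix_vector_mul_assoc)
    also have "\<dots> \<le> (A (Suc n) \<omega> *v max_ar_process A (start_at_zero Y) n \<omega>) $ i"
      using assms(1) Suc Suc.prems by (intro mult_vec_mono Suc.IH) auto
    finally show ?thesis by simp
  qed
qed simp

lemma infnorm_mono:
  fixes u v :: "real ^ 'd"
  assumes "nonneg_vec u" "\<And>i. u $ i \<le> v $ i"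
  shows "infnorm u \<le> infnorm v"
proof -
  have "\<bar>u $ i\<bar> \<le> infnorm v" for i
  proof -
    have "\<bar>u $ i\<bar> \<le> \<bar>v $ i\<bar>" using assms(1) assms(2)[of i] by (auto simp: nonneg_vec_def abs_le_iff dest: spec[of _ i])
    also have "\<dots> \<le> infnorm v" by (rule component_le_infnorm_cart)
    finally show ?thesis .
  qed
  then show ?thesis unfolding infnorm_cart[of u] by (intro cSup_least) auto
qed

lemma infinite_expected_visits_mono:
  assumes "prob_space M"
    and meas: "\<And>n b. {\<omega> \<in> space M. infnorm (V n \<omega>) \<le> b} \<in> sets M" "\<And>n b. {\<omega> \<in> space M. infnorm (W n \<omega>) \<le> b} \<in> sets M"
    and le: "\<And>n \<omega>. \<omega> \<in> space M \<Longrightarrow> infnorm (W n \<omega>) \<le> infnorm (V n \<omega>)"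
    and V: "infinite_expected_visits M V"
  shows "infinite_expected_visits M W"
proof -
  interpret prob_space M by fact
  obtain b where b: "0 < b" "(\<Sum>n. ennreal (\<P>(\<omega> in M. infnorm (V n \<omega>) \<le> b))) = \<infinity>"
    using V by (auto simp: infinite_expected_visits_def)
  have "(\<Sum>n. ennreal (\<P>(\<omega> in M. infnorm (V n \<omega>) \<le> b))) \<le> (\<Sum>n. ennreal (\<P>(\<omega> in M. infnorm (W n \<omega>) \<le> b)))"
    using le by (intro suminf_le ennreal_leI finite_measure_mono meas) (auto intro: order_trans)
  then have "(\<Sum>n. ennreal (\<P>(\<omega> in M. infnorm (W n \<omega>) \<le> b))) = \<infinity>" using b by (simp add: top_unique)
  with b show ?thesis by (auto simp: infinite_expected_visits_def)
qed

section \<open>The given processes in reversed time\<close>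

locale affine_environment =
  iid_environment "distr \<Omega> pair_borel (\<lambda>\<omega>. (A 1 \<omega>, Y 1 \<omega>))" G \<kappa> lam K
  for \<Omega> :: "'w measure" and A :: "nat \<Rightarrow> 'w \<Rightarrow> real ^ 'd ^ 'd" and Y :: "nat \<Rightarrow> 'w \<Rightarrow> real ^ 'd"
    and G \<kappa> lam K +
  assumes setting: "random_affine_setting \<Omega> A Y"
begin

sublocale Om: prob_space \<Omega>
  using setting by (simp add: random_affine_setting_def)

definition past :: "nat \<Rightarrow> 'w \<Rightarrow> nat \<Rightarrow> (real ^ 'd ^ 'd) \<times> (real ^ 'd)" where
  "past n \<omega> i = (A (reverse_index n i) \<omega>, Y (reverse_index n i) \<omega>)"

lemma sets_S: "sets S = sets (\<Pi>\<^sub>M i\<in>UNIV. pair_borel)"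
  by (intro sets_PiM_cong) auto

lemma measurable_past: "past n \<in> \<Omega> \<rightarrow>\<^sub>M S"
  using affine_setting_distr(1)[OF setting reverse_index] by (simp add: past_def[abs_def] cong: measurable_cong_sets[OF refl sets_S])

lemma distr_past: "distr \<Omega> S (past n) = S"
  using affine_setting_distr(2)[OF setting reverse_index]
  by (simp add: past_def[abs_def] cong: distr_cong[OF refl sets_S])

lemma nonneg: "1 \<le> n \<Longrightarrow> \<omega> \<in> space \<Omega> \<Longrightarrow> nonneg_mat (A n \<omega>)" "\<omega> \<in> space \<Omega> \<Longrightarrow> nonneg_vec (Y n \<omega>)"
  using setting unfolding random_affine_setting_def nonneg_mat_def nonneg_vec_def by blast+

lemma measurable_A: "1 \<le> n \<Longrightarrow> A n \<in> borel_measurable \<Omega>" and measurable_Y: "1 \<le> n \<Longrightarrow> Y n \<in> borel_measurable \<Omega>"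
proof -
  assume "1 \<le> n"
  then have "(\<lambda>\<omega>. (A n \<omega>, Y n \<omega>)) \<in> \<Omega> \<rightarrow>\<^sub>M pair_borel"
    using setting unfolding random_affine_setting_def iid_indep_of_initial_def Om.indep_vars_def by auto
  then show "A n \<in> borel_measurable \<Omega>" "Y n \<in> borel_measurable \<Omega>"
    by (auto dest: measurable_fst'' measurable_snd'')
qed

lemma lprod_past: "m \<le> n \<Longrightarrow> lprod (\<lambda>i. fst (past n \<omega> i)) m = lprod (\<lambda>i. A (n - i) \<omega>) m"
  by (intro lprod_cong) (simp add: past_def reverse_index_def)

lemma snd_past: "m < n \<Longrightarrow> snd (past n \<omega> m) = Y (n - m) \<omega>"
  by (simp add: past_def reverse_index_def)

lemma AE_past:
  assumes "AE x in S. P x" shows "AE \<omega> in \<Omega>. P (past n \<omega>)"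
proof -
  have "AE x in distr \<Omega> S (past n). P x" unfolding distr_past by (rule assms)
  then show ?thesis by (rule AE_distrD[OF measurable_past])
qed

lemma nn_integral_past:
  assumes "f \<in> borel_measurable S"
  shows "(\<integral>\<^sup>+\<omega>. f (past n \<omega>) \<partial>\<Omega>) = (\<integral>\<^sup>+x. f x \<partial>S)"
proof -
  have "(\<integral>\<^sup>+x. f x \<partial>S) = (\<integral>\<^sup>+x. f x \<partial>distr \<Omega> S (past n))" unfolding distr_past ..
  also have "\<dots> = (\<integral>\<^sup>+\<omega>. f (past n \<omega>) \<partial>\<Omega>)"
    by (subst nn_integral_distr[OF measurable_past]) (simp_all only: measurable_distr_eq1 assms)
  finally show ?thesis ..
qed

lemma measurable_ar: "ar_process A (start_at_zero Y) n \<in> borel_measurable \<Omega>"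
  using measurable_A measurable_Y by (induction n) auto

lemma measurable_max_ar: "max_ar_process A (start_at_zero Y) n \<in> borel_measurable \<Omega>"
proof (induction n)
  case (Suc n)
  have [measurable]: "A (Suc n) \<in> borel_measurable \<Omega>" "Y (Suc n) \<in> borel_measurable \<Omega>"
    by (auto intro: measurable_A measurable_Y)
  note [measurable] = Suc
  have *: "(\<lambda>\<omega>. \<chi> i. max ((A (Suc n) \<omega> *v max_ar_process A (start_at_zero Y) n \<omega>) $ i) (Y (Suc n) \<omega> $ i)) \<in> borel_measurable \<Omega>"
    by (rule borel_measurable_continuous_Pair[where H = "\<lambda>u v. \<chi> i. max (u $ i) (v $ i)"])
      (auto intro!: continuous_intros)
  then show ?case by simp
qed simp

lemma ar_event: "{\<omega> \<in> space \<Omega>. infnorm (ar_process A (start_at_zero Y) n \<omega>) \<le> b} \<in> sets \<Omega>"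
  using measurable_ar by measurable

lemma max_ar_event: "{\<omega> \<in> space \<Omega>. infnorm (max_ar_process A (start_at_zero Y) n \<omega>) \<le> b} \<in> sets \<Omega>"
  using measurable_max_ar by measurable

lemma ar_imp_max_ar: "ar_recurrent \<Omega> A Y \<Longrightarrow> max_ar_recurrent \<Omega> A Y"
  unfolding ar_recurrent_def max_ar_recurrent_def
  by (rule infinite_expected_visits_mono[OF Om.prob_space_axioms ar_event max_ar_event])
    (auto intro!: infnorm_mono max_ar_process_le max_ar_process_nonneg nonneg)

text \<open>For each fixed \<open>n\<close> the backward sum has the law of the process at time
  \<open>n\<close>, and the norm is at most the coordinate sum.\<close>

lemma ar_recurrentI:
  assumes B: "0 < B" and inf: "(\<Sum>n. ennreal (P.prob {x \<in> space S.
       vsum (\<Sum>m<n. lprod (\<lambda>i. fst (x i)) m *v snd (x m)) \<le> B})) = \<infinity>"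
  shows "ar_recurrent \<Omega> A Y"
proof -
  have "P.prob {x \<in> space S. vsum (\<Sum>m<n. lprod (\<lambda>i. fst (x i)) m *v snd (x m)) \<le> B}
      \<le> \<P>(\<omega> in \<Omega>. infnorm (ar_process A (start_at_zero Y) n \<omega>) \<le> B)" for n
  proof -
    let ?E = "{x \<in> space S. vsum (\<Sum>m<n. lprod (\<lambda>i. fst (x i)) m *v snd (x m)) \<le> B}"
    have E: "?E \<in> sets S" by measurable
    have "P.prob ?E = measure (distr \<Omega> S (past n)) ?E" unfolding distr_past ..
    also have "\<dots> = Om.prob (past n -` ?E \<inter> space \<Omega>)" by (rule measure_distr[OF measurable_past E])
    also have "\<dots> \<le> \<P>(\<omega> in \<Omega>. infnorm (ar_process A (start_at_zero Y) n \<omega>) \<le> B)"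
    proof (intro Om.finite_measure_mono subsetI ar_event)
      fix \<omega> assume "\<omega> \<in> past n -` ?E \<inter> space \<Omega>"
      then have \<omega>: "\<omega> \<in> space \<Omega>" "vsum (\<Sum>m<n. lprod (\<lambda>i. fst (past n \<omega> i)) m *v snd (past n \<omega> m)) \<le> B" by auto
      have e: "(\<Sum>m<n. lprod (\<lambda>i. fst (past n \<omega> i)) m *v snd (past n \<omega> m)) = ar_process A (start_at_zero Y) n \<omega>"
        unfolding ar_process_eq by (intro sum.cong refl) (simp add: lprod_past snd_past)
      have "nonneg_vec (ar_process A (start_at_zero Y) n \<omega>)"
        unfolding ar_process_eq nonneg_vec_def sum_component
      proof (intro allI sum_nonneg)
        fix i m assume "m \<in> {..<n}"
        then have "nonneg_vec (lprod (\<lambda>i. A (n - i) \<omega>) m *v Y (n - m) \<omega>)"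
          using \<omega>(1) by (intro nonneg_vec_mult nonneg_mat_lprod nonneg) auto
        then show "0 \<le> (lprod (\<lambda>i. A (n - i) \<omega>) m *v Y (n - m) \<omega>) $ i" by (simp add: nonneg_vec_def)
      qed
      then show "\<omega> \<in> {\<omega> \<in> space \<Omega>. infnorm (ar_process A (start_at_zero Y) n \<omega>) \<le> B}"
        using \<omega> infnorm_bounds(1) unfolding e by (auto intro: order_trans)
    qed
    finally show ?thesis .
  qed
  then have "(\<Sum>n. ennreal (P.prob {x \<in> space S. vsum (\<Sum>m<n. lprod (\<lambda>i. fst (x i)) m *v snd (x m)) \<le> B}))
     \<le> (\<Sum>n. ennreal (\<P>(\<omega> in \<Omega>. infnorm (ar_process A (start_at_zero Y) n \<omega>) \<le> B)))"
    by (intro suminf_le ennreal_leI) auto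
  then have "(\<Sum>n. ennreal (\<P>(\<omega> in \<Omega>. infnorm (ar_process A (start_at_zero Y) n \<omega>) \<le> B))) = \<infinity>"
    unfolding inf by (simp add: top_unique)
  then show ?thesis using B by (auto simp: ar_recurrent_def infinite_expected_visits_def)
qed

text \<open>Common transience criterion for the max-autoregressive and the branching process: the
  constant \<open>c\<close> may depend on \<open>b\<close> but not on \<open>n\<close>.\<close>

lemma not_recurrentI:
  assumes fin: "\<And>c. 0 \<le> c \<Longrightarrow> (\<Sum>n. \<integral>\<^sup>+x. survival_bound \<alpha> c n x \<partial>S) \<noteq> \<infinity>"
    and bound: "\<And>b. 0 < b \<Longrightarrow> \<exists>c\<ge>0. \<forall>n. ennreal (\<P>(\<omega> in \<Omega>. infnorm (V n \<omega>) \<le> b)) \<le> (\<integral>\<^sup>+\<omega>. survival_bound \<alpha> c n (past n \<omega>) \<partial>\<Omega>)"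
  shows "\<not> infinite_expected_visits \<Omega> V"
proof
  assume "infinite_expected_visits \<Omega> V"
  then obtain b where b: "0 < b" "(\<Sum>n. ennreal (\<P>(\<omega> in \<Omega>. infnorm (V n \<omega>) \<le> b))) = \<infinity>"
    by (auto simp: infinite_expected_visits_def)
  obtain c where c: "0 \<le> c" "\<And>n. ennreal (\<P>(\<omega> in \<Omega>. infnorm (V n \<omega>) \<le> b)) \<le> (\<integral>\<^sup>+\<omega>. survival_bound \<alpha> c n (past n \<omega>) \<partial>\<Omega>)"
    using bound[OF b(1)] by blast
  have "(\<Sum>n. ennreal (\<P>(\<omega> in \<Omega>. infnorm (V n \<omega>) \<le> b))) \<le> (\<Sum>n. \<integral>\<^sup>+x. survival_bound \<alpha> c n x \<partial>S)"
    using c(2) by (intro suminf_le) (auto simp: nn_integral_past)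
  with b fin[OF c(1)] show False by (simp add: top_unique)
qed

lemma not_max_ar_recurrent:
  assumes \<alpha>: "1/2 < \<alpha>" and fin: "\<And>c. 0 \<le> c \<Longrightarrow> (\<Sum>n. \<integral>\<^sup>+x. survival_bound \<alpha> c n x \<partial>S) \<noteq> \<infinity>"
  shows "\<not> max_ar_recurrent \<Omega> A Y"
  unfolding max_ar_recurrent_def
proof (rule not_recurrentI[OF fin])
  fix b :: real assume b: "0 < b"
  define d where "d = vsum (1 :: real ^ 'd)"
  have d: "1 \<le> d" unfolding d_def by (rule vsum_one)
  obtain c where c: "0 \<le> c" "\<And>n x. good x \<Longrightarrow> (\<forall>m. nonneg_vec (snd (x m))) \<Longrightarrow>
    (\<forall>m<n. vsum (lprod (\<lambda>i. fst (x i)) m *v snd (x m)) \<le> d * b) \<Longrightarrow> 1 \<le> survival_bound \<alpha> c n x"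
    using survival_bound_max[OF \<alpha>, of "d * b"] by blast
  have "ennreal (\<P>(\<omega> in \<Omega>. infnorm (max_ar_process A (start_at_zero Y) n \<omega>) \<le> b)) \<le> (\<integral>\<^sup>+\<omega>. survival_bound \<alpha> c n (past n \<omega>) \<partial>\<Omega>)" for n
  proof -
    let ?E = "{\<omega> \<in> space \<Omega>. infnorm (max_ar_process A (start_at_zero Y) n \<omega>) \<le> b}"
    have "ennreal (Om.prob ?E) = (\<integral>\<^sup>+\<omega>. indicator ?E \<omega> \<partial>\<Omega>)"
      by (simp add: Om.emeasure_eq_measure max_ar_event)
    also have "\<dots> \<le> (\<integral>\<^sup>+\<omega>. survival_bound \<alpha> c n (past n \<omega>) \<partial>\<Omega>)"
    proof (rule nn_integral_mono_AE)
      show "AE \<omega> in \<Omega>. indicator ?E \<omega> \<le> survival_bound \<alpha> c n (past n \<omega>)"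
        using AE_past[OF AE_good_nonneg, of n] AE_space
      proof eventually_elim
        case (elim \<omega>)
        show ?case
        proof (cases "\<omega> \<in> ?E")
          case True
          have "vsum (lprod (\<lambda>i. fst (past n \<omega> i)) m *v snd (past n \<omega> m)) \<le> d * b" if m: "m < n" for m
          proof -
            let ?v = "lprod (\<lambda>i. A (n - i) \<omega>) m *v Y (n - m) \<omega>"
            have e: "lprod (\<lambda>i. fst (past n \<omega> i)) m *v snd (past n \<omega> m) = ?v"
              using m by (simp add: lprod_past snd_past)
            have nn: "nonneg_vec ?v"
              using elim m by (intro nonneg_vec_mult nonneg_mat_lprod nonneg) auto
            have "vsum ?v \<le> d * infnorm ?v" unfolding d_def by (rule infnorm_bounds[OF nn])
            also have "infnorm ?v \<le> infnorm (max_ar_process A (start_at_zero Y) n \<omega>)"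
              using elim m by (intro infnorm_mono nn max_ar_process_ge nonneg) auto
            also have "\<dots> \<le> b" using True by simp
            finally show ?thesis using d by (simp add: e)
          qed
          then have "1 \<le> survival_bound \<alpha> c n (past n \<omega>)" using elim by (intro c(2)) auto
          then show ?thesis using True by simp
        qed simp
      qed
    qed
    finally show ?thesis .
  qed
  then show "\<exists>c\<ge>0. \<forall>n. ennreal (\<P>(\<omega> in \<Omega>. infnorm (max_ar_process A (start_at_zero Y) n \<omega>) \<le> b))
      \<le> (\<integral>\<^sup>+\<omega>. survival_bound \<alpha> c n (past n \<omega>) \<partial>\<Omega>)"
    using c(1) by blast
qed

end

section \<open>Branching in a frozen environment\<close>

lemma measurable_add_count_space:
  fixes f g :: "'a \<Rightarrow> 'b::{countable, plus}"
  assumes "f \<in> M \<rightarrow>\<^sub>M count_space UNIV" "g \<in> M \<rightarrow>\<^sub>M count_space UNIV"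
  shows "(\<lambda>x. f x + g x) \<in> M \<rightarrow>\<^sub>M count_space UNIV"
  by (rule measurable_compose_countable[where f = "\<lambda>i x. i + g x" and g = f])
    (auto intro: measurable_compose[OF assms(2)] assms(1))

lemma measurable_sum_count_space:
  fixes f :: "'i \<Rightarrow> 'a \<Rightarrow> 'b::{countable, comm_monoid_add}"
  assumes "\<And>i. i \<in> I \<Longrightarrow> f i \<in> M \<rightarrow>\<^sub>M count_space UNIV"
  shows "(\<lambda>x. \<Sum>i\<in>I. f i x) \<in> M \<rightarrow>\<^sub>M count_space UNIV"
  using assms by (induction I rule: infinite_finite_induct) (auto intro: measurable_add_count_space)

lemma measurable_vec_count_space:
  fixes f :: "'a \<Rightarrow> 'd::finite \<Rightarrow> 'b::countable"
  assumes "\<And>i. (\<lambda>x. f x i) \<in> M \<rightarrow>\<^sub>M count_space UNIV"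
  shows "(\<lambda>x. \<chi> i. f x i) \<in> M \<rightarrow>\<^sub>M count_space UNIV"
proof (subst measurable_count_space_eq_countable, simp, intro conjI ballI)
  fix z :: "'b ^ 'd"
  have "(\<lambda>x. \<chi> i. f x i) -` {z} \<inter> space M = {x \<in> space M. \<forall>i\<in>UNIV. f x i = z $ i}"
    by (auto simp: vec_eq_iff)
  also have "\<dots> \<in> sets M"
  proof (rule sets.sets_Collect_finite_All)
    show "{x \<in> space M. f x i = z $ i} \<in> sets M" for i
      using measurable_sets[OF assms[of i], of "{z $ i}"] by (simp add: vimage_def Int_def conj_commute)
  qed simp
  finally show "(\<lambda>x. \<chi> i. f x i) -` {z} \<inter> space M \<in> sets M" .
qed simp

text \<open>The number of summands is random; splitting according to the countably many values of
  the previous generation leaves finite sums.\<close>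

lemma measurable_family_after:
  assumes off: "\<And>n k j. m < n \<Longrightarrow> n \<le> m + l \<Longrightarrow> 1 \<le> k \<Longrightarrow> (\<lambda>\<omega>. \<Psi> n \<omega> j (U m n k j \<omega>)) \<in> R \<rightarrow>\<^sub>M count_space UNIV"
    and Y: "Y m \<in> borel_measurable R"
  shows "family_after \<Psi> U Y m l \<in> R \<rightarrow>\<^sub>M count_space UNIV"
  using off
proof (induction l)
  case 0
  have "(\<lambda>\<omega>. nat \<lfloor>Y m \<omega> $ i\<rfloor>) \<in> R \<rightarrow>\<^sub>M count_space UNIV" for i
    using Y by measurable
  then show ?case by (auto intro: measurable_vec_count_space)
next
  case (Suc l)
  have IH: "family_after \<Psi> U Y m l \<in> R \<rightarrow>\<^sub>M count_space UNIV"
    using Suc.prems by (intro Suc.IH) auto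
  have c: "(\<lambda>\<omega>. offspring \<Psi> U m (m + Suc l) k i j \<omega>) \<in> R \<rightarrow>\<^sub>M count_space UNIV" if "1 \<le> k" for k i j
    unfolding offspring_def by (rule measurable_compose[OF Suc.prems]) (use that in auto)
  have "(\<lambda>\<omega>. \<chi> i. \<Sum>j\<in>UNIV. \<Sum>k = 1..z $ j. offspring \<Psi> U m (m + Suc l) k i j \<omega>) \<in> R \<rightarrow>\<^sub>M count_space UNIV" for z :: "nat ^ 'a"
    by (intro measurable_vec_count_space measurable_sum_count_space c) auto
  then show ?case
    by (simp only: family_after.simps)
      (rule measurable_compose_countable[OF _ IH,
          where f = "\<lambda>z \<omega>. \<chi> i. \<Sum>j\<in>UNIV. \<Sum>k = 1..z $ j. offspring \<Psi> U m (m + Suc l) k i j \<omega>"])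
qed

text \<open>The two sides may live on different spaces: this identifies families on the original
  space, on the product space and in a frozen environment.\<close>

lemma family_after_cong:
  assumes "\<And>n k j. m < n \<Longrightarrow> n \<le> m + l \<Longrightarrow> 1 \<le> k \<Longrightarrow> \<Psi> n \<omega> j (U m n k j \<omega>) = \<Psi>' n \<omega>' j (U' m n k j \<omega>')"
    and "Y m \<omega> = Y' m \<omega>'"
  shows "family_after \<Psi> U Y m l \<omega> = family_after \<Psi>' U' Y' m l \<omega>'"
  using assms(1)
proof (induction l)
  case (Suc l)
  have "family_after \<Psi> U Y m l \<omega> = family_after \<Psi>' U' Y' m l \<omega>'"
    using Suc.prems by (intro Suc.IH) auto
  moreover have "offspring \<Psi> U m (m + Suc l) k i j \<omega> = offspring \<Psi>' U' m (m + Suc l) k i j \<omega>'" if "1 \<le> k" for k i j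
    using Suc.prems[of "m + Suc l" k j] that by (simp add: offspring_def)
  ultimately show ?case by simp
qed (simp add: assms(2))

lemma prob_space_unif01: "prob_space unif01"
  unfolding unif01_def by (rule prob_space_restrict_space) auto

text \<open>The joint law is a product measure, so Tonelli's theorem replaces the second variable by
  an independent copy.\<close>

lemma (in prob_space) indep_var_nn_integral:
  assumes ind: "indep_var S X T Y" and h [measurable]: "h \<in> borel_measurable (S \<Otimes>\<^sub>M T)"
  shows "(\<integral>\<^sup>+\<omega>. h (X \<omega>, Y \<omega>) \<partial>M) = (\<integral>\<^sup>+\<omega>. \<integral>\<^sup>+\<omega>'. h (X \<omega>, Y \<omega>') \<partial>M \<partial>M)"
proof -
  have [measurable]: "X \<in> M \<rightarrow>\<^sub>M S" "Y \<in> M \<rightarrow>\<^sub>M T"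
    and eq: "distr M S X \<Otimes>\<^sub>M distr M T Y = distr M (S \<Otimes>\<^sub>M T) (\<lambda>x. (X x, Y x))"
    using ind by (auto simp: indep_var_distribution_eq)
  interpret Y: prob_space "distr M T Y" by (rule prob_space_distr) measurable
  have "(\<integral>\<^sup>+\<omega>. h (X \<omega>, Y \<omega>) \<partial>M) = (\<integral>\<^sup>+p. h p \<partial>distr M (S \<Otimes>\<^sub>M T) (\<lambda>x. (X x, Y x)))"
    by (subst nn_integral_distr) auto
  also have "\<dots> = (\<integral>\<^sup>+p. h p \<partial>(distr M S X \<Otimes>\<^sub>M distr M T Y))" by (simp add: eq)
  also have "\<dots> = (\<integral>\<^sup>+x. \<integral>\<^sup>+y. h (x, y) \<partial>distr M T Y \<partial>distr M S X)"
    by (rule Y.nn_integral_fst[symmetric]) simp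
  also have "\<dots> = (\<integral>\<^sup>+\<omega>. \<integral>\<^sup>+y. h (X \<omega>, y) \<partial>distr M T Y \<partial>M)"
    by (rule nn_integral_distr) (auto intro!: Y.borel_measurable_nn_integral)
  also have "\<dots> = (\<integral>\<^sup>+\<omega>. \<integral>\<^sup>+\<omega>'. h (X \<omega>, Y \<omega>') \<partial>M \<partial>M)"
    by (intro nn_integral_cong nn_integral_distr) (auto intro: measurable_compose_Pair1 measurable_space)
  finally show ?thesis .
qed

text \<open>Variances of independent summands add up. The bound is phrased through second moments
  since only upper bounds \<open>s i\<close> for the variances are at hand.\<close>

lemma (in prob_space) indep_sum_second_moment:
  fixes X :: "'i \<Rightarrow> 'a \<Rightarrow> real"
  assumes "finite I" "indep_vars (\<lambda>_. borel) X I"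
    and "\<And>i. i \<in> I \<Longrightarrow> integrable M (X i)" "\<And>i. i \<in> I \<Longrightarrow> integrable M (\<lambda>\<omega>. (X i \<omega>)\<^sup>2)"
    and "\<And>i. i \<in> I \<Longrightarrow> expectation (X i) = \<mu> i" "\<And>i. i \<in> I \<Longrightarrow> expectation (\<lambda>\<omega>. (X i \<omega>)\<^sup>2) \<le> (\<mu> i)\<^sup>2 + s i"
  shows "integrable M (\<lambda>\<omega>. \<Sum>i\<in>I. X i \<omega>) \<and> integrable M (\<lambda>\<omega>. (\<Sum>i\<in>I. X i \<omega>)\<^sup>2) \<and>
    expectation (\<lambda>\<omega>. \<Sum>i\<in>I. X i \<omega>) = (\<Sum>i\<in>I. \<mu> i) \<and>
    expectation (\<lambda>\<omega>. (\<Sum>i\<in>I. X i \<omega>)\<^sup>2) \<le> (\<Sum>i\<in>I. \<mu> i)\<^sup>2 + (\<Sum>i\<in>I. s i)"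
  using assms
proof (induction I rule: finite_induct)
  case (insert i I)
  define S where "S \<omega> = (\<Sum>i\<in>I. X i \<omega>)" for \<omega>
  have IH: "integrable M S" "integrable M (\<lambda>\<omega>. (S \<omega>)\<^sup>2)" "expectation S = (\<Sum>i\<in>I. \<mu> i)"
    "expectation (\<lambda>\<omega>. (S \<omega>)\<^sup>2) \<le> (\<Sum>i\<in>I. \<mu> i)\<^sup>2 + (\<Sum>i\<in>I. s i)"
    using insert.IH[OF indep_vars_subset[OF insert.prems(1)]] insert.prems unfolding S_def by auto
  have iv: "indep_var borel (X i) borel S"
    unfolding S_def by (rule indep_vars_sum[OF insert.hyps insert.prems(1)])
  have Xi: "integrable M (X i)" "integrable M (\<lambda>\<omega>. (X i \<omega>)\<^sup>2)" using insert.prems by auto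
  have cross: "integrable M (\<lambda>\<omega>. X i \<omega> * S \<omega>)" "expectation (\<lambda>\<omega>. X i \<omega> * S \<omega>) = \<mu> i * (\<Sum>i\<in>I. \<mu> i)"
    using indep_var_integrable[OF iv Xi(1) IH(1)] indep_var_lebesgue_integral[OF iv Xi(1) IH(1)] IH(3) insert.prems(4)[of i]
    by auto
  have e: "(\<lambda>\<omega>. (X i \<omega> + S \<omega>)\<^sup>2) = (\<lambda>\<omega>. (X i \<omega>)\<^sup>2 + 2 * (X i \<omega> * S \<omega>) + (S \<omega>)\<^sup>2)"
    by (simp add: power2_sum algebra_simps)
  have "integrable M (\<lambda>\<omega>. (X i \<omega> + S \<omega>)\<^sup>2)"
    unfolding e using Xi IH cross by auto
  moreover have "expectation (\<lambda>\<omega>. (X i \<omega> + S \<omega>)\<^sup>2) \<le> (\<mu> i + (\<Sum>i\<in>I. \<mu> i))\<^sup>2 + (s i + (\<Sum>i\<in>I. s i))"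
    unfolding e using Xi IH cross insert.prems(5)[of i] by (simp add: power2_sum)
  moreover have "integrable M (\<lambda>\<omega>. X i \<omega> + S \<omega>)" "expectation (\<lambda>\<omega>. X i \<omega> + S \<omega>) = \<mu> i + (\<Sum>i\<in>I. \<mu> i)"
    using Xi IH insert.prems(4)[of i] by auto
  ultimately show ?case using insert.hyps by (simp add: S_def)
qed (simp add: prob_space)

text \<open>Cauchy-Schwarz after splitting \<open>w i\<close> into two square roots. A linear
  functional of an offspring vector is thereby controlled by variances of its coordinates, and mixed
  covariances do not appear.\<close>

lemma weighted_sum_square_le:
  fixes w x :: "'i \<Rightarrow> real"
  assumes "\<And>i. i \<in> I \<Longrightarrow> 0 \<le> w i"
  shows "(\<Sum>i\<in>I. w i * x i)\<^sup>2 \<le> (\<Sum>i\<in>I. w i) * (\<Sum>i\<in>I. w i * (x i)\<^sup>2)"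
proof -
  have "(\<Sum>i\<in>I. sqrt (w i) * (sqrt (w i) * x i))\<^sup>2 \<le> (\<Sum>i\<in>I. (sqrt (w i))\<^sup>2) * (\<Sum>i\<in>I. (sqrt (w i) * x i)\<^sup>2)"
    by (rule Cauchy_Schwarz_ineq_sum)
  moreover have "(\<Sum>i\<in>I. sqrt (w i) * (sqrt (w i) * x i)) = (\<Sum>i\<in>I. w i * x i)"
    "(\<Sum>i\<in>I. (sqrt (w i))\<^sup>2) = (\<Sum>i\<in>I. w i)" "(\<Sum>i\<in>I. (sqrt (w i) * x i)\<^sup>2) = (\<Sum>i\<in>I. w i * (x i)\<^sup>2)"
    using assms by (auto intro!: sum.cong simp: mult.assoc[symmetric] power_mult_distrib)
  ultimately show ?thesis by simp
qed

section \<open>Moments of families in a frozen environment\<close>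

definition real_vec :: "nat ^ 'd \<Rightarrow> real ^ 'd" where
  "real_vec z = (\<chi> i. real (z $ i))"

lemma nonneg_real_vec: "nonneg_vec (real_vec z)"
  by (simp add: nonneg_vec_def real_vec_def)

abbreviation U_space :: "(nat \<times> nat \<times> nat \<times> 'd \<Rightarrow> real) measure" where
  "U_space \<equiv> \<Pi>\<^sub>M p\<in>U_index. unif01"

abbreviation U_coord :: "nat \<Rightarrow> nat \<Rightarrow> nat \<Rightarrow> 'd \<Rightarrow> (nat \<times> nat \<times> nat \<times> 'd \<Rightarrow> real) \<Rightarrow> real" where
  "U_coord m n k j u \<equiv> u (m, n, k, j)"

text \<open>Environment and immigration are fixed here, and only the uniforms are random.
  \<open>var\<close> concerns the diagonal of the offspring covariances, which is what
  \<open>weighted_sum_square_le\<close> consumes.\<close>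

locale quenched_branching =
  fixes \<psi> :: "nat \<Rightarrow> ('d::finite) env" and a :: "nat \<Rightarrow> real ^ 'd ^ 'd" and \<gamma> :: real and v :: "nat \<Rightarrow> real ^ 'd"
  assumes meas: "\<And>n j. 1 \<le> n \<Longrightarrow> \<psi> n j \<in> unif01 \<rightarrow>\<^sub>M count_space UNIV"
    and sq_int: "\<And>n i j. 1 \<le> n \<Longrightarrow> integrable unif01 (\<lambda>t. (real (\<psi> n j t $ i))\<^sup>2)"
    and mean: "\<And>n i j. 1 \<le> n \<Longrightarrow> (\<integral>t. real (\<psi> n j t $ i) \<partial>unif01) = a n $ i $ j"
    and var: "\<And>n i j. 1 \<le> n \<Longrightarrow> (\<integral>t. (real (\<psi> n j t $ i) - a n $ i $ j)\<^sup>2 \<partial>unif01) \<le> \<gamma>"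
begin

sublocale unif: prob_space unif01 by (rule prob_space_unif01)

sublocale U: prob_space "U_space :: (nat \<times> nat \<times> nat \<times> 'd \<Rightarrow> real) measure"
  by (rule prob_space_PiM) (rule prob_space_unif01)

definition fam :: "nat \<Rightarrow> nat \<Rightarrow> (nat \<times> nat \<times> nat \<times> 'd \<Rightarrow> real) \<Rightarrow> nat ^ 'd" where
  "fam m l = family_after (\<lambda>n _. \<psi> n) U_coord (\<lambda>n _. v n) m l"

text \<open>Stated for any index set \<open>I\<close> that contains the coordinates of the family,
  so that families or generations on disjoint sets are seen to be independent.\<close>

lemma fam_measurable:
  assumes "{(m', n, k, j). m' = m \<and> m < n \<and> n \<le> m + l \<and> 1 \<le> k} \<subseteq> I"
  shows "fam m l \<in> (\<Pi>\<^sub>M p\<in>I. unif01) \<rightarrow>\<^sub>M count_space UNIV"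
  unfolding fam_def
proof (rule measurable_family_after)
  fix n k j assume nk: "m < n" "n \<le> m + l" "(1::nat) \<le> k"
  have "(\<lambda>u. u (m, n, k, j)) \<in> (\<Pi>\<^sub>M p\<in>I. unif01) \<rightarrow>\<^sub>M unif01"
    by (rule measurable_component_singleton) (use assms nk in auto)
  then show "(\<lambda>u. \<psi> n j (u (m, n, k, j))) \<in> (\<Pi>\<^sub>M p\<in>I. unif01) \<rightarrow>\<^sub>M count_space UNIV"
    by (rule measurable_compose) (use nk in \<open>auto intro: meas\<close>)
qed simp

lemma fam_measurable_U [measurable]: "fam m l \<in> U_space \<rightarrow>\<^sub>M count_space UNIV"
  by (rule fam_measurable) (auto simp: U_index_def)

lemma fam_restrict:
  assumes "{(m', n, k, j). m' = m \<and> m < n \<and> n \<le> m + l \<and> 1 \<le> k} \<subseteq> I"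
  shows "fam m l (restrict u I) = fam m l u"
  unfolding fam_def using assms by (intro family_after_cong) auto

lemma indep_coords: "U.indep_vars (\<lambda>_. unif01) (\<lambda>p u. u p) (U_index :: (nat \<times> nat \<times> nat \<times> 'd) set)"
proof (rule indep_vars_PiM_coords)
  have "(0, 1, 1, undefined) \<in> (U_index :: (nat \<times> nat \<times> nat \<times> 'd) set)" by (auto simp: U_index_def)
  then show "(U_index :: (nat \<times> nat \<times> nat \<times> 'd) set) \<noteq> {}" by blast
qed (rule prob_space_unif01)

lemma coord_distr: "p \<in> U_index \<Longrightarrow> distr U_space unif01 (\<lambda>u. u p) = unif01" for p :: "nat \<times> nat \<times> nat \<times> 'd"
  by (rule distr_PiM_component) (auto intro: prob_space_unif01)

lemma int: "1 \<le> n \<Longrightarrow> integrable unif01 (\<lambda>t. real (\<psi> n j t $ i))"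
proof -
  assume n: "1 \<le> n"
  have [measurable]: "(\<lambda>t. real (\<psi> n j t $ i)) \<in> borel_measurable unif01"
    by (rule measurable_compose[OF meas[OF n]]) simp
  show ?thesis
    by (rule unif.square_integrable_imp_integrable[OF _ sq_int[OF n]]) measurable
qed

lemma a_nonneg: "1 \<le> n \<Longrightarrow> nonneg_mat (a n)"
  unfolding nonneg_mat_def by (auto simp: mean[symmetric])

text \<open>Column sums of \<open>P\<close>: the value of one individual of type \<open>i\<close>
  under the functional \<open>vsum (P *v x)\<close>, where \<open>P\<close> will be the mean growth
  over later generations.\<close>

definition weight :: "real ^ 'd ^ 'd \<Rightarrow> 'd \<Rightarrow> real" where
  "weight P i = (\<Sum>p\<in>UNIV. P $ p $ i)"

lemma vsum_weight: "vsum (P *v x) = (\<Sum>i\<in>UNIV. weight P i * x $ i)"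
  by (simp add: vsum_mult weight_def)

lemma weight_nonneg: "nonneg_mat P \<Longrightarrow> 0 \<le> weight P i"
  by (auto simp: weight_def nonneg_mat_def intro!: sum_nonneg)

lemma sum_weight: "(\<Sum>i\<in>UNIV. weight P i) = esum P"
  unfolding weight_def esum_def by (rule sum.swap)

lemma weight_mult: "weight (P ** B) j = (\<Sum>i\<in>UNIV. weight P i * B $ i $ j)"
  unfolding weight_def matrix_matrix_mult_def
  by (simp add: sum_distrib_right) (rule sum.swap)

definition yield :: "real ^ 'd ^ 'd \<Rightarrow> nat \<Rightarrow> 'd \<Rightarrow> real \<Rightarrow> real" where
  "yield P n j t = (\<Sum>i\<in>UNIV. weight P i * real (\<psi> n j t $ i))"

text \<open>Subtract the mean and apply \<open>weighted_sum_square_le\<close> with the weights: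
  their sum is \<open>esum P\<close>, and each coordinate has variance at most
  \<open>\<gamma>\<close>, which explains the term
  \<open>\<gamma> * (esum P)\<^sup>2\<close>.\<close>

lemma yield_moments:
  assumes n: "1 \<le> n" and P: "nonneg_mat P"
  shows "yield P n j \<in> borel_measurable unif01" "integrable unif01 (yield P n j)"
    "integrable unif01 (\<lambda>t. (yield P n j t)\<^sup>2)"
    "(\<integral>t. yield P n j t \<partial>unif01) = weight (P ** a n) j"
    "(\<integral>t. (yield P n j t)\<^sup>2 \<partial>unif01) \<le> (weight (P ** a n) j)\<^sup>2 + \<gamma> * (esum P)\<^sup>2"
proof -
  have [measurable]: "(\<lambda>t. real (\<psi> n j t $ i)) \<in> borel_measurable unif01" for i
    by (rule measurable_compose[OF meas[OF n]]) simp
  show m [measurable]: "yield P n j \<in> borel_measurable unif01"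
    unfolding yield_def by measurable
  show i: "integrable unif01 (yield P n j)"
    unfolding yield_def by (intro Bochner_Integration.integrable_sum integrable_mult_right int n)
  show E: "(\<integral>t. yield P n j t \<partial>unif01) = weight (P ** a n) j"
    unfolding yield_def by (subst Bochner_Integration.integral_sum) (simp_all add: int[OF n] mean[OF n] weight_mult)
  show sq: "integrable unif01 (\<lambda>t. (yield P n j t)\<^sup>2)"
  proof (rule Bochner_Integration.integrable_bound)
    show "integrable unif01 (\<lambda>t. esum P * (\<Sum>i\<in>UNIV. weight P i * (real (\<psi> n j t $ i))\<^sup>2))"
      by (intro integrable_mult_right Bochner_Integration.integrable_sum sq_int n)
    show "AE t in unif01. norm ((yield P n j t)\<^sup>2) \<le> norm (esum P * (\<Sum>i\<in>UNIV. weight P i * (real (\<psi> n j t $ i))\<^sup>2))"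
      using weighted_sum_square_le[of UNIV "weight P"] weight_nonneg[OF P]
      by (intro AE_I2) (auto simp: yield_def sum_weight intro: order_trans[OF _ abs_ge_self])
  qed measurable
  define c where "c t = (\<Sum>i\<in>UNIV. weight P i * (real (\<psi> n j t $ i) - a n $ i $ j))" for t
  have c: "c t = yield P n j t - weight (P ** a n) j" for t
    by (simp add: c_def yield_def weight_mult right_diff_distrib sum_subtractf)
  have di: "integrable unif01 (\<lambda>t. (real (\<psi> n j t $ i) - a n $ i $ j)\<^sup>2)" for i
    using sq_int[OF n] int[OF n] by (simp add: power2_diff)
  have "(\<integral>t. (c t)\<^sup>2 \<partial>unif01) \<le> (\<integral>t. esum P * (\<Sum>i\<in>UNIV. weight P i * (real (\<psi> n j t $ i) - a n $ i $ j)\<^sup>2) \<partial>unif01)"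
  proof (rule integral_mono)
    show "integrable unif01 (\<lambda>t. (c t)\<^sup>2)" unfolding c using sq i by (simp add: power2_diff)
    show "integrable unif01 (\<lambda>t. esum P * (\<Sum>i\<in>UNIV. weight P i * (real (\<psi> n j t $ i) - a n $ i $ j)\<^sup>2))"
      by (intro integrable_mult_right Bochner_Integration.integrable_sum di)
    show "(c t)\<^sup>2 \<le> esum P * (\<Sum>i\<in>UNIV. weight P i * (real (\<psi> n j t $ i) - a n $ i $ j)\<^sup>2)" for t
      unfolding c_def sum_weight[symmetric] by (rule weighted_sum_square_le) (rule weight_nonneg[OF P])
  qed
  also have "\<dots> = esum P * (\<Sum>i\<in>UNIV. weight P i * (\<integral>t. (real (\<psi> n j t $ i) - a n $ i $ j)\<^sup>2 \<partial>unif01))"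
    by (simp add: di)
  also have "\<dots> \<le> esum P * (\<Sum>i\<in>UNIV. weight P i * \<gamma>)"
    using var[OF n] weight_nonneg[OF P] esum_nonneg[OF P] by (intro mult_left_mono sum_mono) auto
  also have "\<dots> = \<gamma> * (esum P)\<^sup>2"
    by (simp add: sum_distrib_right[symmetric] sum_weight power2_eq_square)
  finally have "(\<integral>t. (c t)\<^sup>2 \<partial>unif01) \<le> \<gamma> * (esum P)\<^sup>2" .
  moreover have "(\<integral>t. (c t)\<^sup>2 \<partial>unif01) = (\<integral>t. (yield P n j t)\<^sup>2 \<partial>unif01) - (weight (P ** a n) j)\<^sup>2"
    unfolding c using unif.variance_eq[OF i sq] E by simp
  ultimately show "(\<integral>t. (yield P n j t)\<^sup>2 \<partial>unif01) \<le> (weight (P ** a n) j)\<^sup>2 + \<gamma> * (esum P)\<^sup>2" by simp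
qed

text \<open>The parents \<open>z\<close> are held fixed, so this is a sum of independent yields;
  \<open>fam_Suc\<close> recovers the process by inserting the random generation for
  \<open>z\<close>.\<close>

definition brood :: "real ^ 'd ^ 'd \<Rightarrow> nat \<Rightarrow> nat \<Rightarrow> nat ^ 'd \<Rightarrow> (nat \<times> nat \<times> nat \<times> 'd \<Rightarrow> real) \<Rightarrow> real" where
  "brood P m n z u = (\<Sum>(j, k)\<in>(SIGMA j:UNIV. {1..z $ j}). yield P n j (u (m, n, k, j)))"

lemma fam_Suc: "vsum (P *v real_vec (fam m (Suc l) u)) = brood P m (m + Suc l) (fam m l u) u"
proof -
  let ?z = "fam m l u"
  have "vsum (P *v real_vec (fam m (Suc l) u))
     = (\<Sum>i\<in>UNIV. weight P i * (\<Sum>j\<in>UNIV. \<Sum>k = 1..?z $ j. real (\<psi> (m + Suc l) j (u (m, m + Suc l, k, j)) $ i)))"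
    by (simp add: vsum_weight real_vec_def fam_def offspring_def)
  also have "\<dots> = (\<Sum>j\<in>UNIV. \<Sum>k = 1..?z $ j. yield P (m + Suc l) j (u (m, m + Suc l, k, j)))"
    unfolding yield_def sum_distrib_left
    by (subst sum.swap, rule sum.cong[OF refl], rule sum.swap)
  also have "\<dots> = brood P m (m + Suc l) ?z u"
    unfolding brood_def by (rule sum.Sigma) auto
  finally show ?thesis .
qed

lemma brood_moments:
  assumes P: "nonneg_mat P" and n: "m < n"
  shows "integrable U_space (brood P m n z)" "integrable U_space (\<lambda>u. (brood P m n z u)\<^sup>2)"
    "U.expectation (brood P m n z) = vsum ((P ** a n) *v real_vec z)"
    "U.expectation (\<lambda>u. (brood P m n z u)\<^sup>2) \<le> (vsum ((P ** a n) *v real_vec z))\<^sup>2 + \<gamma> * (esum P)\<^sup>2 * vsum (real_vec z)"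
proof -
  have n1: "1 \<le> n" using n by simp
  define I where "I = (SIGMA j:(UNIV::'d set). {1..z $ j})"
  define X where "X p u = yield P n (fst p) (u (m, n, snd p, fst p))" for p :: "'d \<times> nat" and u :: "nat \<times> nat \<times> nat \<times> 'd \<Rightarrow> real"
  have fI: "finite I" by (simp add: I_def)
  have idx: "(m, n, snd p, fst p) \<in> U_index" if "p \<in> I" for p
    using that n by (auto simp: I_def U_index_def)
  have ind: "U.indep_vars (\<lambda>_. borel) X I"
  proof -
    have "inj_on (\<lambda>p. (m, n, snd p, fst p)) I" by (auto simp: inj_on_def)
    moreover have "U.indep_vars (\<lambda>_. unif01) (\<lambda>p u. u p) ((\<lambda>p. (m, n, snd p, fst p)) ` I)"
      using idx by (intro U.indep_vars_subset[OF indep_coords]) auto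
    ultimately have "U.indep_vars (\<lambda>_. unif01) (\<lambda>p u. u (m, n, snd p, fst p)) I"
      by (rule U.indep_vars_reindex)
    then show ?thesis unfolding X_def
      by (rule U.indep_vars_compose2) (rule yield_moments[OF n1 P])
  qed
  have distr: "integrable U_space (\<lambda>u. f (u (m, n, snd p, fst p))) \<longleftrightarrow> integrable unif01 f"
    "U.expectation (\<lambda>u. f (u (m, n, snd p, fst p))) = (\<integral>t. f t \<partial>unif01)"
    if p: "p \<in> I" and [measurable]: "f \<in> borel_measurable unif01" for p and f :: "real \<Rightarrow> real"
  proof -
    have c: "(\<lambda>u. u (m, n, snd p, fst p)) \<in> U_space \<rightarrow>\<^sub>M unif01"
      by (rule measurable_component_singleton[OF idx[OF p]])
    show "integrable U_space (\<lambda>u. f (u (m, n, snd p, fst p))) \<longleftrightarrow> integrable unif01 f"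
      using integrable_distr_eq[OF c that(2)] by (simp add: coord_distr[OF idx[OF p]])
    show "U.expectation (\<lambda>u. f (u (m, n, snd p, fst p))) = (\<integral>t. f t \<partial>unif01)"
      using integral_distr[OF c that(2)] by (simp add: coord_distr[OF idx[OF p]])
  qed
  note ym = yield_moments[OF n1 P]
  have eq: "brood P m n z = (\<lambda>u. \<Sum>p\<in>I. X p u)"
    by (auto simp: brood_def I_def X_def case_prod_unfold)
  have res: "integrable U_space (\<lambda>\<omega>. \<Sum>i\<in>I. X i \<omega>) \<and> integrable U_space (\<lambda>\<omega>. (\<Sum>i\<in>I. X i \<omega>)\<^sup>2) \<and>
    U.expectation (\<lambda>\<omega>. \<Sum>i\<in>I. X i \<omega>) = (\<Sum>p\<in>I. weight (P ** a n) (fst p)) \<and>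
    U.expectation (\<lambda>\<omega>. (\<Sum>i\<in>I. X i \<omega>)\<^sup>2) \<le> (\<Sum>p\<in>I. weight (P ** a n) (fst p))\<^sup>2 + (\<Sum>p\<in>I. \<gamma> * (esum P)\<^sup>2)"
  proof (rule U.indep_sum_second_moment[OF fI ind])
    fix p assume p: "p \<in> I"
    show "integrable U_space (X p)"
      unfolding X_def using distr(1)[OF p ym(1)] ym(2) by simp
    show "integrable U_space (\<lambda>\<omega>. (X p \<omega>)\<^sup>2)"
      unfolding X_def using distr(1)[OF p, of "\<lambda>t. (yield P n (fst p) t)\<^sup>2"] ym(1,3) by simp
    show "U.expectation (X p) = weight (P ** a n) (fst p)"
      unfolding X_def using distr(2)[OF p ym(1)] ym(4) by simp
    show "U.expectation (\<lambda>\<omega>. (X p \<omega>)\<^sup>2) \<le> (weight (P ** a n) (fst p))\<^sup>2 + \<gamma> * (esum P)\<^sup>2"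
      unfolding X_def using distr(2)[OF p, of "\<lambda>t. (yield P n (fst p) t)\<^sup>2"] ym(1,5) by simp
  qed
  have s1: "(\<Sum>p\<in>I. weight (P ** a n) (fst p)) = vsum ((P ** a n) *v real_vec z)"
    unfolding I_def vsum_weight
    by (subst sum.Sigma[symmetric, where B = "\<lambda>j. {1..z $ j}" and g = "\<lambda>j k. weight (P ** a n) j", simplified case_prod_unfold])
      (auto simp: real_vec_def mult.commute)
  have "card I = (\<Sum>j\<in>UNIV. z $ j)" unfolding I_def by (subst card_SigmaI) auto
  then have s2: "(\<Sum>p\<in>I. \<gamma> * (esum P)\<^sup>2) = \<gamma> * (esum P)\<^sup>2 * vsum (real_vec z)"
    by (simp add: vsum_def real_vec_def)
  show "integrable U_space (brood P m n z)" "integrable U_space (\<lambda>u. (brood P m n z u)\<^sup>2)"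
    "U.expectation (brood P m n z) = vsum ((P ** a n) *v real_vec z)"
    "U.expectation (\<lambda>u. (brood P m n z u)\<^sup>2) \<le> (vsum ((P ** a n) *v real_vec z))\<^sup>2 + \<gamma> * (esum P)\<^sup>2 * vsum (real_vec z)"
    using res unfolding eq s1 s2 by auto
qed

lemma brood_nonneg: "nonneg_mat P \<Longrightarrow> 0 \<le> brood P m n z u"
  unfolding brood_def yield_def by (auto intro!: sum_nonneg mult_nonneg_nonneg weight_nonneg)

text \<open>The generation at time \<open>m + l\<close> is independent of the offspring numbers of the next one.\<close>

lemma fresh_generation:
  assumes P: "nonneg_mat P" and \<phi> [measurable]: "\<phi> \<in> borel_measurable borel"
  shows "(\<integral>\<^sup>+u. \<phi> (brood P m (m + Suc l) (fam m l u) u) \<partial>U_space)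
    = (\<integral>\<^sup>+u. \<integral>\<^sup>+u'. (\<phi> (brood P m (m + Suc l) (fam m l u) u') :: ennreal) \<partial>U_space \<partial>U_space)"
proof -
  define n where "n = m + Suc l"
  \<comment> \<open>Coordinates of the generations up to \<open>m + l\<close> on one side, of the
    next reproduction on the other.\<close>
  define I1 :: "(nat \<times> nat \<times> nat \<times> 'd) set" where "I1 = {(m', n', k, j). m' = m \<and> m < n' \<and> n' \<le> m + l \<and> 1 \<le> k}"
  define I2 :: "(nat \<times> nat \<times> nat \<times> 'd) set" where "I2 = {(m', n', k, j). m' = m \<and> n' = n \<and> 1 \<le> k}"
  have I: "I1 \<inter> I2 = {}" "I1 \<subseteq> U_index" "I2 \<subseteq> U_index"
    by (auto simp: I1_def I2_def U_index_def n_def)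
  have ind: "U.indep_var (PiM I1 (\<lambda>_. unif01)) (\<lambda>u. restrict u I1) (PiM I2 (\<lambda>_. unif01)) (\<lambda>u. restrict u I2)"
    by (rule U.indep_var_restrict[OF indep_coords I])
  have f1: "fam m l \<in> PiM I1 (\<lambda>_. unif01) \<rightarrow>\<^sub>M count_space UNIV" "fam m l (restrict u I1) = fam m l u" for u
    by (auto intro!: fam_measurable fam_restrict simp: I1_def)
  have b2: "brood P m n z (restrict u I2) = brood P m n z u" for z u
    unfolding brood_def by (intro sum.cong refl) (auto simp: I2_def)
  have b3: "brood P m n z \<in> borel_measurable (PiM I2 (\<lambda>_. unif01))" for z
    unfolding brood_def
  proof (rule borel_measurable_sum, clarify)
    fix j k assume k: "k \<in> {1..z $ j}"
    have "(\<lambda>u. u (m, n, k, j)) \<in> PiM I2 (\<lambda>_. unif01) \<rightarrow>\<^sub>M unif01"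
      by (rule measurable_component_singleton) (use k in \<open>auto simp: I2_def\<close>)
    then show "(\<lambda>u. yield P n j (u (m, n, k, j))) \<in> borel_measurable (PiM I2 (\<lambda>_. unif01))"
      by (rule measurable_compose) (rule yield_moments, use P in \<open>auto simp: n_def\<close>)
  qed
  \<comment> \<open>Joint measurability is obtained by running through the countably many values of
    the generation.\<close>
  have h: "(\<lambda>p. \<phi> (brood P m n (fam m l (fst p)) (snd p))) \<in> borel_measurable (PiM I1 (\<lambda>_. unif01) \<Otimes>\<^sub>M PiM I2 (\<lambda>_. unif01))"
  proof (rule measurable_compose_countable[where f = "\<lambda>z p. \<phi> (brood P m n z (snd p))" and g = "\<lambda>p. fam m l (fst p)"])
    show "(\<lambda>p. \<phi> (brood P m n z (snd p))) \<in> borel_measurable (PiM I1 (\<lambda>_. unif01) \<Otimes>\<^sub>M PiM I2 (\<lambda>_. unif01))" for z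
      by (rule measurable_compose[OF measurable_compose[OF measurable_snd b3] \<phi>])
    show "(\<lambda>p. fam m l (fst p)) \<in> PiM I1 (\<lambda>_. unif01) \<Otimes>\<^sub>M PiM I2 (\<lambda>_. unif01) \<rightarrow>\<^sub>M count_space UNIV"
      by (rule measurable_compose[OF measurable_fst f1(1)])
  qed
  show ?thesis
    using U.indep_var_nn_integral[OF ind h] unfolding n_def[symmetric] by (simp add: f1(2) b2)
qed

text \<open>Integrating out the last reproduction absorbs its mean matrix into \<open>P\<close>;
  this is why \<open>P\<close> is kept arbitrary.\<close>

lemma fam_mean_step:
  assumes P: "nonneg_mat P"
  shows "(\<integral>\<^sup>+u. ennreal (vsum (P *v real_vec (fam m (Suc l) u))) \<partial>U_space)
    = (\<integral>\<^sup>+u. ennreal (vsum ((P ** a (m + Suc l)) *v real_vec (fam m l u))) \<partial>U_space)"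
proof -
  have "(\<integral>\<^sup>+u. ennreal (vsum (P *v real_vec (fam m (Suc l) u))) \<partial>U_space)
     = (\<integral>\<^sup>+u. ennreal (brood P m (m + Suc l) (fam m l u) u) \<partial>U_space)" unfolding fam_Suc ..
  also have "\<dots> = (\<integral>\<^sup>+u. \<integral>\<^sup>+u'. ennreal (brood P m (m + Suc l) (fam m l u) u') \<partial>U_space \<partial>U_space)"
    by (rule fresh_generation[OF P]) simp
  also have "\<dots> = (\<integral>\<^sup>+u. ennreal (vsum ((P ** a (m + Suc l)) *v real_vec (fam m l u))) \<partial>U_space)"
    using brood_moments(1,3)[OF P, of m "m + Suc l"] brood_nonneg[OF P]
    by (intro nn_integral_cong) (simp add: nn_integral_eq_integral)
  finally show ?thesis .
qed

text \<open>Given the parents, the second moment is at most the squared conditional mean plus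
  \<open>\<gamma> * (esum P)\<^sup>2\<close> for each parent.\<close>

lemma fam_square_step:
  assumes P: "nonneg_mat P" and \<gamma>: "0 \<le> \<gamma>"
  shows "(\<integral>\<^sup>+u. ennreal ((vsum (P *v real_vec (fam m (Suc l) u)))\<^sup>2) \<partial>U_space)
    \<le> (\<integral>\<^sup>+u. ennreal ((vsum ((P ** a (m + Suc l)) *v real_vec (fam m l u)))\<^sup>2) \<partial>U_space)
      + ennreal (\<gamma> * (esum P)\<^sup>2) * (\<integral>\<^sup>+u. ennreal (vsum (real_vec (fam m l u))) \<partial>U_space)"
proof -
  have [measurable]: "(\<lambda>u. ennreal (f (fam m l u))) \<in> borel_measurable U_space" for f :: "nat ^ 'd \<Rightarrow> real"
    by (rule measurable_compose[OF fam_measurable_U]) simp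
  have "(\<integral>\<^sup>+u. ennreal ((vsum (P *v real_vec (fam m (Suc l) u)))\<^sup>2) \<partial>U_space)
     = (\<integral>\<^sup>+u. ennreal ((brood P m (m + Suc l) (fam m l u) u)\<^sup>2) \<partial>U_space)" unfolding fam_Suc ..
  also have "\<dots> = (\<integral>\<^sup>+u. \<integral>\<^sup>+u'. ennreal ((brood P m (m + Suc l) (fam m l u) u')\<^sup>2) \<partial>U_space \<partial>U_space)"
    by (rule fresh_generation[OF P]) simp
  also have "\<dots> \<le> (\<integral>\<^sup>+u. ennreal ((vsum ((P ** a (m + Suc l)) *v real_vec (fam m l u)))\<^sup>2)
      + ennreal (\<gamma> * (esum P)\<^sup>2) * ennreal (vsum (real_vec (fam m l u))) \<partial>U_space)"
  proof (rule nn_integral_mono)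
    fix u
    let ?z = "fam m l u"
    have "(\<integral>\<^sup>+u'. ennreal ((brood P m (m + Suc l) ?z u')\<^sup>2) \<partial>U_space)
       = ennreal (U.expectation (\<lambda>u'. (brood P m (m + Suc l) ?z u')\<^sup>2))"
      using brood_moments(2)[OF P, of m "m + Suc l" ?z] by (simp add: nn_integral_eq_integral)
    also have "\<dots> \<le> ennreal ((vsum ((P ** a (m + Suc l)) *v real_vec ?z))\<^sup>2 + \<gamma> * (esum P)\<^sup>2 * vsum (real_vec ?z))"
      using brood_moments(4)[OF P, of m "m + Suc l" ?z] by (intro ennreal_leI) simp
    also have "\<dots> = ennreal ((vsum ((P ** a (m + Suc l)) *v real_vec ?z))\<^sup>2) + ennreal (\<gamma> * (esum P)\<^sup>2) * ennreal (vsum (real_vec ?z))"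
      using \<gamma> vsum_nonneg[OF nonneg_real_vec] by (subst ennreal_mult[symmetric]) (auto intro!: ennreal_plus)
    finally show "(\<integral>\<^sup>+u'. ennreal ((brood P m (m + Suc l) ?z u')\<^sup>2) \<partial>U_space)
      \<le> ennreal ((vsum ((P ** a (m + Suc l)) *v real_vec ?z))\<^sup>2) + ennreal (\<gamma> * (esum P)\<^sup>2) * ennreal (vsum (real_vec ?z))" .
  qed
  also have "\<dots> = (\<integral>\<^sup>+u. ennreal ((vsum ((P ** a (m + Suc l)) *v real_vec (fam m l u)))\<^sup>2) \<partial>U_space)
      + (\<integral>\<^sup>+u. ennreal (\<gamma> * (esum P)\<^sup>2) * ennreal (vsum (real_vec (fam m l u))) \<partial>U_space)"
    by (rule nn_integral_add) measurable
  also have "(\<integral>\<^sup>+u. ennreal (\<gamma> * (esum P)\<^sup>2) * ennreal (vsum (real_vec (fam m l u))) \<partial>U_space)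
     = ennreal (\<gamma> * (esum P)\<^sup>2) * (\<integral>\<^sup>+u. ennreal (vsum (real_vec (fam m l u))) \<partial>U_space)"
    by (rule nn_integral_cmult) measurable
  finally show ?thesis .
qed

definition start :: "nat \<Rightarrow> real ^ 'd" where
  "start m = (\<chi> i. real (nat \<lfloor>v m $ i\<rfloor>))"

lemma fam_0: "real_vec (fam m 0 u) = start m"
  by (simp add: real_vec_def fam_def start_def)

lemma fam_mean:
  assumes P: "nonneg_mat P"
  shows "(\<integral>\<^sup>+u. ennreal (vsum (P *v real_vec (fam m l u))) \<partial>U_space)
    = ennreal (vsum (P *v (lprod (\<lambda>i. a (m + l - i)) l *v start m)))"
  using P
proof (induction l arbitrary: P)
  case 0
  then show ?case by (simp add: fam_0 U.emeasure_space_1)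
next
  case (Suc l)
  have "nonneg_mat (P ** a (m + Suc l))" using Suc.prems by (intro nonneg_mat_mult a_nonneg) auto
  from Suc.IH[OF this] show ?case
    unfolding fam_mean_step[OF Suc.prems] lprod_Suc_shift
    by (simp add: matrix_vector_mul_assoc matrix_mul_assoc)
qed

text \<open>Term \<open>j\<close> is the variance created by the reproduction \<open>j\<close> steps
  before the end: the squared mean growth since then times the mean number of parents.\<close>

lemma fam_second_moment:
  assumes P: "nonneg_mat P" and \<gamma>: "0 \<le> \<gamma>"
  shows "(\<integral>\<^sup>+u. ennreal ((vsum (P *v real_vec (fam m l u)))\<^sup>2) \<partial>U_space)
    \<le> ennreal ((vsum (P *v (lprod (\<lambda>i. a (m + l - i)) l *v start m)))\<^sup>2
       + \<gamma> * (\<Sum>j<l. (esum (P ** lprod (\<lambda>i. a (m + l - i)) j))\<^sup>2 *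
           vsum (lprod (\<lambda>i. a (m + l - (Suc j + i))) (l - Suc j) *v start m)))"
  using P
proof (induction l arbitrary: P)
  case 0
  then show ?case by (simp add: fam_0 U.emeasure_space_1)
next
  case (Suc l)
  let ?P' = "P ** a (m + Suc l)"
  have P': "nonneg_mat ?P'" using Suc.prems by (intro nonneg_mat_mult a_nonneg) auto
  have ns: "nonneg_vec (start m)" by (simp add: nonneg_vec_def start_def)
  have nl: "nonneg_vec (lprod (\<lambda>i. a (m + l' - (k + i))) (l' - k) *v start m)" for l' k
    by (intro nonneg_vec_mult nonneg_mat_lprod a_nonneg ns) auto
  define t where "t j = (esum (P ** lprod (\<lambda>i. a (m + Suc l - i)) j))\<^sup>2 *
           vsum (lprod (\<lambda>i. a (m + Suc l - (Suc j + i))) (Suc l - Suc j) *v start m)" for j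
  have t0: "0 \<le> t j" for j unfolding t_def by (intro mult_nonneg_nonneg vsum_nonneg nl) simp
  have "(\<integral>\<^sup>+u. ennreal ((vsum (P *v real_vec (fam m (Suc l) u)))\<^sup>2) \<partial>U_space)
     \<le> (\<integral>\<^sup>+u. ennreal ((vsum (?P' *v real_vec (fam m l u)))\<^sup>2) \<partial>U_space)
      + ennreal (\<gamma> * (esum P)\<^sup>2) * (\<integral>\<^sup>+u. ennreal (vsum (real_vec (fam m l u))) \<partial>U_space)"
    by (rule fam_square_step[OF Suc.prems \<gamma>])
  also have "(\<integral>\<^sup>+u. ennreal (vsum (real_vec (fam m l u))) \<partial>U_space) = ennreal (vsum (lprod (\<lambda>i. a (m + l - i)) l *v start m))"
    using fam_mean[OF nonneg_mat_one, of m l] by simp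
  \<comment> \<open>The variance of the last reproduction, which becomes the term
    \<open>j = 0\<close>.\<close>
  also have "ennreal (\<gamma> * (esum P)\<^sup>2) * \<dots> = ennreal (\<gamma> * t 0)"
    using \<gamma> vsum_nonneg[OF nl[of l 0]] by (simp add: t_def ennreal_mult[symmetric] mult.assoc)
  also have "(\<integral>\<^sup>+u. ennreal ((vsum (?P' *v real_vec (fam m l u)))\<^sup>2) \<partial>U_space)
     \<le> ennreal ((vsum (?P' *v (lprod (\<lambda>i. a (m + l - i)) l *v start m)))\<^sup>2
       + \<gamma> * (\<Sum>j<l. (esum (?P' ** lprod (\<lambda>i. a (m + l - i)) j))\<^sup>2 *
           vsum (lprod (\<lambda>i. a (m + l - (Suc j + i))) (l - Suc j) *v start m)))"
    by (rule Suc.IH[OF P'])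
  also have "\<dots> = ennreal ((vsum (P *v (lprod (\<lambda>i. a (m + Suc l - i)) (Suc l) *v start m)))\<^sup>2 + \<gamma> * (\<Sum>j<l. t (Suc j)))"
    unfolding t_def lprod_Suc_shift by (simp add: matrix_vector_mul_assoc matrix_mul_assoc)
  finally have "(\<integral>\<^sup>+u. ennreal ((vsum (P *v real_vec (fam m (Suc l) u)))\<^sup>2) \<partial>U_space)
     \<le> ennreal ((vsum (P *v (lprod (\<lambda>i. a (m + Suc l - i)) (Suc l) *v start m)))\<^sup>2 + \<gamma> * (\<Sum>j<l. t (Suc j))) + ennreal (\<gamma> * t 0)"
    by (simp add: add_right_mono)
  also have "\<dots> = ennreal ((vsum (P *v (lprod (\<lambda>i. a (m + Suc l - i)) (Suc l) *v start m)))\<^sup>2 + \<gamma> * (\<Sum>j<Suc l. t j))"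
    using \<gamma> t0 by (subst ennreal_plus[symmetric]) (auto simp: sum.lessThan_Suc_shift algebra_simps intro!: add_nonneg_nonneg mult_nonneg_nonneg sum_nonneg simp del: sum.lessThan_Suc)
  finally show ?case unfolding t_def .
qed

text \<open>Chebyshev's inequality at distance \<open>\<mu> / 2\<close> from the mean, hence the
  factor 4.\<close>

lemma fam_small_prob:
  assumes \<gamma>: "0 \<le> \<gamma>" and \<mu>: "\<mu> = vsum (lprod (\<lambda>i. a (m + l - i)) l *v start m)" "0 < \<mu>" and b: "2 * b \<le> \<mu>"
  shows "U.prob {u \<in> space U_space. vsum (real_vec (fam m l u)) \<le> b} \<le>
     4 * \<gamma> / \<mu>\<^sup>2 * (\<Sum>j<l. (esum (lprod (\<lambda>i. a (m + l - i)) j))\<^sup>2 *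
           vsum (lprod (\<lambda>i. a (m + l - (Suc j + i))) (l - Suc j) *v start m))"
proof -
  define s where "s = \<gamma> * (\<Sum>j<l. (esum (lprod (\<lambda>i. a (m + l - i)) j))\<^sup>2 *
           vsum (lprod (\<lambda>i. a (m + l - (Suc j + i))) (l - Suc j) *v start m))"
  define Z where "Z u = vsum (real_vec (fam m l u))" for u
  have [measurable]: "Z \<in> borel_measurable U_space"
    unfolding Z_def by (rule measurable_compose[OF fam_measurable_U]) simp
  have Z0: "0 \<le> Z u" for u unfolding Z_def by (rule vsum_nonneg[OF nonneg_real_vec])
  have ns: "nonneg_vec (start m)" by (simp add: nonneg_vec_def start_def)
  have s0: "0 \<le> s" unfolding s_def
    by (intro mult_nonneg_nonneg sum_nonneg \<gamma> vsum_nonneg nonneg_vec_mult nonneg_mat_lprod a_nonneg ns) auto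
  have m1: "(\<integral>\<^sup>+u. ennreal (Z u) \<partial>U_space) = ennreal \<mu>"
    using fam_mean[OF nonneg_mat_one, of m l] by (simp add: Z_def \<mu>)
  have m2: "(\<integral>\<^sup>+u. ennreal ((Z u)\<^sup>2) \<partial>U_space) \<le> ennreal (\<mu>\<^sup>2 + s)"
    using fam_second_moment[OF nonneg_mat_one \<gamma>, of m l] by (simp add: Z_def \<mu> s_def)
  have i1: "integrable U_space Z"
    using m1 Z0 by (intro integrableI_nonneg) auto
  have i2: "integrable U_space (\<lambda>u. (Z u)\<^sup>2)"
    using m2 by (intro integrableI_nonneg) (auto simp: le_less_trans)
  have E1: "U.expectation Z = \<mu>"
    using m1 Z0 \<mu> by (subst integral_eq_nn_integral) auto
  have E2: "U.expectation (\<lambda>u. (Z u)\<^sup>2) \<le> \<mu>\<^sup>2 + s"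
  proof -
    have "ennreal (U.expectation (\<lambda>u. (Z u)\<^sup>2)) = (\<integral>\<^sup>+u. ennreal ((Z u)\<^sup>2) \<partial>U_space)"
      by (rule nn_integral_eq_integral[OF i2, symmetric]) simp
    also have "\<dots> \<le> ennreal (\<mu>\<^sup>2 + s)" by (rule m2)
    finally show ?thesis using s0 by (subst (asm) ennreal_le_iff) auto
  qed
  have "U.prob {u \<in> space U_space. Z u \<le> b} \<le> U.prob {u \<in> space U_space. \<mu> / 2 \<le> \<bar>Z u - U.expectation Z\<bar>}"
    using b \<mu>(2) by (intro U.finite_measure_mono) (auto simp: E1 abs_if)
  also have "\<dots> \<le> U.variance Z / (\<mu> / 2)\<^sup>2"
    using \<mu>(2) by (intro U.Chebyshev_inequality i2) auto
  also have "U.variance Z = U.expectation (\<lambda>u. (Z u)\<^sup>2) - \<mu>\<^sup>2"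
    using U.variance_eq[OF i1 i2] by (simp add: E1)
  also have "\<dots> / (\<mu> / 2)\<^sup>2 \<le> s / (\<mu> / 2)\<^sup>2" using E2 by (intro divide_right_mono) auto
  finally show ?thesis by (simp add: Z_def s_def power_divide mult_ac)
qed

text \<open>The uniforms carry the immigration time as first index, so different families use
  disjoint sets of coordinates.\<close>

lemma fam_indep_prob:
  shows "U.prob {u \<in> space U_space. \<forall>m<n. vsum (real_vec (fam (n - m) m u)) \<le> b}
    = (\<Prod>m<n. U.prob {u \<in> space U_space. vsum (real_vec (fam (n - m) m u)) \<le> b})"
proof (cases "n = 0")
  case True
  then show ?thesis by (simp add: U.prob_space)
next
  case False
  define Km :: "nat \<Rightarrow> (nat \<times> nat \<times> nat \<times> 'd) set" where "Km m = {(m', n', k, j). m' = n - m \<and> m' < n' \<and> 1 \<le> k}" for m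
  have K: "Km m \<subseteq> (U_index :: (nat \<times> nat \<times> nat \<times> 'd) set)" for m by (auto simp: Km_def U_index_def)
  have dis: "disjoint_family_on (Km :: nat \<Rightarrow> (nat \<times> nat \<times> nat \<times> 'd) set) {..<n}"
    by (auto simp: disjoint_family_on_def Km_def)
  have "U.indep_vars (\<lambda>m. PiM (Km m) (\<lambda>_. unif01)) (\<lambda>m u. restrict (\<lambda>p. u p) (Km m)) {..<n}"
    by (rule U.indep_vars_restrict[OF indep_coords K dis])
  then have "U.indep_vars (\<lambda>_. count_space UNIV) (\<lambda>m u. fam (n - m) m (restrict (\<lambda>p. u p) (Km m))) {..<n}"
    by (rule U.indep_vars_compose2) (rule fam_measurable, auto simp: Km_def)
  moreover have "fam (n - m) m (restrict (\<lambda>p. u p) (Km m)) = fam (n - m) m u" for m u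
    by (rule fam_restrict) (auto simp: Km_def)
  ultimately have ind: "U.indep_vars (\<lambda>_. count_space UNIV) (\<lambda>m u. fam (n - m) m u) {..<n}" by simp
  have "U.prob (\<Inter>m\<in>{..<n}. fam (n - m) m -` {z. vsum (real_vec z) \<le> b} \<inter> space U_space)
      = (\<Prod>m\<in>{..<n}. U.prob (fam (n - m) m -` {z. vsum (real_vec z) \<le> b} \<inter> space U_space))"
    using False by (intro U.indep_varsD_finite[OF ind]) auto
  moreover have "(\<Inter>m\<in>{..<n}. fam (n - m) m -` {z. vsum (real_vec z) \<le> b} \<inter> space U_space)
     = {u \<in> space U_space. \<forall>m<n. vsum (real_vec (fam (n - m) m u)) \<le> b}"
    using False by auto
  moreover have "fam (n - m) m -` {z. vsum (real_vec z) \<le> b} \<inter> space U_space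
     = {u \<in> space U_space. vsum (real_vec (fam (n - m) m u)) \<le> b}" for m by auto
  ultimately show ?thesis by simp
qed

end

section \<open>Extinction of large families\<close>

text \<open>Independence of the generated sigma-algebras determines the joint law on rectangles as
  the product law; Tonelli's theorem then freezes \<open>Y\<close>.\<close>

lemma indep_rvs_nn_integral:
  assumes M: "prob_space M" and ind: "indep_rvs M S X T Y" and h [measurable]: "h \<in> borel_measurable (S \<Otimes>\<^sub>M T)"
  shows "(\<integral>\<^sup>+\<omega>. h (X \<omega>, Y \<omega>) \<partial>M) = (\<integral>\<^sup>+\<omega>. \<integral>\<^sup>+x. h (x, Y \<omega>) \<partial>distr M S X \<partial>M)"
proof -
  interpret prob_space M by fact
  have [measurable]: "X \<in> M \<rightarrow>\<^sub>M S" "Y \<in> M \<rightarrow>\<^sub>M T"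
    and i: "indep_set (sets (vimage_algebra (space M) X S)) (sets (vimage_algebra (space M) Y T))"
    using ind by (auto simp: indep_rvs_def)
  interpret X: prob_space "distr M S X" by (rule prob_space_distr) measurable
  interpret Y: prob_space "distr M T Y" by (rule prob_space_distr) measurable
  interpret XY: pair_sigma_finite "distr M S X" "distr M T Y" ..
  have eq: "distr M S X \<Otimes>\<^sub>M distr M T Y = distr M (S \<Otimes>\<^sub>M T) (\<lambda>\<omega>. (X \<omega>, Y \<omega>))"
  proof (rule pair_measure_eqI)
    fix A B assume "A \<in> sets (distr M S X)" "B \<in> sets (distr M T Y)"
    then have [measurable]: "A \<in> sets S" "B \<in> sets T" by auto
    have "prob ((X -` A \<inter> space M) \<inter> (Y -` B \<inter> space M)) = prob (X -` A \<inter> space M) * prob (Y -` B \<inter> space M)"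
      by (rule indep_setD[OF i]) (auto intro: in_vimage_algebra)
    moreover have "(\<lambda>\<omega>. (X \<omega>, Y \<omega>)) -` (A \<times> B) \<inter> space M = (X -` A \<inter> space M) \<inter> (Y -` B \<inter> space M)" by auto
    ultimately show "emeasure (distr M S X) A * emeasure (distr M T Y) B
       = emeasure (distr M (S \<Otimes>\<^sub>M T) (\<lambda>\<omega>. (X \<omega>, Y \<omega>))) (A \<times> B)"
      by (simp add: emeasure_distr emeasure_eq_measure ennreal_mult)
  qed (auto intro: X.sigma_finite_measure_axioms Y.sigma_finite_measure_axioms cong: sets_pair_measure_cong)
  have "(\<integral>\<^sup>+\<omega>. h (X \<omega>, Y \<omega>) \<partial>M) = (\<integral>\<^sup>+p. h p \<partial>distr M (S \<Otimes>\<^sub>M T) (\<lambda>\<omega>. (X \<omega>, Y \<omega>)))"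
    by (subst nn_integral_distr) auto
  also have "\<dots> = (\<integral>\<^sup>+p. h p \<partial>(distr M S X \<Otimes>\<^sub>M distr M T Y))" by (simp add: eq)
  also have "\<dots> = (\<integral>\<^sup>+y. \<integral>\<^sup>+x. h (x, y) \<partial>distr M S X \<partial>distr M T Y)"
    by (rule XY.nn_integral_snd[symmetric]) simp
  also have "\<dots> = (\<integral>\<^sup>+\<omega>. \<integral>\<^sup>+x. h (x, Y \<omega>) \<partial>distr M S X \<partial>M)"
    by (rule nn_integral_distr) measurable
  finally show ?thesis .
qed

text \<open>The norm sees a single coordinate, and rounding that one down loses at most 1.\<close>

lemma infnorm_le_vsum_floor:
  fixes y :: "real ^ 'd"
  assumes "nonneg_vec y"
  shows "infnorm y - 1 \<le> vsum (\<chi> i. real (nat \<lfloor>y $ i\<rfloor>))"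
proof -
  have "\<bar>y $ i\<bar> \<le> vsum (\<chi> i. real (nat \<lfloor>y $ i\<rfloor>)) + 1" for i
  proof -
    have "0 \<le> y $ i" using assms by (simp add: nonneg_vec_def)
    then have "\<bar>y $ i\<bar> \<le> real (nat \<lfloor>y $ i\<rfloor>) + 1" by linarith
    also have "real (nat \<lfloor>y $ i\<rfloor>) \<le> vsum (\<chi> i. real (nat \<lfloor>y $ i\<rfloor>))"
      using vec_le_vsum[of "\<chi> i. real (nat \<lfloor>y $ i\<rfloor>)" i] by (simp add: nonneg_vec_def)
    finally show ?thesis by simp
  qed
  then have "infnorm y \<le> vsum (\<chi> i. real (nat \<lfloor>y $ i\<rfloor>)) + 1"
    unfolding infnorm_cart by (intro cSup_least) auto
  then show ?thesis by simp
qed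

context iid_environment
begin

text \<open>In Chebyshev's sum one factor \<open>esum (P j)\<close> is at most
  \<open>exp (real m powr \<alpha>)\<close>; the other, joined with the remainder, is at most a
  constant times the mean \<open>\<mu>\<close>. Dividing by the square of \<open>\<mu>\<close>
  leaves one inverse mean, which is at most of order
  \<open>exp (- 2 * real m powr \<alpha>)\<close>.\<close>

lemma family_extinction_bound:
  assumes x: "good x" and q: "quenched_branching \<psi> a \<gamma>" and \<gamma>: "0 \<le> \<gamma>"
    and past: "\<And>i. i < n \<Longrightarrow> a (n - i) = fst (x i)" "m < n" "v (n - m) = snd (x m)" "nonneg_vec (snd (x m))"
    and m: "2 * K \<le> m" "\<not> bad \<alpha> m x" "T \<alpha> m < infnorm (snd (x m))" "2 \<le> T \<alpha> m"
    and c1: "c1 = \<kappa> / G ^ K / 2" and b: "2 * b \<le> c1 * exp (2 * real m powr \<alpha>)"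
  shows "measure U_space {u \<in> space U_space. vsum (real_vec (quenched_branching.fam \<psi> v (n - m) m u)) \<le> b}
    \<le> \<gamma> / c1 ^ 3 * (real m * exp (- (real m powr \<alpha>)))"
proof -
  interpret quenched_branching \<psi> a \<gamma> v by fact
  have c1_pos: "0 < c1" using \<kappa> G by (simp add: c1)
  define P where "P = lprod (\<lambda>i. fst (x i))"
  define s where "s = start (n - m)"
  have ns: "nonneg_vec s" by (simp add: s_def nonneg_vec_def start_def)
  have e1: "lprod (\<lambda>i. a (n - m + m - i)) j = P j" if "j \<le> m" for j
    unfolding P_def using that past(1,2) by (intro lprod_cong) auto
  have e2: "lprod (\<lambda>i. a (n - m + m - (Suc j + i))) (m - Suc j) = lprod (\<lambda>i. fst (x (Suc j + i))) (m - Suc j)" for j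
    using past(1)[of "Suc j + i" for i] past(2) by (intro lprod_cong) auto
  define \<mu> where "\<mu> = vsum (P m *v s)"
  have "T \<alpha> m / 2 \<le> T \<alpha> m - 1" using m(4) by simp
  also have "\<dots> \<le> vsum s"
    using infnorm_le_vsum_floor[OF past(4)] m(3) by (simp add: s_def start_def past(3))
  finally have \<mu>_ge: "c1 * exp (2 * real m powr \<alpha>) \<le> \<mu>"
    unfolding c1 \<mu>_def P_def using m K by (intro mean_ge[OF x _ m(2) ns]) auto
  have \<mu>_pos: "0 < \<mu>" using c1_pos by (intro less_le_trans[OF _ \<mu>_ge]) simp
  have pe: "0 \<le> esum (P j)" for j
    unfolding P_def by (intro esum_nonneg adm_nonneg0[OF G \<kappa> K x])
  have "m \<noteq> 0" using m K by auto
  \<comment> \<open>Badness at \<open>m\<close> monitors all prefixes, so not being bad bounds every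
    intermediate product; the negative drift is simply dropped.\<close>
  have Pj: "esum (P j) \<le> exp (real m powr \<alpha>)" if "j < m" for j
  proof -
    have "dev j x \<le> real m powr \<alpha>" using m(2) that by (auto simp: bad_def not_less)
    moreover have "0 \<le> lam * real j" using lam by simp
    ultimately have "Sn j x \<le> real m powr \<alpha>" by (simp add: dev_def abs_le_iff)
    then show ?thesis unfolding P_def by (simp add: esum_lprod_eq_exp[OF x])
  qed
  \<comment> \<open>The mean is nearly multiplicative across the cut at \<open>j\<close>; the
    constant is \<open>4 * c1\<^sup>2\<close>, whose 4 cancels the one from Chebyshev's
    inequality.\<close>
  have split: "esum (P j) * vsum (lprod (\<lambda>i. fst (x (Suc j + i))) (m - Suc j) *v s) \<le> \<mu> / (4 * c1\<^sup>2)" if "j < m" for j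
  proof -
    have "(\<kappa> / G ^ K)\<^sup>2 = 4 * c1\<^sup>2" by (simp add: c1 power_divide)
    moreover have "(\<kappa> / G ^ K)\<^sup>2 * esum (P j) * vsum (lprod (\<lambda>i. fst (x (Suc j + i))) (m - Suc j) *v s) \<le> \<mu>"
      unfolding \<mu>_def P_def by (rule adm_family_split[OF G \<kappa> K x ns m(1) that])
    ultimately have "4 * c1\<^sup>2 * esum (P j) * vsum (lprod (\<lambda>i. fst (x (Suc j + i))) (m - Suc j) *v s) \<le> \<mu>"
      by (simp only:)
    then show ?thesis using c1_pos by (simp add: field_simps)
  qed
  have "U.prob {u \<in> space U_space. vsum (real_vec (fam (n - m) m u)) \<le> b} \<le>
     4 * \<gamma> / \<mu>\<^sup>2 * (\<Sum>j<m. (esum (lprod (\<lambda>i. a (n - m + m - i)) j))\<^sup>2 *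
           vsum (lprod (\<lambda>i. a (n - m + m - (Suc j + i))) (m - Suc j) *v start (n - m)))"
    by (rule fam_small_prob[OF \<gamma>]) (use \<mu>_pos \<mu>_ge b in \<open>auto simp: \<mu>_def e1[simplified] s_def\<close>)
  also have "\<dots> = 4 * \<gamma> / \<mu>\<^sup>2 * (\<Sum>j<m. esum (P j) * (esum (P j) * vsum (lprod (\<lambda>i. fst (x (Suc j + i))) (m - Suc j) *v s)))"
    unfolding e2 s_def[symmetric] by (intro arg_cong[where f = "\<lambda>S. 4 * \<gamma> / \<mu>\<^sup>2 * S"] refl sum.cong) (simp add: e1[simplified] power2_eq_square mult.assoc)
  also have "\<dots> \<le> 4 * \<gamma> / \<mu>\<^sup>2 * (\<Sum>j<m. exp (real m powr \<alpha>) * (\<mu> / (4 * c1\<^sup>2)))"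
    using \<gamma> Pj split pe by (intro mult_left_mono sum_mono mult_mono vsum_nonneg nonneg_vec_mult adm_nonneg[OF G \<kappa> K x] ns mult_nonneg_nonneg) auto
  also have "\<dots> = \<gamma> / c1\<^sup>2 * (real m * exp (real m powr \<alpha>)) / \<mu>"
    using \<mu>_pos c1_pos by (simp add: power2_eq_square field_simps)
  also have "\<dots> \<le> \<gamma> / c1\<^sup>2 * (real m * exp (real m powr \<alpha>)) / (c1 * exp (2 * real m powr \<alpha>))"
    using \<gamma> c1_pos \<mu>_ge \<mu>_pos by (intro divide_left_mono) auto
  also have "\<dots> = \<gamma> / c1 ^ 3 * (real m * (exp (real m powr \<alpha>) / exp (2 * real m powr \<alpha>)))"
    using c1_pos by (simp add: power2_eq_square power3_eq_cube field_simps)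
  also have "exp (real m powr \<alpha>) / exp (2 * real m powr \<alpha>) = exp (- (real m powr \<alpha>))"
    by (simp add: exp_diff[symmetric])
  finally show ?thesis .
qed

text \<open>The same comparison as for the max process, with extinction probabilities instead of
  indicators. The constant \<open>c\<close> is uniform over all environments with variance bound
  \<open>\<gamma>\<close>.\<close>

lemma survival_bound_branching:
  assumes \<alpha>: "1/2 < \<alpha>" and \<gamma>: "0 \<le> \<gamma>"
  shows "\<exists>c\<ge>0. \<forall>n x \<psi> a v. good x \<longrightarrow> (\<forall>m. nonneg_vec (snd (x m))) \<longrightarrow> quenched_branching \<psi> a \<gamma> \<longrightarrow>
    (\<forall>i<n. a (n - i) = fst (x i) \<and> v (n - i) = snd (x i)) \<longrightarrow>
    ennreal (\<Prod>m<n. measure U_space {u \<in> space U_space. vsum (real_vec (quenched_branching.fam \<psi> v (n - m) m u)) \<le> b})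
      \<le> survival_bound \<alpha> c n x"
proof -
  define c1 where "c1 = \<kappa> / G ^ K / 2"
  have c1: "0 < c1" using \<kappa> G by (simp add: c1_def)
  have f1: "eventually (\<lambda>m::nat. 2 \<le> T \<alpha> m) sequentially"
  proof -
    have "eventually (\<lambda>m::nat. 1 \<le> lam * real m) sequentially"
      using lam by real_asymp
    then show ?thesis
    proof eventually_elim
      case (elim m)
      then show ?case using exp_ge_add_one_self[of "lam * real m + 3 * real m powr \<alpha>"] powr_ge_zero[of "real m" \<alpha>]
        unfolding T_def by linarith
    qed
  qed
  have f2: "eventually (\<lambda>m::nat. 2 * b \<le> c1 * exp (2 * real m powr \<alpha>)) sequentially"
    using c1 \<alpha> by real_asymp
  \<comment> \<open>The extinction bound is smaller than the inverse square of the age from some age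
    on, so it fits under the slack.\<close>
  have "((\<lambda>m::nat. \<gamma> / c1 ^ 3 * ((real m * exp (- (real m powr \<alpha>))) * (real m + 1)\<^sup>2)) \<longlongrightarrow> \<gamma> / c1 ^ 3 * 0) sequentially"
    by (rule tendsto_mult_left) (use \<alpha> in real_asymp)
  then have "eventually (\<lambda>m::nat. \<gamma> / c1 ^ 3 * ((real m * exp (- (real m powr \<alpha>))) * (real m + 1)\<^sup>2) < 1) sequentially"
    by (rule order_tendstoD) simp
  then have f3: "eventually (\<lambda>m::nat. \<gamma> / c1 ^ 3 * (real m * exp (- (real m powr \<alpha>))) \<le> 1 / (real m + 1)\<^sup>2) sequentially"
    by eventually_elim (simp add: pos_le_divide_eq mult.assoc)
  from f1 f2 f3 eventually_ge_at_top[of "2 * K"]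
  have "eventually (\<lambda>m. 2 * K \<le> m \<and> 2 \<le> T \<alpha> m \<and> 2 * b \<le> c1 * exp (2 * real m powr \<alpha>) \<and>
     \<gamma> / c1 ^ 3 * (real m * exp (- (real m powr \<alpha>))) \<le> 1 / (real m + 1)\<^sup>2) sequentially"
    by eventually_elim blast
  then obtain m0 where m0: "\<And>m. m0 \<le> m \<Longrightarrow> 2 * K \<le> m \<and> 2 \<le> T \<alpha> m \<and> 2 * b \<le> c1 * exp (2 * real m powr \<alpha>) \<and>
     \<gamma> / c1 ^ 3 * (real m * exp (- (real m powr \<alpha>))) \<le> 1 / (real m + 1)\<^sup>2"
    unfolding eventually_sequentially by blast
  define c where "c = (real m0 + 1)\<^sup>2"
  have c: "1 \<le> c" unfolding c_def by (rule one_le_power) simp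
  interpret U: prob_space "U_space :: (nat \<times> nat \<times> nat \<times> 'd \<Rightarrow> real) measure"
    by (rule prob_space_PiM) (rule prob_space_unif01)
  show ?thesis
  proof (intro exI[of _ c] conjI allI impI)
    fix n x \<psi> a v
    assume x: "good x" "\<forall>m. nonneg_vec (snd (x m))" and q: "quenched_branching \<psi> a \<gamma>"
      and past: "\<forall>i<n. a (n - i) = fst (x i) \<and> v (n - i) = snd (x i)"
    show "ennreal (\<Prod>m<n. measure U_space {u \<in> space U_space. vsum (real_vec (quenched_branching.fam \<psi> v (n - m) m u)) \<le> b})
      \<le> survival_bound \<alpha> c n x"
    proof (rule survival_bound_prod[where k = m0])
      fix m assume m: "m < n" "m0 \<le> m" "\<not> bad \<alpha> m x" "T \<alpha> m < infnorm (snd (x m))"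
      have "measure U_space {u \<in> space U_space. vsum (real_vec (quenched_branching.fam \<psi> v (n - m) m u)) \<le> b}
        \<le> \<gamma> / c1 ^ 3 * (real m * exp (- (real m powr \<alpha>)))"
        using m m0[OF m(2)] past x by (intro family_extinction_bound[OF x(1) q \<gamma>]) (auto simp: c1_def)
      also have "\<dots> \<le> 1 / (real m + 1)\<^sup>2" using m0[OF m(2)] by simp
      also have "\<dots> \<le> slack c m" unfolding slack_def using c by (intro divide_right_mono) auto
      finally show "measure U_space {u \<in> space U_space. vsum (real_vec (quenched_branching.fam \<psi> v (n - m) m u)) \<le> b} \<le> slack c m" .
    qed (auto simp: c_def)
  qed (use c in simp)
qed

end

section \<open>Branching in a random environment\<close>

locale branching_environment = affine_environment \<Omega> A Y G \<kappa> lam K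
  for \<Omega> :: "'w measure" and A :: "nat \<Rightarrow> 'w \<Rightarrow> real ^ 'd ^ 'd" and Y :: "nat \<Rightarrow> 'w \<Rightarrow> real ^ 'd"
    and G \<kappa> lam K +
  fixes E :: "'d env measure" and \<Psi> :: "nat \<Rightarrow> 'w \<Rightarrow> 'd env"
    and U :: "nat \<Rightarrow> nat \<Rightarrow> nat \<Rightarrow> 'd \<Rightarrow> 'w \<Rightarrow> real"
  assumes branching: "branching_setting \<Omega> E \<Psi> U Y"
    and means: "conditional_mean_offspring \<Omega> E \<Psi> U A"
    and covariance: "bounded_offspring_covariance \<Omega> E \<Psi> U"
begin

declare One_nat_def [simp del]

sublocale unif: prob_space unif01 by (rule prob_space_unif01)

sublocale UU: prob_space "U_space :: (nat \<times> nat \<times> nat \<times> 'd \<Rightarrow> real) measure"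
  by (rule prob_space_PiM) (rule prob_space_unif01)

definition U_fam :: "'w \<Rightarrow> (nat \<times> nat \<times> nat \<times> 'd \<Rightarrow> real)" where
  "U_fam \<omega> = (\<lambda>(m, n, k, j)\<in>U_index. U m n k j \<omega>)"

definition env_Y :: "'w \<Rightarrow> (nat \<Rightarrow> 'd env) \<times> (nat \<Rightarrow> real ^ 'd)" where
  "env_Y \<omega> = (\<lambda>n\<in>{1..}. \<Psi> n \<omega>, \<lambda>n. Y n \<omega>)"

abbreviation env_Y_space :: "((nat \<Rightarrow> 'd env) \<times> (nat \<Rightarrow> real ^ 'd)) measure" where
  "env_Y_space \<equiv> (\<Pi>\<^sub>M n\<in>{1..}. E) \<Otimes>\<^sub>M (\<Pi>\<^sub>M n\<in>UNIV. borel)"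

lemma eval_measurable: "(\<lambda>(\<psi>, u). \<psi> j u) \<in> E \<Otimes>\<^sub>M unif01 \<rightarrow>\<^sub>M count_space UNIV"
  using branching unfolding branching_setting_def env_space_def by blast

lemma eval_measurable' [measurable]: "(\<lambda>p. fst p j (snd p)) \<in> E \<Otimes>\<^sub>M unif01 \<rightarrow>\<^sub>M count_space UNIV"
  using eval_measurable[of j] by (simp add: case_prod_unfold)

lemma indep_U_env: "indep_rvs \<Omega> U_space U_fam env_Y_space env_Y"
  using branching unfolding branching_setting_def U_fam_def[abs_def] env_Y_def[abs_def] by blast

lemma env_Y_measurable [measurable]: "env_Y \<in> \<Omega> \<rightarrow>\<^sub>M env_Y_space"
  and U_fam_measurable [measurable]: "U_fam \<in> \<Omega> \<rightarrow>\<^sub>M U_space"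
  using indep_U_env unfolding indep_rvs_def by blast+

lemma env_iid: "Om.indep_vars (\<lambda>_. E \<Otimes>\<^sub>M borel) (\<lambda>n \<omega>. (\<Psi> n \<omega>, Y n \<omega>)) {1..}"
  "\<And>n. 1 \<le> n \<Longrightarrow> distr \<Omega> (E \<Otimes>\<^sub>M borel) (\<lambda>\<omega>. (\<Psi> n \<omega>, Y n \<omega>)) = distr \<Omega> (E \<Otimes>\<^sub>M borel) (\<lambda>\<omega>. (\<Psi> 1 \<omega>, Y 1 \<omega>))"
  using branching unfolding branching_setting_def iid_indep_of_initial_def by blast+

lemma env_measurable: "1 \<le> n \<Longrightarrow> \<Psi> n \<in> \<Omega> \<rightarrow>\<^sub>M E"
proof -
  assume "1 \<le> n"
  then have "(\<lambda>\<omega>. (\<Psi> n \<omega>, Y n \<omega>)) \<in> \<Omega> \<rightarrow>\<^sub>M E \<Otimes>\<^sub>M borel"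
    using env_iid(1) unfolding Om.indep_vars_def by auto
  from measurable_compose[OF this measurable_fst] show ?thesis by simp
qed

lemma env_distr: "1 \<le> n \<Longrightarrow> distr \<Omega> E (\<Psi> n) = distr \<Omega> E (\<Psi> 1)"
proof -
  have e: "distr \<Omega> E (\<Psi> n) = distr (distr \<Omega> (E \<Otimes>\<^sub>M borel) (\<lambda>\<omega>. (\<Psi> n \<omega>, Y n \<omega>))) E fst" if "1 \<le> n" for n
  proof (subst distr_distr)
    show "(\<lambda>\<omega>. (\<Psi> n \<omega>, Y n \<omega>)) \<in> \<Omega> \<rightarrow>\<^sub>M E \<Otimes>\<^sub>M borel"
      using env_iid(1) that unfolding Om.indep_vars_def by auto
  qed (auto simp: comp_def)
  assume n: "1 \<le> n"
  show ?thesis unfolding e[OF n] e[OF order_refl] env_iid(2)[OF n] ..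
qed

lemma U_distr: "distr \<Omega> U_space U_fam = U_space"
proof -
  have ne: "(U_index :: (nat \<times> nat \<times> nat \<times> 'd) set) \<noteq> {}"
  proof -
    have "(0, 1, 1, undefined) \<in> (U_index :: (nat \<times> nat \<times> nat \<times> 'd) set)" by (auto simp: U_index_def)
    then show ?thesis by blast
  qed
  let ?X = "\<lambda>(m, n, k, j). U m n k j"
  have ind: "Om.indep_vars (\<lambda>_. unif01) ?X U_index"
    and d: "\<And>p. p \<in> U_index \<Longrightarrow> distr \<Omega> unif01 (?X p) = unif01"
    using branching unfolding branching_setting_def by (blast, auto)
  have rv: "\<And>p. p \<in> U_index \<Longrightarrow> ?X p \<in> \<Omega> \<rightarrow>\<^sub>M unif01"
    using ind unfolding Om.indep_vars_def by blast
  have "distr \<Omega> U_space (\<lambda>\<omega>. \<lambda>p\<in>U_index. ?X p \<omega>) = (\<Pi>\<^sub>M p\<in>U_index. distr \<Omega> unif01 (?X p))"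
    using iffD1[OF Om.indep_vars_iff_distr_eq_PiM'[OF ne rv] ind] by simp
  also have "\<dots> = U_space" by (intro PiM_cong refl d)
  also have "(\<lambda>\<omega>. \<lambda>p\<in>U_index. ?X p \<omega>) = U_fam"
    by (auto simp: U_fam_def restrict_def fun_eq_iff split: prod.splits)
  finally show ?thesis .
qed

text \<open>Freezing the environment: the uniforms are independent of \<open>env_Y\<close> and have
  law \<open>U_space\<close>, so they are integrated out first.\<close>

lemma quenched_integral:
  assumes "h \<in> borel_measurable (U_space \<Otimes>\<^sub>M env_Y_space)"
  shows "(\<integral>\<^sup>+\<omega>. h (U_fam \<omega>, env_Y \<omega>) \<partial>\<Omega>) = (\<integral>\<^sup>+\<omega>. \<integral>\<^sup>+u. h (u, env_Y \<omega>) \<partial>U_space \<partial>\<Omega>)"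
  using indep_rvs_nn_integral[OF Om.prob_space_axioms indep_U_env assms] unfolding U_distr .

section \<open>Conditional moments given the environment\<close>

abbreviation \<F> :: "'w measure" where "\<F> \<equiv> env_algebra \<Omega> E \<Psi>"

lemma env_seq_measurable: "(\<lambda>\<omega>. \<lambda>n\<in>{1..}. \<Psi> n \<omega>) \<in> \<Omega> \<rightarrow>\<^sub>M (\<Pi>\<^sub>M n\<in>{1..}. E)"
  by (rule measurable_restrict) (auto intro: env_measurable)

lemma subalgebra_F: "subalgebra \<Omega> \<F>"
proof -
  have f: "(\<lambda>\<omega>. \<lambda>n\<in>{1..}. \<Psi> n \<omega>) \<in> space \<Omega> \<rightarrow> space (\<Pi>\<^sub>M n\<in>{1..}. E)"
    using measurable_space[OF env_seq_measurable] by blast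
  show ?thesis
    unfolding subalgebra_def env_algebra_def sets_vimage_algebra2[OF f] space_vimage_algebra
    using measurable_sets[OF env_seq_measurable] by blast
qed

sublocale F: sigma_finite_subalgebra \<Omega> \<F>
  by (rule finite_measure_subalgebra_is_sigma_finite)
    (simp add: finite_measure_subalgebra_def finite_measure_subalgebra_axioms_def subalgebra_F Om.finite_measure_axioms)

lemma env_seq_measurable_F: "(\<lambda>\<omega>. \<lambda>n\<in>{1..}. \<Psi> n \<omega>) \<in> \<F> \<rightarrow>\<^sub>M (\<Pi>\<^sub>M n\<in>{1..}. E)"
  unfolding env_algebra_def
  by (rule measurable_vimage_algebra1) (use measurable_space[OF env_seq_measurable] in auto)

lemma env_measurable_F: "1 \<le> n \<Longrightarrow> \<Psi> n \<in> \<F> \<rightarrow>\<^sub>M E"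
  using measurable_compose[OF env_seq_measurable_F measurable_component_singleton[of n "{1..}"]] by simp

text \<open>One uniform is independent of the whole environment, so conditioning amounts to
  integrating it out with \<open>\<Psi> n\<close> fixed. Stated for general \<open>g\<close> because
  means, squares and centred squares are all needed.\<close>

lemma nn_cond_exp_offspring:
  assumes n: "1 \<le> n" and g [measurable]: "g \<in> borel_measurable (E \<Otimes>\<^sub>M unif01)"
  shows "AE \<omega> in \<Omega>. nn_cond_exp \<Omega> \<F> (\<lambda>\<omega>. g (\<Psi> n \<omega>, U 0 n 1 j \<omega>)) \<omega> = (\<integral>\<^sup>+t. g (\<Psi> n \<omega>, t) \<partial>unif01)"
proof -
  have idx: "(0, n, 1, j) \<in> U_index" using n by (auto simp: U_index_def)
  have Uj: "U 0 n 1 j \<omega> = U_fam \<omega> (0, n, 1, j)" for \<omega> using idx by (simp add: U_fam_def)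
  have cm [measurable]: "(\<lambda>u. u (0, n, 1, j)) \<in> U_space \<rightarrow>\<^sub>M unif01"
    by (rule measurable_component_singleton[OF idx])
  have [measurable]: "\<Psi> n \<in> \<Omega> \<rightarrow>\<^sub>M E" by (rule env_measurable[OF n])
  have Um [measurable]: "U 0 n 1 j \<in> \<Omega> \<rightarrow>\<^sub>M unif01"
    unfolding Uj[abs_def] by measurable
  have gm: "(\<lambda>\<psi>. \<integral>\<^sup>+t. g (\<psi>, t) \<partial>unif01) \<in> borel_measurable E"
    by (rule unif.borel_measurable_nn_integral) simp
  have "AE \<omega> in \<Omega>. (\<integral>\<^sup>+t. g (\<Psi> n \<omega>, t) \<partial>unif01) = nn_cond_exp \<Omega> \<F> (\<lambda>\<omega>. g (\<Psi> n \<omega>, U 0 n 1 j \<omega>)) \<omega>"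
  proof (rule F.nn_cond_exp_charact)
    fix B assume "B \<in> sets \<F>"
    then obtain C where C [measurable]: "C \<in> sets (\<Pi>\<^sub>M n\<in>{1..}. E)" and B: "B = (\<lambda>\<omega>. \<lambda>n\<in>{1..}. \<Psi> n \<omega>) -` C \<inter> space \<Omega>"
      using measurable_space[OF env_seq_measurable] by (auto simp: env_algebra_def sets_vimage_algebra2)
    \<comment> \<open>The test set turns into an indicator in the environment variable, so
      \<open>quenched_integral\<close> applies to one function of uniforms and environment.\<close>
    define h where "h p = g (fst (snd p) n, fst p (0, n, 1, j)) * indicator C (fst (snd p))"
      for p :: "(nat \<times> nat \<times> nat \<times> 'd \<Rightarrow> real) \<times> (nat \<Rightarrow> 'd env) \<times> (nat \<Rightarrow> real ^ 'd)"
    have c [measurable]: "(\<lambda>p. fst (snd p) n) \<in> U_space \<Otimes>\<^sub>M env_Y_space \<rightarrow>\<^sub>M E"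
      by (rule measurable_compose[OF measurable_compose[OF measurable_snd measurable_fst] measurable_component_singleton])
        (use n in simp)
    have [measurable]: "h \<in> borel_measurable (U_space \<Otimes>\<^sub>M env_Y_space)"
      unfolding h_def by measurable
    have "(\<integral>\<^sup>+\<omega>\<in>B. g (\<Psi> n \<omega>, U 0 n 1 j \<omega>) \<partial>\<Omega>) = (\<integral>\<^sup>+\<omega>. h (U_fam \<omega>, env_Y \<omega>) \<partial>\<Omega>)"
      using n by (intro nn_integral_cong) (auto simp: h_def Uj env_Y_def B indicator_def)
    also have "\<dots> = (\<integral>\<^sup>+\<omega>. \<integral>\<^sup>+u. h (u, env_Y \<omega>) \<partial>U_space \<partial>\<Omega>)"
      by (rule quenched_integral) measurable
    also have "\<dots> = (\<integral>\<^sup>+\<omega>\<in>B. (\<integral>\<^sup>+t. g (\<Psi> n \<omega>, t) \<partial>unif01) \<partial>\<Omega>)"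
    proof (intro nn_integral_cong)
      fix \<omega> assume \<omega>: "\<omega> \<in> space \<Omega>"
      have [measurable]: "(\<lambda>t. g (\<Psi> n \<omega>, t)) \<in> borel_measurable unif01"
        using measurable_space[OF env_measurable[OF n] \<omega>] by measurable
      have "(\<integral>\<^sup>+u. g (\<Psi> n \<omega>, u (0, n, 1, j)) \<partial>U_space) = (\<integral>\<^sup>+t. g (\<Psi> n \<omega>, t) \<partial>distr U_space unif01 (\<lambda>u. u (0, n, 1, j)))"
        by (rule nn_integral_distr[symmetric, OF cm]) (simp only: measurable_distr_eq1, measurable)
      also have "\<dots> = (\<integral>\<^sup>+t. g (\<Psi> n \<omega>, t) \<partial>unif01)"
        by (simp only: distr_PiM_component[OF prob_space_unif01 idx])
      finally have e: "(\<integral>\<^sup>+u. g (\<Psi> n \<omega>, u (0, n, 1, j)) \<partial>U_space) = (\<integral>\<^sup>+t. g (\<Psi> n \<omega>, t) \<partial>unif01)" .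
      have "(\<integral>\<^sup>+u. h (u, env_Y \<omega>) \<partial>U_space) = (\<integral>\<^sup>+u. g (\<Psi> n \<omega>, u (0, n, 1, j)) * indicator B \<omega> \<partial>U_space)"
        using n \<omega> by (intro nn_integral_cong) (auto simp: h_def env_Y_def B indicator_def)
      also have "\<dots> = (\<integral>\<^sup>+u. g (\<Psi> n \<omega>, u (0, n, 1, j)) \<partial>U_space) * indicator B \<omega>"
        by (rule nn_integral_multc) measurable
      finally show "(\<integral>\<^sup>+u. h (u, env_Y \<omega>) \<partial>U_space) = (\<integral>\<^sup>+t. g (\<Psi> n \<omega>, t) \<partial>unif01) * indicator B \<omega>"
        by (simp add: e)
    qed
    finally show "(\<integral>\<^sup>+\<omega>\<in>B. g (\<Psi> n \<omega>, U 0 n 1 j \<omega>) \<partial>\<Omega>) = (\<integral>\<^sup>+\<omega>\<in>B. (\<integral>\<^sup>+t. g (\<Psi> n \<omega>, t) \<partial>unif01) \<partial>\<Omega>)" .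
  next
    show "(\<lambda>\<omega>. g (\<Psi> n \<omega>, U 0 n 1 j \<omega>)) \<in> borel_measurable \<Omega>" by measurable
    show "(\<lambda>\<omega>. \<integral>\<^sup>+t. g (\<Psi> n \<omega>, t) \<partial>unif01) \<in> borel_measurable \<F>"
      by (rule measurable_compose[OF env_measurable_F[OF n] gm])
  qed
  then show ?thesis by eventually_elim simp
qed

lemma real_cond_exp_offspring:
  assumes n: "1 \<le> n" and g [measurable]: "g \<in> borel_measurable (E \<Otimes>\<^sub>M unif01)" and nn: "\<And>p. 0 \<le> g p"
  shows "AE \<omega> in \<Omega>. real_cond_exp \<Omega> \<F> (\<lambda>\<omega>. g (\<Psi> n \<omega>, U 0 n 1 j \<omega>)) \<omega> = enn2real (\<integral>\<^sup>+t. ennreal (g (\<Psi> n \<omega>, t)) \<partial>unif01)"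
proof -
  have "AE \<omega> in \<Omega>. nn_cond_exp \<Omega> \<F> (\<lambda>\<omega>. ennreal (g (\<Psi> n \<omega>, U 0 n 1 j \<omega>))) \<omega> = (\<integral>\<^sup>+t. ennreal (g (\<Psi> n \<omega>, t)) \<partial>unif01)"
    by (rule nn_cond_exp_offspring[OF n, of "\<lambda>p. ennreal (g p)"]) measurable
  moreover have "AE \<omega> in \<Omega>. nn_cond_exp \<Omega> \<F> (\<lambda>\<omega>. ennreal (- g (\<Psi> n \<omega>, U 0 n 1 j \<omega>))) \<omega> = (\<integral>\<^sup>+t. ennreal (- g (\<Psi> n \<omega>, t)) \<partial>unif01)"
    by (rule nn_cond_exp_offspring[OF n, of "\<lambda>p. ennreal (- g p)"]) measurable
  ultimately show ?thesis
    by eventually_elim (simp add: real_cond_exp_def nn ennreal_neg)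
qed

definition mean_of :: "'d env \<Rightarrow> 'd \<Rightarrow> 'd \<Rightarrow> real" where
  "mean_of \<psi> i j = (\<integral>t. real (\<psi> j t $ i) \<partial>unif01)"

lemma count_measurable [measurable]: "(\<lambda>p. real (fst p j (snd p) $ i)) \<in> borel_measurable (E \<Otimes>\<^sub>M unif01)"
  by (rule measurable_compose[OF eval_measurable']) simp

lemma mean_of_measurable [measurable]: "(\<lambda>\<psi>. mean_of \<psi> i j) \<in> borel_measurable E"
  unfolding mean_of_def
  by (rule unif.borel_measurable_lebesgue_integral) (use count_measurable in \<open>simp add: case_prod_unfold\<close>)

lemma section_measurable: "\<psi> \<in> space E \<Longrightarrow> \<psi> j \<in> unif01 \<rightarrow>\<^sub>M count_space UNIV"
  using branching unfolding branching_setting_def env_space_def offspring_functions_def by blast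

text \<open>The conditional mean is the integral over one uniform; the hypothesis on
  \<open>A\<close> makes it finite, hence integrability.\<close>

lemma mean_eq:
  assumes n: "1 \<le> n"
  shows "AE \<omega> in \<Omega>. integrable unif01 (\<lambda>t. real (\<Psi> n \<omega> j t $ i)) \<and> mean_of (\<Psi> n \<omega>) i j = A n \<omega> $ i $ j"
proof -
  have "AE \<omega> in \<Omega>. nn_cond_exp \<Omega> \<F> (\<lambda>\<omega>. ennreal (real (fst (\<Psi> n \<omega>, U 0 n 1 j \<omega>) j (snd (\<Psi> n \<omega>, U 0 n 1 j \<omega>)) $ i))) \<omega>
      = (\<integral>\<^sup>+t. ennreal (real (fst (\<Psi> n \<omega>, t) j (snd (\<Psi> n \<omega>, t)) $ i)) \<partial>unif01)"
    by (rule nn_cond_exp_offspring[OF n, of "\<lambda>p. ennreal (real (fst p j (snd p) $ i))"]) measurable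
  moreover have "AE \<omega> in \<Omega>. nn_cond_exp \<Omega> \<F> (\<lambda>\<omega>. of_nat (offspring \<Psi> U 0 n 1 i j \<omega>)) \<omega> = ennreal (A n \<omega> $ i $ j)"
    using means n unfolding conditional_mean_offspring_def by blast
  ultimately show ?thesis using AE_space
  proof eventually_elim
    case (elim \<omega>)
    have [measurable]: "(\<lambda>t. real (\<Psi> n \<omega> j t $ i)) \<in> borel_measurable unif01"
      by (rule measurable_compose[OF section_measurable]) (use measurable_space[OF env_measurable[OF n]] elim in auto)
    have e: "(\<integral>\<^sup>+t. ennreal (real (\<Psi> n \<omega> j t $ i)) \<partial>unif01) = ennreal (A n \<omega> $ i $ j)"
      using elim(1,2) by (simp add: offspring_def ennreal_of_nat_eq_real_of_nat)
    have "0 \<le> A n \<omega> $ i $ j" using nonneg(1)[OF n] elim by (simp add: nonneg_mat_def)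
    then show ?case using e
      by (auto intro!: integrableI_nonneg simp: mean_of_def integral_eq_nn_integral)
  qed
qed

text \<open>A property of one environment \<open>\<psi>\<close>, written with nonnegative integrals
  so that it is measurable on \<open>E\<close>. It can therefore be carried from time 1 to every
  time by equality in law.\<close>

definition square_bounded :: "real \<Rightarrow> 'd env \<Rightarrow> bool" where
  "square_bounded \<gamma> \<psi> \<longleftrightarrow> (\<forall>i j. (\<integral>\<^sup>+t. ennreal ((real (\<psi> j t $ i))\<^sup>2) \<partial>unif01) < \<infinity> \<and>
     (\<integral>\<^sup>+t. ennreal ((real (\<psi> j t $ i) - mean_of \<psi> i j)\<^sup>2) \<partial>unif01) \<le> ennreal \<gamma>)"

lemma square_bounded_measurable: "Measurable.pred E (square_bounded \<gamma>)"
proof -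
  have [measurable]: "(\<lambda>\<psi>. \<integral>\<^sup>+t. ennreal ((real (\<psi> j t $ i))\<^sup>2) \<partial>unif01) \<in> borel_measurable E" for i j
    by (rule unif.borel_measurable_nn_integral)
      (use count_measurable[of j i] in \<open>simp add: case_prod_unfold\<close>)
  have [measurable]: "(\<lambda>p. mean_of (fst p) i j) \<in> borel_measurable (E \<Otimes>\<^sub>M unif01)" for i j
    by (rule measurable_compose[OF measurable_fst mean_of_measurable])
  have [measurable]: "(\<lambda>\<psi>. \<integral>\<^sup>+t. ennreal ((real (\<psi> j t $ i) - mean_of \<psi> i j)\<^sup>2) \<partial>unif01) \<in> borel_measurable E" for i j
  proof (rule unif.borel_measurable_nn_integral)
    have "(\<lambda>p. ennreal ((real (fst p j (snd p) $ i) - mean_of (fst p) i j)\<^sup>2)) \<in> borel_measurable (E \<Otimes>\<^sub>M unif01)"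
      by measurable
    then show "(\<lambda>(\<psi>, t). ennreal ((real (\<psi> j t $ i) - mean_of \<psi> i j)\<^sup>2)) \<in> borel_measurable (E \<Otimes>\<^sub>M unif01)"
      by (simp add: case_prod_unfold)
  qed
  show ?thesis unfolding square_bounded_def by measurable
qed

lemma diag_le_matnorm: "\<bar>B $ i $ i\<bar> \<le> matnorm B" for B :: "real ^ 'd ^ 'd"
proof -
  have "\<bar>B $ i $ i\<bar> \<le> (\<Sum>j\<in>UNIV. \<bar>B $ i $ j\<bar>)" by (rule member_le_sum) auto
  also have "\<dots> \<le> matnorm B" unfolding matnorm_def by (rule Max_ge) auto
  finally show ?thesis .
qed

text \<open>The diagonal of the conditional covariance is evaluated by integrating out the uniform,
  and a diagonal entry is at most the row-sum norm bounded by (BD2).\<close>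

lemma square_bounded_first: "\<exists>\<gamma>\<ge>0. AE \<omega> in \<Omega>. square_bounded \<gamma> (\<Psi> 1 \<omega>)"
proof -
  obtain \<gamma> :: nat where \<gamma>: "AE \<omega> in \<Omega>. \<forall>j. matnorm (cond_cov_matrix \<Omega> \<F> (\<lambda>i \<omega>. real (offspring \<Psi> U 0 1 1 i j \<omega>)) \<omega>) \<le> real \<gamma>"
    using covariance unfolding bounded_offspring_covariance_def by blast
  have fin: "AE \<omega> in \<Omega>. \<forall>i j. nn_cond_exp \<Omega> \<F> (\<lambda>\<omega>. (of_nat (offspring \<Psi> U 0 1 1 i j \<omega>))\<^sup>2) \<omega> < \<infinity>"
    using covariance unfolding bounded_offspring_covariance_def by (auto simp: AE_all_countable)
  have sq: "AE \<omega> in \<Omega>. \<forall>i j. nn_cond_exp \<Omega> \<F> (\<lambda>\<omega>. (of_nat (offspring \<Psi> U 0 1 1 i j \<omega>))\<^sup>2) \<omega>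
     = (\<integral>\<^sup>+t. ennreal ((real (\<Psi> 1 \<omega> j t $ i))\<^sup>2) \<partial>unif01)"
  proof (simp only: AE_all_countable, intro allI)
    fix i j
    have "AE \<omega> in \<Omega>. nn_cond_exp \<Omega> \<F> (\<lambda>\<omega>. ennreal ((real (fst (\<Psi> 1 \<omega>, U 0 1 1 j \<omega>) j (snd (\<Psi> 1 \<omega>, U 0 1 1 j \<omega>)) $ i))\<^sup>2)) \<omega>
      = (\<integral>\<^sup>+t. ennreal ((real (fst (\<Psi> 1 \<omega>, t) j (snd (\<Psi> 1 \<omega>, t)) $ i))\<^sup>2) \<partial>unif01)"
      by (rule nn_cond_exp_offspring[of 1 "\<lambda>p. ennreal ((real (fst p j (snd p) $ i))\<^sup>2)"]) (simp, measurable)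
    then show "AE \<omega> in \<Omega>. nn_cond_exp \<Omega> \<F> (\<lambda>\<omega>. (of_nat (offspring \<Psi> U 0 1 1 i j \<omega>))\<^sup>2) \<omega>
       = (\<integral>\<^sup>+t. ennreal ((real (\<Psi> 1 \<omega> j t $ i))\<^sup>2) \<partial>unif01)"
      by (simp add: offspring_def ennreal_of_nat_eq_real_of_nat ennreal_power)
  qed
  have cov: "AE \<omega> in \<Omega>. \<forall>i j. cond_cov_matrix \<Omega> \<F> (\<lambda>i \<omega>. real (offspring \<Psi> U 0 1 1 i j \<omega>)) \<omega> $ i $ i
     = enn2real (\<integral>\<^sup>+t. ennreal ((real (\<Psi> 1 \<omega> j t $ i) - mean_of (\<Psi> 1 \<omega>) i j)\<^sup>2) \<partial>unif01)"
  proof (simp only: AE_all_countable, intro allI)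
    fix i j
    let ?\<xi> = "\<lambda>\<omega>. real (offspring \<Psi> U 0 1 1 i j \<omega>)"
    let ?g = "\<lambda>p. (real (fst p j (snd p) $ i) - mean_of (fst p) i j)\<^sup>2"
    have idx: "(0, 1, 1, j) \<in> U_index" by (auto simp: U_index_def)
    have Uj: "U 0 1 1 j \<omega> = U_fam \<omega> (0, 1, 1, j)" for \<omega> using idx by (simp add: U_fam_def)
    have p1: "(\<lambda>\<omega>. (\<Psi> 1 \<omega>, U 0 1 1 j \<omega>)) \<in> \<Omega> \<rightarrow>\<^sub>M E \<Otimes>\<^sub>M unif01"
    proof (rule measurable_Pair)
      show "\<Psi> 1 \<in> \<Omega> \<rightarrow>\<^sub>M E" by (rule env_measurable) simp
      show "U 0 1 1 j \<in> \<Omega> \<rightarrow>\<^sub>M unif01"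
        unfolding Uj[abs_def] by (rule measurable_compose[OF U_fam_measurable measurable_component_singleton[OF idx]])
    qed
    have gm [measurable]: "?g \<in> borel_measurable (E \<Otimes>\<^sub>M unif01)"
    proof -
      have [measurable]: "(\<lambda>p. mean_of (fst p) i j) \<in> borel_measurable (E \<Otimes>\<^sub>M unif01)"
        by (rule measurable_compose[OF measurable_fst mean_of_measurable])
      show ?thesis by measurable
    qed
    have \<xi>m [measurable]: "?\<xi> \<in> borel_measurable \<Omega>"
      using measurable_compose[OF p1 count_measurable[of j i]] by (simp add: offspring_def)
    have r1: "AE \<omega> in \<Omega>. real_cond_exp \<Omega> \<F> ?\<xi> \<omega> = mean_of (\<Psi> 1 \<omega>) i j"
    proof -
      have "AE \<omega> in \<Omega>. real_cond_exp \<Omega> \<F> (\<lambda>\<omega>. real (fst (\<Psi> 1 \<omega>, U 0 1 1 j \<omega>) j (snd (\<Psi> 1 \<omega>, U 0 1 1 j \<omega>)) $ i)) \<omega>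
        = enn2real (\<integral>\<^sup>+t. ennreal (real (fst (\<Psi> 1 \<omega>, t) j (snd (\<Psi> 1 \<omega>, t)) $ i)) \<partial>unif01)"
        by (rule real_cond_exp_offspring[of 1 "\<lambda>p. real (fst p j (snd p) $ i)"]) (simp, measurable)
      then show ?thesis using AE_space
      proof eventually_elim
        case (elim \<omega>)
        have [measurable]: "(\<lambda>t. real (\<Psi> 1 \<omega> j t $ i)) \<in> borel_measurable unif01"
          by (rule measurable_compose[OF section_measurable]) (use measurable_space[OF env_measurable[OF order_refl]] elim in auto)
        show ?case using elim(1) by (simp add: offspring_def mean_of_def integral_eq_nn_integral)
      qed
    qed
    \<comment> \<open>The inner conditional mean may be replaced by \<open>mean_of\<close>, which
      depends on the environment alone.\<close>
    have "AE \<omega> in \<Omega>. real_cond_exp \<Omega> \<F> (\<lambda>\<omega>. (?\<xi> \<omega> - real_cond_exp \<Omega> \<F> ?\<xi> \<omega>) * (?\<xi> \<omega> - real_cond_exp \<Omega> \<F> ?\<xi> \<omega>)) \<omega>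
       = real_cond_exp \<Omega> \<F> (\<lambda>\<omega>. ?g (\<Psi> 1 \<omega>, U 0 1 1 j \<omega>)) \<omega>"
    proof (rule F.real_cond_exp_cong)
      show "AE \<omega> in \<Omega>. (?\<xi> \<omega> - real_cond_exp \<Omega> \<F> ?\<xi> \<omega>) * (?\<xi> \<omega> - real_cond_exp \<Omega> \<F> ?\<xi> \<omega>) = ?g (\<Psi> 1 \<omega>, U 0 1 1 j \<omega>)"
        using r1 by eventually_elim (simp add: offspring_def power2_eq_square)
      show "(\<lambda>\<omega>. ?g (\<Psi> 1 \<omega>, U 0 1 1 j \<omega>)) \<in> borel_measurable \<Omega>"
        by (rule measurable_compose[OF p1 gm])
    qed measurable
    moreover have "AE \<omega> in \<Omega>. real_cond_exp \<Omega> \<F> (\<lambda>\<omega>. ?g (\<Psi> 1 \<omega>, U 0 1 1 j \<omega>)) \<omega>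
       = enn2real (\<integral>\<^sup>+t. ennreal (?g (\<Psi> 1 \<omega>, t)) \<partial>unif01)"
      by (rule real_cond_exp_offspring[of 1 ?g]) (simp, rule gm, simp)
    ultimately show "AE \<omega> in \<Omega>. cond_cov_matrix \<Omega> \<F> (\<lambda>i \<omega>. real (offspring \<Psi> U 0 1 1 i j \<omega>)) \<omega> $ i $ i
     = enn2real (\<integral>\<^sup>+t. ennreal ((real (\<Psi> 1 \<omega> j t $ i) - mean_of (\<Psi> 1 \<omega>) i j)\<^sup>2) \<partial>unif01)"
      by eventually_elim (simp add: cond_cov_matrix_def)
  qed
  have "AE \<omega> in \<Omega>. square_bounded (real \<gamma>) (\<Psi> 1 \<omega>)"
    using \<gamma> fin sq cov AE_space
  proof eventually_elim
    case (elim \<omega>)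
    show ?case
      unfolding square_bounded_def
    proof (intro allI conjI)
      fix i j
      let ?X = "\<lambda>t. real (\<Psi> 1 \<omega> j t $ i)"
      have X [measurable]: "?X \<in> borel_measurable unif01"
        by (rule measurable_compose[OF section_measurable]) (use measurable_space[OF env_measurable[OF order_refl]] elim in auto)
      show f: "(\<integral>\<^sup>+t. ennreal ((?X t)\<^sup>2) \<partial>unif01) < \<infinity>" using elim(2,3) by metis
      have i2: "integrable unif01 (\<lambda>t. (?X t)\<^sup>2)" by (rule integrableI_nonneg) (use f in auto)
      have i1: "integrable unif01 ?X" by (rule unif.square_integrable_imp_integrable[OF X i2])
      have "integrable unif01 (\<lambda>t. (?X t - mean_of (\<Psi> 1 \<omega>) i j)\<^sup>2)" using i1 i2 by (simp add: power2_diff)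
      \<comment> \<open>Finiteness comes first: \<open>enn2real\<close> sends an infinite integral
        to 0, so a bound on its value alone would say nothing.\<close>
      then have "(\<integral>\<^sup>+t. ennreal ((?X t - mean_of (\<Psi> 1 \<omega>) i j)\<^sup>2) \<partial>unif01) < \<top>"
        by (simp add: nn_integral_eq_integral)
      then have "(\<integral>\<^sup>+t. ennreal ((?X t - mean_of (\<Psi> 1 \<omega>) i j)\<^sup>2) \<partial>unif01)
        = ennreal (enn2real (\<integral>\<^sup>+t. ennreal ((?X t - mean_of (\<Psi> 1 \<omega>) i j)\<^sup>2) \<partial>unif01))" by simp
      also have "\<dots> \<le> ennreal (real \<gamma>)"
      proof (rule ennreal_leI)
        let ?C = "cond_cov_matrix \<Omega> \<F> (\<lambda>i \<omega>. real (offspring \<Psi> U 0 1 1 i j \<omega>)) \<omega>"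
        have "enn2real (\<integral>\<^sup>+t. ennreal ((?X t - mean_of (\<Psi> 1 \<omega>) i j)\<^sup>2) \<partial>unif01) = ?C $ i $ i" using elim(4) by simp
        also have "\<dots> \<le> matnorm ?C" using diag_le_matnorm[of ?C i] by simp
        also have "\<dots> \<le> real \<gamma>" using elim(1) by simp
        finally show "enn2real (\<integral>\<^sup>+t. ennreal ((?X t - mean_of (\<Psi> 1 \<omega>) i j)\<^sup>2) \<partial>unif01) \<le> real \<gamma>" .
      qed
      finally show "(\<integral>\<^sup>+t. ennreal ((?X t - mean_of (\<Psi> 1 \<omega>) i j)\<^sup>2) \<partial>unif01) \<le> ennreal (real \<gamma>)" .
    qed
  qed
  then show ?thesis by (intro exI[of _ "real \<gamma>"]) simp
qed

lemma AE_quenched: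
  "\<exists>\<gamma>\<ge>0. AE \<omega> in \<Omega>. quenched_branching (\<lambda>n. \<Psi> n \<omega>) (\<lambda>n. A n \<omega>) \<gamma>"
proof -
  obtain \<gamma> where \<gamma>: "0 \<le> \<gamma>" "AE \<omega> in \<Omega>. square_bounded \<gamma> (\<Psi> 1 \<omega>)" using square_bounded_first by blast
  have sb: "{\<psi> \<in> space E. square_bounded \<gamma> \<psi>} \<in> sets E" using square_bounded_measurable by measurable
  \<comment> \<open>The bound is given for time 1 and transferred through the common law of the
    environments.\<close>
  have "AE \<omega> in \<Omega>. square_bounded \<gamma> (\<Psi> n \<omega>)" if n: "1 \<le> n" for n
  proof -
    have "AE \<psi> in distr \<Omega> E (\<Psi> 1). square_bounded \<gamma> \<psi>"
      using \<gamma>(2) by (subst AE_distr_iff[OF env_measurable[OF order_refl] sb])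
    then have "AE \<psi> in distr \<Omega> E (\<Psi> n). square_bounded \<gamma> \<psi>" unfolding env_distr[OF n] .
    then show ?thesis by (rule AE_distrD[OF env_measurable[OF n]])
  qed
  then have "AE \<omega> in \<Omega>. \<forall>n. 1 \<le> n \<longrightarrow> square_bounded \<gamma> (\<Psi> n \<omega>)"
    unfolding AE_all_countable by (auto intro: AE_I2)
  moreover have "AE \<omega> in \<Omega>. \<forall>n i j. 1 \<le> n \<longrightarrow>
      integrable unif01 (\<lambda>t. real (\<Psi> n \<omega> j t $ i)) \<and> mean_of (\<Psi> n \<omega>) i j = A n \<omega> $ i $ j"
    unfolding AE_all_countable
  proof (intro allI)
    fix n i j
    show "AE \<omega> in \<Omega>. 1 \<le> n \<longrightarrow> integrable unif01 (\<lambda>t. real (\<Psi> n \<omega> j t $ i)) \<and> mean_of (\<Psi> n \<omega>) i j = A n \<omega> $ i $ j"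
      using mean_eq[of n j i] by (cases "1 \<le> n") auto
  qed
  ultimately have "AE \<omega> in \<Omega>. quenched_branching (\<lambda>n. \<Psi> n \<omega>) (\<lambda>n. A n \<omega>) \<gamma>"
    using AE_space
  proof eventually_elim
    case (elim \<omega>)
    have X: "(\<lambda>t. real (\<Psi> n \<omega> j t $ i)) \<in> borel_measurable unif01" if "1 \<le> n" for n i j
      by (rule measurable_compose[OF section_measurable]) (use measurable_space[OF env_measurable[OF that]] elim in auto)
    show ?case
    proof
      show "\<Psi> n \<omega> j \<in> unif01 \<rightarrow>\<^sub>M count_space UNIV" if "1 \<le> n" for n j
        using measurable_space[OF env_measurable[OF that]] elim by (intro section_measurable) auto
      fix n :: nat and i j :: 'd assume n: "1 \<le> n"
      note [measurable] = X[OF n]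
      have sq: "(\<integral>\<^sup>+t. ennreal ((real (\<Psi> n \<omega> j t $ i))\<^sup>2) \<partial>unif01) < \<infinity>"
        "(\<integral>\<^sup>+t. ennreal ((real (\<Psi> n \<omega> j t $ i) - mean_of (\<Psi> n \<omega>) i j)\<^sup>2) \<partial>unif01) \<le> ennreal \<gamma>"
        using elim(1) n unfolding square_bounded_def by auto
      show "integrable unif01 (\<lambda>t. (real (\<Psi> n \<omega> j t $ i))\<^sup>2)"
        by (rule integrableI_nonneg) (use sq in auto)
      show m: "(\<integral>t. real (\<Psi> n \<omega> j t $ i) \<partial>unif01) = A n \<omega> $ i $ j"
        using elim(2) n unfolding mean_of_def by blast
      have "(\<integral>t. (real (\<Psi> n \<omega> j t $ i) - A n \<omega> $ i $ j)\<^sup>2 \<partial>unif01)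
         = enn2real (\<integral>\<^sup>+t. ennreal ((real (\<Psi> n \<omega> j t $ i) - A n \<omega> $ i $ j)\<^sup>2) \<partial>unif01)"
        by (rule integral_eq_nn_integral) auto
      also have "\<dots> \<le> \<gamma>"
        using sq(2) \<gamma>(1) elim(2) n by (intro enn2real_leI) auto
      finally show "(\<integral>t. (real (\<Psi> n \<omega> j t $ i) - A n \<omega> $ i $ j)\<^sup>2 \<partial>unif01) \<le> \<gamma>" .
    qed
  qed
  with \<gamma>(1) show ?thesis by blast
qed

text \<open>The branching process as a function of uniforms and environment on the product space,
  with the initial state 0 built in, so that the environment can be frozen.\<close>

definition canonical_Z :: "nat \<Rightarrow> (nat \<times> nat \<times> nat \<times> 'd \<Rightarrow> real) \<times> (nat \<Rightarrow> 'd env) \<times> (nat \<Rightarrow> real ^ 'd) \<Rightarrow> nat ^ 'd" where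
  "canonical_Z n = branching_process (\<lambda>n p. fst (snd p) n) (\<lambda>m n k j p. fst p (m, n, k, j))
     (\<lambda>n p. if n = 0 then 0 else snd (snd p) n) n"

lemma canonical_Z_measurable [measurable]: "canonical_Z n \<in> U_space \<Otimes>\<^sub>M env_Y_space \<rightarrow>\<^sub>M count_space UNIV"
  unfolding canonical_Z_def branching_process_def
proof (intro measurable_sum_count_space measurable_family_after)
  fix m n' k :: nat and j :: 'd assume a: "m < n'" "1 \<le> k"
  have "(\<lambda>p. fst (snd p) n') \<in> U_space \<Otimes>\<^sub>M env_Y_space \<rightarrow>\<^sub>M E"
    by (rule measurable_compose[OF measurable_compose[OF measurable_snd measurable_fst] measurable_component_singleton])
      (use a in simp)
  moreover have "(\<lambda>p. fst p (m, n', k, j)) \<in> U_space \<Otimes>\<^sub>M env_Y_space \<rightarrow>\<^sub>M unif01"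
    by (rule measurable_compose[OF measurable_fst measurable_component_singleton]) (use a in \<open>auto simp: U_index_def\<close>)
  ultimately have "(\<lambda>p. (fst (snd p) n', fst p (m, n', k, j))) \<in> U_space \<Otimes>\<^sub>M env_Y_space \<rightarrow>\<^sub>M E \<Otimes>\<^sub>M unif01"
    by (rule measurable_Pair)
  from measurable_compose[OF this eval_measurable'[of j]]
  show "(\<lambda>p. fst (snd p) n' j (fst p (m, n', k, j))) \<in> U_space \<Otimes>\<^sub>M env_Y_space \<rightarrow>\<^sub>M count_space UNIV" by simp
next
  fix m
  have "(\<lambda>p. snd (snd p) m) \<in> borel_measurable (U_space \<Otimes>\<^sub>M env_Y_space)"
    by (rule measurable_compose[OF measurable_compose[OF measurable_snd measurable_snd] measurable_component_singleton]) simp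
  then show "(\<lambda>p. if m = 0 then 0 else snd (snd p) m) \<in> borel_measurable (U_space \<Otimes>\<^sub>M env_Y_space)"
    by (cases "m = 0") auto
qed

abbreviation qfam :: "'w \<Rightarrow> nat \<Rightarrow> nat \<Rightarrow> (nat \<times> nat \<times> nat \<times> 'd \<Rightarrow> real) \<Rightarrow> nat ^ 'd" where
  "qfam \<omega> \<equiv> quenched_branching.fam (\<lambda>n. \<Psi> n \<omega>) (\<lambda>n. start_at_zero Y n \<omega>)"

lemma branching_process_eq: "branching_process \<Psi> U (start_at_zero Y) n \<omega> = canonical_Z n (U_fam \<omega>, env_Y \<omega>)"
  unfolding canonical_Z_def branching_process_def
  by (intro sum.cong refl family_after_cong) (auto simp: U_fam_def env_Y_def U_index_def start_at_zero_def)

lemma canonical_Z_eq: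
  assumes "quenched_branching (\<lambda>n. \<Psi> n \<omega>) a \<gamma>"
  shows "canonical_Z n (u, env_Y \<omega>) = (\<Sum>m=0..n. qfam \<omega> m (n - m) u)"
  unfolding canonical_Z_def branching_process_def quenched_branching.fam_def[OF assms]
  by (intro sum.cong refl family_after_cong) (auto simp: env_Y_def start_at_zero_def)

lemma branching_prob:
  "ennreal (\<P>(\<omega> in \<Omega>. infnorm (\<chi> i. real (branching_process \<Psi> U (start_at_zero Y) n \<omega> $ i)) \<le> b))
    = (\<integral>\<^sup>+\<omega>. emeasure U_space {u \<in> space U_space. infnorm (real_vec (canonical_Z n (u, env_Y \<omega>))) \<le> b} \<partial>\<Omega>)"
proof -
  let ?H = "{p \<in> space (U_space \<Otimes>\<^sub>M env_Y_space). infnorm (real_vec (canonical_Z n p)) \<le> b}"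
  have H [measurable]: "?H \<in> sets (U_space \<Otimes>\<^sub>M env_Y_space)"
  proof -
    have "(\<lambda>p. infnorm (real_vec (canonical_Z n p))) \<in> borel_measurable (U_space \<Otimes>\<^sub>M env_Y_space)"
      by (rule measurable_compose[OF canonical_Z_measurable]) simp
    then show ?thesis by measurable
  qed
  have m [measurable]: "(\<lambda>\<omega>. (U_fam \<omega>, env_Y \<omega>)) \<in> \<Omega> \<rightarrow>\<^sub>M U_space \<Otimes>\<^sub>M env_Y_space" by measurable
  have e: "{\<omega> \<in> space \<Omega>. infnorm (\<chi> i. real (branching_process \<Psi> U (start_at_zero Y) n \<omega> $ i)) \<le> b}
     = (\<lambda>\<omega>. (U_fam \<omega>, env_Y \<omega>)) -` ?H \<inter> space \<Omega>"
    using measurable_space[OF m] by (auto simp: branching_process_eq real_vec_def)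
  have "ennreal (\<P>(\<omega> in \<Omega>. infnorm (\<chi> i. real (branching_process \<Psi> U (start_at_zero Y) n \<omega> $ i)) \<le> b))
     = emeasure \<Omega> ((\<lambda>\<omega>. (U_fam \<omega>, env_Y \<omega>)) -` ?H \<inter> space \<Omega>)"
    by (simp add: e Om.emeasure_eq_measure)
  also have "\<dots> = (\<integral>\<^sup>+\<omega>. indicator ((\<lambda>\<omega>. (U_fam \<omega>, env_Y \<omega>)) -` ?H \<inter> space \<Omega>) \<omega> \<partial>\<Omega>)"
    by (rule nn_integral_indicator[symmetric]) (rule measurable_sets[OF m H])
  also have "\<dots> = (\<integral>\<^sup>+\<omega>. indicator ?H (U_fam \<omega>, env_Y \<omega>) \<partial>\<Omega>)"
    by (intro nn_integral_cong) (simp add: indicator_def)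
  also have "\<dots> = (\<integral>\<^sup>+\<omega>. \<integral>\<^sup>+u. indicator ?H (u, env_Y \<omega>) \<partial>U_space \<partial>\<Omega>)"
    by (rule quenched_integral) measurable
  also have "\<dots> = (\<integral>\<^sup>+\<omega>. emeasure U_space {u \<in> space U_space. infnorm (real_vec (canonical_Z n (u, env_Y \<omega>))) \<le> b} \<partial>\<Omega>)"
  proof (intro nn_integral_cong)
    fix \<omega> assume \<omega>: "\<omega> \<in> space \<Omega>"
    have s: "{u \<in> space U_space. infnorm (real_vec (canonical_Z n (u, env_Y \<omega>))) \<le> b} = (\<lambda>u. (u, env_Y \<omega>)) -` ?H \<inter> space U_space"
      using measurable_space[OF env_Y_measurable \<omega>] by (auto simp: space_pair_measure)
    have "(\<lambda>u. (u, env_Y \<omega>)) \<in> U_space \<rightarrow>\<^sub>M U_space \<Otimes>\<^sub>M env_Y_space"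
      using measurable_space[OF env_Y_measurable \<omega>] by measurable
    from measurable_sets[OF this H]
    show "(\<integral>\<^sup>+u. indicator ?H (u, env_Y \<omega>) \<partial>U_space) = emeasure U_space {u \<in> space U_space. infnorm (real_vec (canonical_Z n (u, env_Y \<omega>))) \<le> b}"
      unfolding s by (subst nn_integral_indicator[symmetric], assumption) (intro nn_integral_cong, simp add: indicator_def)
  qed
  finally show ?thesis .
qed

lemma real_vec_sum: "real_vec (\<Sum>m\<in>I. f m) = (\<Sum>m\<in>I. real_vec (f m))"
  by (simp add: real_vec_def vec_eq_iff)

lemma vsum_sum: "vsum (\<Sum>m\<in>I. f m) = (\<Sum>m\<in>I. vsum (f m))"
  unfolding vsum_def by (simp add: sum.swap[of _ _ I])

text \<open>A small total forces every single family to be small. In a frozen environment these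
  events are independent, and the product of their probabilities is bounded by the functional of the
  reversed past.\<close>

lemma not_branching_recurrent:
  assumes \<alpha>: "1/2 < \<alpha>" and fin: "\<And>c. 0 \<le> c \<Longrightarrow> (\<Sum>n. \<integral>\<^sup>+x. survival_bound \<alpha> c n x \<partial>S) \<noteq> \<infinity>"
  shows "\<not> branching_recurrent \<Omega> \<Psi> U Y"
  unfolding branching_recurrent_def
proof (rule not_recurrentI[OF fin])
  fix b :: real assume b: "0 < b"
  define d where "d = vsum (1 :: real ^ 'd)"
  have d: "1 \<le> d" unfolding d_def by (rule vsum_one)
  obtain \<gamma> where \<gamma>: "0 \<le> \<gamma>" "AE \<omega> in \<Omega>. quenched_branching (\<lambda>n. \<Psi> n \<omega>) (\<lambda>n. A n \<omega>) \<gamma>"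
    using AE_quenched by blast
  obtain c where c: "0 \<le> c" "\<And>n x \<psi> a v. good x \<Longrightarrow> (\<forall>m. nonneg_vec (snd (x m))) \<Longrightarrow> quenched_branching \<psi> a \<gamma> \<Longrightarrow>
    (\<forall>i<n. a (n - i) = fst (x i) \<and> v (n - i) = snd (x i)) \<Longrightarrow>
    ennreal (\<Prod>m<n. measure U_space {u \<in> space U_space. vsum (real_vec (quenched_branching.fam \<psi> v (n - m) m u)) \<le> d * b})
      \<le> survival_bound \<alpha> c n x"
    using survival_bound_branching[OF \<alpha> \<gamma>(1), of "d * b"] by blast
  have "ennreal (\<P>(\<omega> in \<Omega>. infnorm (\<chi> i. real (branching_process \<Psi> U (start_at_zero Y) n \<omega> $ i)) \<le> b))
      \<le> (\<integral>\<^sup>+\<omega>. survival_bound \<alpha> c n (past n \<omega>) \<partial>\<Omega>)" for n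
    unfolding branching_prob
  proof (rule nn_integral_mono_AE)
    show "AE \<omega> in \<Omega>. emeasure U_space {u \<in> space U_space. infnorm (real_vec (canonical_Z n (u, env_Y \<omega>))) \<le> b}
       \<le> survival_bound \<alpha> c n (past n \<omega>)"
      using \<gamma>(2) AE_past[OF AE_good_nonneg, of n]
    proof eventually_elim
      case (elim \<omega>)
      interpret q: quenched_branching "\<lambda>n. \<Psi> n \<omega>" "\<lambda>n. A n \<omega>" \<gamma> "\<lambda>n. start_at_zero Y n \<omega>" by (rule elim(1))
      have "vsum (real_vec (qfam \<omega> (n - m) m u)) \<le> d * b"
        if u: "infnorm (real_vec (canonical_Z n (u, env_Y \<omega>))) \<le> b" and m: "m < n" for u m
      proof -
        have "vsum (real_vec (qfam \<omega> (n - m) m u)) \<le> (\<Sum>k=0..n. vsum (real_vec (qfam \<omega> k (n - k) u)))"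
          using m member_le_sum[of "n - m" "{0..n}" "\<lambda>k. vsum (real_vec (qfam \<omega> k (n - k) u))"]
          by (simp add: vsum_nonneg[OF nonneg_real_vec])
        also have "\<dots> = vsum (real_vec (canonical_Z n (u, env_Y \<omega>)))"
          by (simp add: canonical_Z_eq[OF elim(1)] real_vec_sum vsum_sum)
        also have "\<dots> \<le> d * infnorm (real_vec (canonical_Z n (u, env_Y \<omega>)))"
          unfolding d_def by (rule infnorm_bounds[OF nonneg_real_vec])
        also have "\<dots> \<le> d * b" using u d by (intro mult_left_mono) auto
        finally show ?thesis .
      qed
      then have "emeasure U_space {u \<in> space U_space. infnorm (real_vec (canonical_Z n (u, env_Y \<omega>))) \<le> b}
        \<le> emeasure U_space {u \<in> space U_space. \<forall>m<n. vsum (real_vec (qfam \<omega> (n - m) m u)) \<le> d * b}"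
      proof (intro emeasure_mono)
        have [measurable]: "(\<lambda>u. vsum (real_vec (qfam \<omega> (n - m) m u))) \<in> borel_measurable U_space" for m
          by (rule measurable_compose[OF q.fam_measurable_U]) simp
        show "{u \<in> space U_space. \<forall>m<n. vsum (real_vec (qfam \<omega> (n - m) m u)) \<le> d * b} \<in> sets U_space"
          by measurable
      qed auto
      also have "\<dots> = ennreal (\<Prod>m<n. measure U_space {u \<in> space U_space. vsum (real_vec (qfam \<omega> (n - m) m u)) \<le> d * b})"
        by (simp add: UU.emeasure_eq_measure q.fam_indep_prob)
      also have "\<dots> \<le> survival_bound \<alpha> c n (past n \<omega>)"
      proof (rule c(2))
        show "\<forall>i<n. A (n - i) \<omega> = fst (past n \<omega> i) \<and> start_at_zero Y (n - i) \<omega> = snd (past n \<omega> i)"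
          by (auto simp: past_def reverse_index_def start_at_zero_def)
      qed (use elim in auto)
      finally show ?case .
    qed
  qed
  then show "\<exists>c\<ge>0. \<forall>n. ennreal (\<P>(\<omega> in \<Omega>. infnorm (\<chi> i. real (branching_process \<Psi> U (start_at_zero Y) n \<omega> $ i)) \<le> b))
      \<le> (\<integral>\<^sup>+\<omega>. survival_bound \<alpha> c n (past n \<omega>) \<partial>\<Omega>)"
    using c(1) by blast
qed

text \<open>Given the environment and the immigration, \<open>Z\<^sub>n\<close> has mean at most \<open>X\<^sub>n\<close>, so Markov's inequality applies.\<close>

lemma ar_imp_branching:
  assumes "ar_recurrent \<Omega> A Y"
  shows "branching_recurrent \<Omega> \<Psi> U Y"
proof -
  obtain b where b: "0 < b" "(\<Sum>n. ennreal (\<P>(\<omega> in \<Omega>. infnorm (ar_process A (start_at_zero Y) n \<omega>) \<le> b))) = \<infinity>"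
    using assms by (auto simp: ar_recurrent_def infinite_expected_visits_def)
  define d where "d = vsum (1 :: real ^ 'd)"
  have d: "1 \<le> d" unfolding d_def by (rule vsum_one)
  define B where "B = d * b"
  have B: "0 < B" using d b by (simp add: B_def)
  obtain \<gamma> where \<gamma>: "0 \<le> \<gamma>" "AE \<omega> in \<Omega>. quenched_branching (\<lambda>n. \<Psi> n \<omega>) (\<lambda>n. A n \<omega>) \<gamma>"
    using AE_quenched by blast
  let ?pX = "\<lambda>n. \<P>(\<omega> in \<Omega>. infnorm (ar_process A (start_at_zero Y) n \<omega>) \<le> b)"
  \<comment> \<open>Markov's inequality at twice the bound \<open>B\<close> for the conditional mean
    keeps at least half of the probability.\<close>
  let ?pZ = "\<lambda>n. \<P>(\<omega> in \<Omega>. infnorm (\<chi> i. real (branching_process \<Psi> U (start_at_zero Y) n \<omega> $ i)) \<le> 2 * B)"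
  have "ennreal (1/2) * ennreal (?pX n) \<le> ennreal (?pZ n)" for n
  proof -
    let ?E = "{\<omega> \<in> space \<Omega>. infnorm (ar_process A (start_at_zero Y) n \<omega>) \<le> b}"
    have "ennreal (1/2) * ennreal (?pX n) = (\<integral>\<^sup>+\<omega>. ennreal (1/2) * indicator ?E \<omega> \<partial>\<Omega>)"
      by (subst nn_integral_cmult_indicator) (auto simp: ar_event Om.emeasure_eq_measure)
    also have "\<dots> \<le> (\<integral>\<^sup>+\<omega>. emeasure U_space {u \<in> space U_space. infnorm (real_vec (canonical_Z n (u, env_Y \<omega>))) \<le> 2 * B} \<partial>\<Omega>)"
    proof (rule nn_integral_mono_AE)
      show "AE \<omega> in \<Omega>. ennreal (1/2) * indicator ?E \<omega> \<le> emeasure U_space {u \<in> space U_space. infnorm (real_vec (canonical_Z n (u, env_Y \<omega>))) \<le> 2 * B}"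
        using \<gamma>(2) AE_space
      proof eventually_elim
        case (elim \<omega>)
        show ?case
        proof (cases "\<omega> \<in> ?E")
          case True
          interpret q: quenched_branching "\<lambda>n. \<Psi> n \<omega>" "\<lambda>n. A n \<omega>" \<gamma> "\<lambda>n. start_at_zero Y n \<omega>" by (rule elim(1))
          define V where "V u = vsum (real_vec (canonical_Z n (u, env_Y \<omega>)))" for u
          have V: "V u = (\<Sum>m=0..n. vsum (real_vec (qfam \<omega> m (n - m) u)))" for u
            by (simp add: V_def canonical_Z_eq[OF elim(1)] real_vec_sum vsum_sum)
          have fm [measurable]: "(\<lambda>u. vsum (real_vec (qfam \<omega> m l u))) \<in> borel_measurable U_space" for m l
            by (rule measurable_compose[OF q.fam_measurable_U]) simp
          have [measurable]: "V \<in> borel_measurable U_space" unfolding V[abs_def] by measurable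
          have V0: "0 \<le> V u" for u unfolding V_def by (rule vsum_nonneg[OF nonneg_real_vec])
          have fam_le: "(\<integral>\<^sup>+u. ennreal (vsum (real_vec (qfam \<omega> m (n - m) u))) \<partial>U_space)
             \<le> (if m = 0 then 0 else ennreal (vsum (lprod (\<lambda>i. A (n - i) \<omega>) (n - m) *v Y m \<omega>)))" if m: "m \<le> n" for m
          proof -
            have "(\<integral>\<^sup>+u. ennreal (vsum (real_vec (qfam \<omega> m (n - m) u))) \<partial>U_space)
              = ennreal (vsum (lprod (\<lambda>i. A (m + (n - m) - i) \<omega>) (n - m) *v q.start m))"
              using q.fam_mean[OF nonneg_mat_one, of m "n - m"] by simp
            also have "\<dots> \<le> (if m = 0 then 0 else ennreal (vsum (lprod (\<lambda>i. A (n - i) \<omega>) (n - m) *v Y m \<omega>)))"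
            proof (cases "m = 0")
              case True
              then have "q.start m = 0" by (simp add: q.start_def vec_eq_iff)
              then show ?thesis using True by (simp add: vsum_def)
            next
              case False
              have nY: "nonneg_vec (Y m \<omega>)" using elim by (intro nonneg) auto
              have nP: "nonneg_mat (lprod (\<lambda>i. A (n - i) \<omega>) (n - m))"
                using elim m by (intro nonneg_mat_lprod nonneg) auto
              \<comment> \<open>Immigrants enter through integer parts, which can only lower the
                mean.\<close>
              have "q.start m $ i \<le> Y m \<omega> $ i" for i
                using nY False by (cases m) (auto simp: q.start_def nonneg_vec_def)
              then have "vsum (lprod (\<lambda>i. A (n - i) \<omega>) (n - m) *v q.start m) \<le> vsum (lprod (\<lambda>i. A (n - i) \<omega>) (n - m) *v Y m \<omega>)"
                unfolding vsum_def by (intro sum_mono mult_vec_mono nP)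
              then show ?thesis using False m by (simp add: ennreal_leI)
            qed
            finally show ?thesis .
          qed
          have "(\<integral>\<^sup>+u. ennreal (V u) \<partial>U_space) = (\<Sum>m=0..n. \<integral>\<^sup>+u. ennreal (vsum (real_vec (qfam \<omega> m (n - m) u))) \<partial>U_space)"
          proof -
            have "ennreal (V u) = (\<Sum>m=0..n. ennreal (vsum (real_vec (qfam \<omega> m (n - m) u))))" for u
              unfolding V by (rule sum_ennreal[symmetric]) (rule vsum_nonneg[OF nonneg_real_vec])
            then show ?thesis by (simp only:) (rule nn_integral_sum, measurable)
          qed
          also have "\<dots> \<le> (\<Sum>m=0..n. if m = 0 then 0 else ennreal (vsum (lprod (\<lambda>i. A (n - i) \<omega>) (n - m) *v Y m \<omega>)))"
            by (intro sum_mono fam_le) auto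
          also have "\<dots> = (\<Sum>m\<in>{1..n}. ennreal (vsum (lprod (\<lambda>i. A (n - i) \<omega>) (n - m) *v Y m \<omega>)))"
            by (intro sum.mono_neutral_cong_right) auto
          \<comment> \<open>Change of summation from immigration time to age.\<close>
          also have "\<dots> = (\<Sum>m<n. ennreal (vsum (lprod (\<lambda>i. A (n - i) \<omega>) m *v Y (n - m) \<omega>)))"
            by (rule sum.reindex_bij_witness[of _ "\<lambda>m. n - m" "\<lambda>m. n - m"]) auto
          also have "\<dots> = ennreal (vsum (ar_process A (start_at_zero Y) n \<omega>))"
            unfolding ar_process_eq vsum_sum using elim
            by (intro sum_ennreal vsum_nonneg nonneg_vec_mult nonneg_mat_lprod nonneg) auto
          also have "\<dots> \<le> ennreal B"
          proof (rule ennreal_leI)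
            have "nonneg_vec (ar_process A (start_at_zero Y) n \<omega>)"
              unfolding ar_process_eq nonneg_vec_def sum_component
            proof (intro allI sum_nonneg)
              fix i m assume "m \<in> {..<n}"
              then have "nonneg_vec (lprod (\<lambda>i. A (n - i) \<omega>) m *v Y (n - m) \<omega>)"
                using elim by (intro nonneg_vec_mult nonneg_mat_lprod nonneg) auto
              then show "0 \<le> (lprod (\<lambda>i. A (n - i) \<omega>) m *v Y (n - m) \<omega>) $ i" by (simp add: nonneg_vec_def)
            qed
            then have "vsum (ar_process A (start_at_zero Y) n \<omega>) \<le> d * infnorm (ar_process A (start_at_zero Y) n \<omega>)"
              unfolding d_def by (rule infnorm_bounds)
            also have "\<dots> \<le> B" unfolding B_def using True d by (intro mult_left_mono) auto
            finally show "vsum (ar_process A (start_at_zero Y) n \<omega>) \<le> B" .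
          qed
          finally have EV: "(\<integral>\<^sup>+u. ennreal (V u) \<partial>U_space) \<le> ennreal B" .
          have iV: "integrable U_space V"
            using EV V0 by (intro integrableI_nonneg) (auto simp: le_less_trans)
          have "ennreal (UU.expectation V) \<le> ennreal B"
            using EV nn_integral_eq_integral[OF iV] V0 by simp
          then have EV': "UU.expectation V \<le> B" using B by simp
          have "UU.prob {u \<in> space U_space. 2 * B \<le> V u} \<le> UU.expectation V / (2 * B)"
            using B V0 by (intro integral_Markov_inequality_measure[OF iV]) auto
          also have "\<dots> \<le> 1/2" using EV' B by (simp add: field_simps)
          finally have "1/2 \<le> 1 - UU.prob {u \<in> space U_space. 2 * B \<le> V u}" by simp
          also have "\<dots> = UU.prob (space U_space - {u \<in> space U_space. 2 * B \<le> V u})"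
            by (subst UU.prob_compl) auto
          also have "\<dots> \<le> UU.prob {u \<in> space U_space. infnorm (real_vec (canonical_Z n (u, env_Y \<omega>))) \<le> 2 * B}"
          proof (intro UU.finite_measure_mono subsetI)
            fix u assume "u \<in> space U_space - {u \<in> space U_space. 2 * B \<le> V u}"
            then have "u \<in> space U_space" "V u \<le> 2 * B" by auto
            moreover have "infnorm (real_vec (canonical_Z n (u, env_Y \<omega>))) \<le> V u"
              unfolding V_def by (rule infnorm_bounds[OF nonneg_real_vec])
            ultimately show "u \<in> {u \<in> space U_space. infnorm (real_vec (canonical_Z n (u, env_Y \<omega>))) \<le> 2 * B}" by auto
          next
            have "(\<lambda>u. \<Sum>m=0..n. qfam \<omega> m (n - m) u) \<in> U_space \<rightarrow>\<^sub>M count_space UNIV"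
              by (intro measurable_sum_count_space q.fam_measurable_U)
            then have "(\<lambda>u. infnorm (real_vec (canonical_Z n (u, env_Y \<omega>)))) \<in> borel_measurable U_space"
              unfolding canonical_Z_eq[OF elim(1)] by (rule measurable_compose) simp
            then show "{u \<in> space U_space. infnorm (real_vec (canonical_Z n (u, env_Y \<omega>))) \<le> 2 * B} \<in> sets U_space"
              by measurable
          qed
          finally have "ennreal (1/2) \<le> emeasure U_space {u \<in> space U_space. infnorm (real_vec (canonical_Z n (u, env_Y \<omega>))) \<le> 2 * B}"
            unfolding UU.emeasure_eq_measure by (rule ennreal_leI)
          then show ?thesis using True by (simp del: ennreal_half)
        qed simp
      qed
    qed
    finally show ?thesis unfolding branching_prob .
  qed
  then have "(\<Sum>n. ennreal (1/2) * ennreal (?pX n)) \<le> (\<Sum>n. ennreal (?pZ n))"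
    by (intro suminf_le) auto
  moreover have "(\<Sum>n. ennreal (1/2) * ennreal (?pX n)) = \<infinity>"
    using b(2) by (simp add: ennreal_suminf_cmult ennreal_mult_eq_top_iff del: ennreal_half)
  ultimately have "(\<Sum>n. ennreal (?pZ n)) = \<infinity>" by (simp add: top_unique)
  then show ?thesis
    unfolding branching_recurrent_def infinite_expected_visits_def using B by (intro exI[of _ "2 * B"]) auto
qed

end

section \<open>The equivalences\<close>

theorem theorem5:
  fixes M :: "'w measure"
    and A :: "nat \<Rightarrow> 'w \<Rightarrow> real ^ 'd ^ 'd"
    and Y :: "nat \<Rightarrow> 'w \<Rightarrow> real ^ 'd"
    and lam y :: real
  assumes setting: "random_affine_setting M A Y"
    and BD1: "\<exists>\<gamma>\<^sub>1::nat. 1 \<le> \<gamma>\<^sub>1 \<and> (AE \<omega> in M. matnorm (A 1 \<omega>) \<le> real \<gamma>\<^sub>1)"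
    and PR: "\<exists>\<kappa>>0. \<exists>K\<ge>1. AE \<omega> in M. \<forall>i j. \<kappa> \<le> mat_prod (\<lambda>k. A k \<omega>) K $ i $ j"
    and lambda: "has_decay_rate M A lam" "0 < lam"
    and REG: "\<exists>\<beta>::real. 2/3 < \<beta> \<and> \<beta> < 1 \<and>
      (((\<lambda>x::real. x powr \<beta> * \<P>(\<omega> in M. infnorm (Y 1 \<omega>) > exp x)) \<longlongrightarrow> 0) at_top \<or>
       Liminf at_top (\<lambda>x::real. ereal (x * \<P>(\<omega> in M. infnorm (Y 1 \<omega>) > exp x))) > ereal lam)"
    and y: "0 < y" "\<P>(\<omega> in M. infnorm (Y 1 \<omega>) \<le> y) > 0"
  shows
    "(ar_recurrent M A Y \<longleftrightarrow> max_ar_recurrent M A Y) \<and>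
     (max_ar_recurrent M A Y \<longleftrightarrow>
        (\<Sum>n. ennreal (\<Prod>m=0..n. \<P>(\<omega> in M. infnorm (Y 1 \<omega>) \<le> y * exp (real m * lam)))) = \<infinity>) \<and>
     (\<forall>E \<Psi> U.
        branching_setting M E \<Psi> U Y \<longrightarrow>
        conditional_mean_offspring M E \<Psi> U A \<longrightarrow>
        bounded_offspring_covariance M E \<Psi> U \<longrightarrow>
        (branching_recurrent M \<Psi> U Y \<longleftrightarrow> ar_recurrent M A Y))"
proof -
  obtain G \<kappa> K where env: "iid_environment (distr M pair_borel (\<lambda>\<omega>. (A 1 \<omega>, Y 1 \<omega>))) G \<kappa> lam K"
    using affine_setting_iid_environment[OF setting BD1 PR lambda] by blast
  interpret affine_environment M A Y G \<kappa> lam K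
    by (intro affine_environment.intro env) (unfold_locales, rule setting)
  have Q: "Q t = \<P>(\<omega> in M. infnorm (Y 1 \<omega>) \<le> t)" for t
  proof -
    have V: "(\<lambda>\<omega>. (A 1 \<omega>, Y 1 \<omega>)) \<in> M \<rightarrow>\<^sub>M pair_borel"
      using measurable_A[of 1] measurable_Y[of 1] by measurable
    have s: "{z \<in> space pair_borel. infnorm (snd z) \<le> t} \<in> sets pair_borel" by measurable
    show ?thesis
      unfolding Q_def using measure_distr[OF V s]
      by (simp add: space_pair_measure vimage_def Int_def conj_commute)
  qed
  have Q': "1 - Q t = \<P>(\<omega> in M. t < infnorm (Y 1 \<omega>))" for t
  proof -
    have m: "{\<omega> \<in> space M. infnorm (Y 1 \<omega>) \<le> t} \<in> sets M"
      using measurable_Y[of 1] by measurable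
    have "{\<omega> \<in> space M. t < infnorm (Y 1 \<omega>)} = space M - {\<omega> \<in> space M. infnorm (Y 1 \<omega>) \<le> t}" by auto
    then show ?thesis unfolding Q by (simp only: Om.prob_compl[OF m])
  qed
  let ?R = "\<Sum>n. ennreal (\<Prod>m=0..n. \<P>(\<omega> in M. infnorm (Y 1 \<omega>) \<le> y * exp (real m * lam)))"
  \<comment> \<open>\<open>Q\<close> and \<open>Q'\<close> express the dichotomy on the given space.
    It stays general in \<open>c\<close>, since each bound on the norm requires its own
    slack.\<close>
  obtain \<alpha> where \<alpha>: "1/2 < \<alpha>"
    and fin: "?R \<noteq> \<infinity> \<Longrightarrow> 0 \<le> c \<Longrightarrow> (\<Sum>n. \<integral>\<^sup>+x. survival_bound \<alpha> c n x \<partial>S) \<noteq> \<infinity>"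
    and inf: "?R = \<infinity> \<Longrightarrow> \<exists>B>0. (\<Sum>n. ennreal (P.prob {x \<in> space S.
       vsum (\<Sum>m<n. lprod (\<lambda>i. fst (x i)) m *v snd (x m)) \<le> B})) = \<infinity>" for c
    using dichotomy[of y] REG y unfolding Q' unfolding Q by blast
  have 1: "?R = \<infinity> \<Longrightarrow> ar_recurrent M A Y" using inf ar_recurrentI by blast
  have 2: "?R \<noteq> \<infinity> \<Longrightarrow> \<not> max_ar_recurrent M A Y" using not_max_ar_recurrent[OF \<alpha>] fin by blast
  have 3: "branching_recurrent M \<Psi> U Y \<longleftrightarrow> ar_recurrent M A Y"
    if "branching_setting M E \<Psi> U Y" "conditional_mean_offspring M E \<Psi> U A" "bounded_offspring_covariance M E \<Psi> U"
    for E \<Psi> U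
  proof -
    interpret branching_environment M A Y G \<kappa> lam K E \<Psi> U
      by unfold_locales (fact that)+
    have "?R \<noteq> \<infinity> \<Longrightarrow> \<not> branching_recurrent M \<Psi> U Y" using not_branching_recurrent[OF \<alpha>] fin by blast
    then show ?thesis using 1 ar_imp_branching by blast
  qed
  \<comment> \<open>Divergence gives the autoregressive process, which gives the other two;
    convergence excludes the max process, hence also the autoregressive one.\<close>
  show ?thesis using 1 2 3 ar_imp_max_ar by blast
qed

end
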